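(* Let $\mathfrak d$ be a real vector space of dimension $n$, and let $\Delta\subset\mathfrak d^*$ be a simple convex polytope of dimension $n$ with $d$ facets. Choose inward-pointing normals $X_1,\ldots,X_d\in\mathfrak d$ to the facets of $\Delta$, so that $\Delta=\bigcap_{j=1}^d\{\mu\in\mathfrak d^*\mid\langle\mu,X_j\rangle\ge\lambda_j\}$ for some real numbers $\lambda_1,\ldots,\lambda_d$, and let $Q\subset\mathfrak d$ be a quasilattice containing $X_1,\ldots,X_d$. Let $N_{\mathbb C}\subset T^d_{\mathbb C}=\mathbb C^d/\mathbb Z^d$ and $\mathbb C^d_\Delta\subset\mathbb C^d$ be the corresponding group and space. Then the quotient space $\mathbb C^d_\Delta/N_{\mathbb C}$ (with the quotient topology) is a complex quasifold of dimension $n$. The complex quasitorus $\mathfrak d_{\mathbb C}/Q\cong T^d_{\mathbb C}/N_{\mathbb C}$ acts on $\mathbb C^d_\Delta/N_{\mathbb C}$ (the action induced by the standard action of $T^d_{\mathbb C}$ on $\mathbb C^d_\Delta$); this action is holomorphic and has a dense open orbit.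
   Context: **Polytope data.** A polytope of dimension $n$ is simple if exactly $n$ edges stem from each vertex. A quasilattice $Q$ in $\mathfrak d$ is the $\mathbb Z$-span of a set of vectors spanning $\mathfrak d$. Put $\mathfrak d_{\mathbb C}=\mathfrak d+i\mathfrak d$; $Q$ acts on it by $A\cdot(X+iY)=(X+A)+iY$. The complex quasitorus of dimension $n$ determined by $Q$ is the group $\mathfrak d_{\mathbb C}/Q$; it is a complex quasifold (see below) covered by the single chart $\mathfrak d_{\mathbb C}\to\mathfrak d_{\mathbb C}/Q$. Let $\pi_{\mathbb C}:\mathbb C^d\to\mathfrak d_{\mathbb C}$ be the complex linear surjection $e_j\mapsto X_j$. It induces a group homomorphism $\Pi_{\mathbb C}:T^d_{\mathbb C}=\mathbb C^d/\mathbb Z^d\to\mathfrak d_{\mathbb C}/Q$; let $N_{\mathbb C}=\ker\Pi_{\mathbb C}$. Then $\Pi_{\mathbb C}$ induces an isomorphism $T^d_{\mathbb C}/N_{\mathbb C}\cong\mathfrak d_{\mathbb C}/Q$. The group $T^d_{\mathbb C}$ acts on $\mathbb C^d$ by $[Z]\cdot(z_1,\ldots,z_d)=(e^{2\pi iZ_1}z_1,\ldots,e^{2\pi iZ_d}z_d)$. For a nonempty face $F$ of $\Delta$ (including $\Delta$ itself), let $I_F\subset\{1,\ldots,d\}$ be the set of indices $j$ with $\langle\mu,X_j\rangle=\lambda_j$ for all $\mu\in F$; put $\mathbb C^d_F=\{(z_1,\ldots,z_d)\in\mathbb C^d\mid z_j=0\text{ iff }j\in I_F\}$ and $\mathbb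 C^d_\Delta=\bigcup_F\mathbb C^d_F$. **Complex models.** A complex model of dimension $k$ is a triple $(\tilde V/\Gamma,p,\tilde V)$, where $\tilde V$ is a connected, simply connected complex manifold of dimension $k$, $\Gamma$ is a discrete group acting holomorphically on $\tilde V$ such that the set of points where the action is free is connected and dense, $\tilde V/\Gamma$ has the quotient topology, and $p:\tilde V\to\tilde V/\Gamma$ is the projection. If $\tilde V$ satisfies all of this except simple connectedness, let $\varpi:V^\#\to\tilde V$ be the universal cover and let $\Lambda=\{\lambda\in\mathrm{Diff}(V^\#)\mid\exists\gamma\in\Gamma\ \forall u\in V^\#:\ \varpi(\lambda(u))=\gamma\cdot\varpi(u)\}$; then $\tilde V/\Gamma=V^\#/\Lambda$, and one regards this space as the model given by $V^\#$ and $\Lambda$. An open set $W\subset\tilde V/\Gamma$ is a submodel if $(W,p,p^{-1}(W))$, with $\Gamma$ acting on $p^{-1}(W)$, is a model in this sense (passing to the universal cover of $p^{-1}(W)$ if necessary). A map $f:\tilde V/\Gamma\to\tilde W/\Delta'$ of models, with projections $p,q$, is holomorphic if there is a holomorphic map $\tilde f:\tilde V\to\tilde W$ (a lift) with $q\circ\tilde f=f\circ p$; it is a biholomorphism of models if it is bijective and the lift $\tilde f$ is a biholomorphism. **Complex quasifolds.** A complex quasifold structure of dimension $k$ on a topological space $M$ is an atlas $\mathcal A=\{(V_\alpha,\phi_\alpha,\tilde V_\alpha/\Gamma_\alpha)\}$ such that: (1) the $V_\alpha$ cover $M$; (2) each $V_\alpha\subset M$ is open, $\tilde V_\alpha/\Gamma_\alpha$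 is a model with $\tilde V_\alpha$ an open, connected, simply connected subset of $\mathbb C^k$, and $\phi_\alpha:\tilde V_\alpha/\Gamma_\alpha\to V_\alpha$ is a homeomorphism; (3) whenever $V_\alpha\cap V_\beta\ne\emptyset$, the sets $\phi_\alpha^{-1}(V_\alpha\cap V_\beta)$ and $\phi_\beta^{-1}(V_\alpha\cap V_\beta)$ are submodels and $\phi_\beta^{-1}\circ\phi_\alpha$ is a biholomorphism of models between them (the charts are then called compatible); (4) $\mathcal A$ is maximal: any triple satisfying (2) and compatible with all charts of $\mathcal A$ belongs to $\mathcal A$. A continuous map $f:M\to M'$ of complex quasifolds is holomorphic if for each $m\in M$ there are a chart $(V,\phi,\tilde V/\Gamma)$ around $m$, a chart $(W,\psi,\tilde W/\Delta')$ around $f(m)$, and a holomorphic map of models $f_m:\tilde V/\Gamma\to\tilde W/\Delta'$ with $\psi\circ f_m=f\circ\phi$. A product of complex quasifolds is a complex quasifold with product charts. A holomorphic action of a complex quasitorus $D_{\mathbb C}$ on $M$ is a group action $D_{\mathbb C}\times M\to M$ which is a holomorphic map. *)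

theory Defs
  imports "HOL-Analysis.Analysis" "HOL-Algebra.Group_Action"
begin

section \<open>Topological preliminaries\<close>

definition quotient_topology :: "'a topology \<Rightarrow> ('a \<Rightarrow> 'b) \<Rightarrow> 'b topology" where
  "quotient_topology T p =
     topology (\<lambda>U. U \<subseteq> p ` topspace T \<and> openin T {x \<in> topspace T. p x \<in> U})"

lemma openin_quotient_topology:
  "openin (quotient_topology T p) U \<longleftrightarrow>
     U \<subseteq> p ` topspace T \<and> openin T {x \<in> topspace T. p x \<in> U}"
proof -
  let ?L = "\<lambda>U. U \<subseteq> p ` topspace T \<and> openin T {x \<in> topspace T. p x \<in> U}"
  have "istopology ?L"
    unfolding istopology_def
  proof (intro conjI allI impI)
    fix S R assume "?L S" "?L R"
    moreover have "{x \<in> topspace T. p x \<in> S \<inter> R} =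
        {x \<in> topspace T. p x \<in> S} \<inter> {x \<in> topspace T. p x \<in> R}"
      by blast
    ultimately show "S \<inter> R \<subseteq> p ` topspace T"
      and "openin T {x \<in> topspace T. p x \<in> S \<inter> R}"
      by auto
  next
    fix \<K> assume K: "\<forall>K\<in>\<K>. ?L K"
    have "{x \<in> topspace T. p x \<in> \<Union>\<K>} = (\<Union>K\<in>\<K>. {x \<in> topspace T. p x \<in> K})"
      by blast
    then show "openin T {x \<in> topspace T. p x \<in> \<Union>\<K>}"
      using K by (metis (no_types, lifting) openin_Union imageE)
    show "\<Union>\<K> \<subseteq> p ` topspace T"
      using K by blast
  qed
  then show ?thesis
    by (simp add: quotient_topology_def)
qed

lemma quotient_map_quotient_topology:
  "quotient_map T (quotient_topology T p) p"
proof -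
  have "topspace (quotient_topology T p) = p ` topspace T"
  proof
    show "topspace (quotient_topology T p) \<subseteq> p ` topspace T"
      using openin_topspace openin_quotient_topology by metis
    have "{x \<in> topspace T. p x \<in> p ` topspace T} = topspace T"
      by blast
    then have "openin (quotient_topology T p) (p ` topspace T)"
      by (simp add: openin_quotient_topology)
    then show "p ` topspace T \<subseteq> topspace (quotient_topology T p)"
      by (rule openin_subset)
  qed
  then show ?thesis
    by (auto simp: quotient_map_def openin_quotient_topology)
qed

text \<open>The library notions \<open>simply_connected\<close> and \<open>covering_space\<close> concern subsets of a
  topological space type. Universal covers need them for abstract topologies.\<close>

definition simply_connected_space :: "'a topology \<Rightarrow> bool" where
  "simply_connected_space T \<longleftrightarrow>
     (\<forall>p q. pathin T p \<and> p 1 = p 0 \<and> pathin T q \<and> q 1 = q 0 \<longrightarrow>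
        homotopic_with (\<lambda>r. r 1 = r 0) (top_of_set {0..1}) T p q)"

definition covering_map :: "'a topology \<Rightarrow> 'b topology \<Rightarrow> ('a \<Rightarrow> 'b) \<Rightarrow> bool" where
  "covering_map T T' w \<longleftrightarrow>
     continuous_map T T' w \<and> w ` topspace T = topspace T' \<and>
     (\<forall>x\<in>topspace T'. \<exists>U. x \<in> U \<and> openin T' U \<and>
        (\<exists>\<V>. \<Union>\<V> = {u \<in> topspace T. w u \<in> U} \<and> (\<forall>V\<in>\<V>. openin T V) \<and> disjoint \<V> \<and>
             (\<forall>V\<in>\<V>. homeomorphic_map (subtopology T V) (subtopology T' U) w)))"

section \<open>Complex manifolds\<close>

definition holomorphic_vec_on ::
  "(complex^'k \<Rightarrow> complex^'l) \<Rightarrow> (complex^'k) set \<Rightarrow> bool" where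
  "holomorphic_vec_on f S \<longleftrightarrow>
     (\<forall>z\<in>S. \<exists>f'. (f has_derivative f') (at z) \<and> (\<forall>c v. f' (c *s v) = c *s f' v))"

text \<open>The dimension is the cardinality of the index type \<open>'k\<close>.\<close>

record ('a, 'k::finite) cmfd =
  mtop :: "'a topology"
  mcharts :: "('a set \<times> ('a \<Rightarrow> complex^'k)) set"

definition complex_manifold :: "('a, 'k::finite) cmfd \<Rightarrow> bool" where
  "complex_manifold M \<longleftrightarrow>
     Hausdorff_space (mtop M) \<and> second_countable (mtop M) \<and>
     (\<Union>(U, h)\<in>mcharts M. U) = topspace (mtop M) \<and>
     (\<forall>(U, h)\<in>mcharts M. openin (mtop M) U \<and> open (h ` U) \<and>
        homeomorphic_map (subtopology (mtop M) U) (top_of_set (h ` U)) h) \<and>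
     (\<forall>(U, h)\<in>mcharts M. \<forall>(U', h')\<in>mcharts M.
        holomorphic_vec_on (h' \<circ> inv_into U h) (h ` (U \<inter> U')))"

definition holomorphic_mfd_map ::
  "('a, 'k::finite) cmfd \<Rightarrow> ('b, 'l::finite) cmfd \<Rightarrow> ('a \<Rightarrow> 'b) \<Rightarrow> bool" where
  "holomorphic_mfd_map M N f \<longleftrightarrow>
     continuous_map (mtop M) (mtop N) f \<and>
     (\<forall>(U, h)\<in>mcharts M. \<forall>(U', h')\<in>mcharts N.
        holomorphic_vec_on (h' \<circ> f \<circ> inv_into U h) (h ` {x \<in> U. f x \<in> U'}))"

definition biholomorphic_mfd_map ::
  "('a, 'k::finite) cmfd \<Rightarrow> ('b, 'l::finite) cmfd \<Rightarrow> ('a \<Rightarrow> 'b) \<Rightarrow> bool" where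
  "biholomorphic_mfd_map M N f \<longleftrightarrow>
     bij_betw f (topspace (mtop M)) (topspace (mtop N)) \<and>
     holomorphic_mfd_map M N f \<and>
     holomorphic_mfd_map N M (inv_into (topspace (mtop M)) f)"

definition open_mfd :: "(complex^'k) set \<Rightarrow> (complex^'k, 'k::finite) cmfd" where
  "open_mfd S = \<lparr>mtop = top_of_set S, mcharts = {(S, \<lambda>z. z)}\<rparr>"

text \<open>The complex structure of a cover is the one making the covering map locally biholomorphic:
  its charts are the charts of the base precomposed with local restrictions of the covering.\<close>

definition universal_cover ::
  "('a, 'k::finite) cmfd \<Rightarrow> ('a \<Rightarrow> 'b) \<Rightarrow> ('b, 'k) cmfd \<Rightarrow> bool" where
  "universal_cover M w N \<longleftrightarrow>
     simply_connected_space (mtop M) \<and> covering_map (mtop M) (mtop N) w \<and>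
     mcharts M = {(U, h \<circ> w) |U V h. (V, h) \<in> mcharts N \<and> openin (mtop M) U \<and>
        openin (mtop N) (w ` U) \<and> w ` U \<subseteq> V \<and>
        homeomorphic_map (subtopology (mtop M) U) (subtopology (mtop N) (w ` U)) w}"

section \<open>Complex models\<close>

text \<open>The action of the group of a model is free on a dense set, hence faithful, so the group is
  given as a group of transformations, i.e. a subgroup of \<open>BijGroup\<close>. It is discrete in
  the sense of carrying the discrete topology: its orbits need not be discrete.\<close>

definition free_points :: "'a set \<Rightarrow> ('a \<Rightarrow> 'a) set \<Rightarrow> 'a set" where
  "free_points S \<Gamma> = {x \<in> S. \<forall>\<gamma>\<in>\<Gamma>. \<gamma> x = x \<longrightarrow> \<gamma> = (\<lambda>y\<in>S. y)}"

definition tg_orbit :: "('a \<Rightarrow> 'a) set \<Rightarrow> 'a \<Rightarrow> 'a set" where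
  "tg_orbit \<Gamma> x = (\<lambda>\<gamma>. \<gamma> x) ` \<Gamma>"

text \<open>All conditions on a model except simple connectedness.\<close>

definition pre_model :: "('a, 'k::finite) cmfd \<Rightarrow> ('a \<Rightarrow> 'a) set \<Rightarrow> bool" where
  "pre_model M \<Gamma> \<longleftrightarrow>
     complex_manifold M \<and> connected_space (mtop M) \<and>
     subgroup \<Gamma> (BijGroup (topspace (mtop M))) \<and>
     (\<forall>\<gamma>\<in>\<Gamma>. holomorphic_mfd_map M M \<gamma>) \<and>
     connectedin (mtop M) (free_points (topspace (mtop M)) \<Gamma>) \<and>
     mtop M closure_of free_points (topspace (mtop M)) \<Gamma> = topspace (mtop M)"

definition complex_model :: "('a, 'k::finite) cmfd \<Rightarrow> ('a \<Rightarrow> 'a) set \<Rightarrow> bool" where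
  "complex_model M \<Gamma> \<longleftrightarrow> pre_model M \<Gamma> \<and> simply_connected_space (mtop M)"

definition model_space :: "('a, 'k::finite) cmfd \<Rightarrow> ('a \<Rightarrow> 'a) set \<Rightarrow> 'a set topology" where
  "model_space M \<Gamma> = quotient_topology (mtop M) (tg_orbit \<Gamma>)"

text \<open>Maps of models only refer to the manifolds \<open>M\<close>, \<open>N\<close> and to the projections \<open>p\<close>, \<open>q\<close>
  onto the quotients.\<close>

definition holomorphic_model_map ::
  "('a, 'k::finite) cmfd \<Rightarrow> ('a \<Rightarrow> 'x) \<Rightarrow> ('b, 'l::finite) cmfd \<Rightarrow> ('b \<Rightarrow> 'y) \<Rightarrow>
     ('x \<Rightarrow> 'y) \<Rightarrow> bool" where
  "holomorphic_model_map M p N q f \<longleftrightarrow>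
     (\<exists>F. holomorphic_mfd_map M N F \<and> (\<forall>u\<in>topspace (mtop M). q (F u) = f (p u)))"

definition biholomorphic_model_map ::
  "('a, 'k::finite) cmfd \<Rightarrow> ('a \<Rightarrow> 'x) \<Rightarrow> ('b, 'l::finite) cmfd \<Rightarrow> ('b \<Rightarrow> 'y) \<Rightarrow>
     ('x \<Rightarrow> 'y) \<Rightarrow> bool" where
  "biholomorphic_model_map M p N q f \<longleftrightarrow>
     bij_betw f (p ` topspace (mtop M)) (q ` topspace (mtop N)) \<and>
     (\<exists>F. biholomorphic_mfd_map M N F \<and> (\<forall>u\<in>topspace (mtop M). q (F u) = f (p u)))"

section \<open>Complex quasifolds\<close>

record ('m, 'k::finite) qchart =
  qdom :: "'m set"
  qmap :: "(complex^'k) set \<Rightarrow> 'm"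
  qcov :: "(complex^'k) set"
  qgrp :: "(complex^'k \<Rightarrow> complex^'k) set"

abbreviation qproj :: "('m, 'k::finite) qchart \<Rightarrow> complex^'k \<Rightarrow> (complex^'k) set" where
  "qproj c \<equiv> tg_orbit (qgrp c)"

abbreviation qspace :: "('m, 'k::finite) qchart \<Rightarrow> (complex^'k) set topology" where
  "qspace c \<equiv> model_space (open_mfd (qcov c)) (qgrp c)"

definition quasifold_chart :: "'m topology \<Rightarrow> ('m, 'k::finite) qchart \<Rightarrow> bool" where
  "quasifold_chart T c \<longleftrightarrow>
     openin T (qdom c) \<and> open (qcov c) \<and> complex_model (open_mfd (qcov c)) (qgrp c) \<and>
     homeomorphic_map (qspace c) (subtopology T (qdom c)) (qmap c)"

definition qlift :: "('m, 'k::finite) qchart \<Rightarrow> (complex^'k) set set \<Rightarrow> (complex^'k) set" where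
  "qlift c U = {z \<in> qcov c. qproj c z \<in> U}"

definition submodel :: "('m, 'k::finite) qchart \<Rightarrow> (complex^'k) set set \<Rightarrow> bool" where
  "submodel c U \<longleftrightarrow>
     openin (qspace c) U \<and>
     pre_model (open_mfd (qlift c U)) ((\<lambda>\<gamma>. restrict \<gamma> (qlift c U)) ` qgrp c)"

text \<open>For a universal cover \<open>w\<close> of \<open>qlift c U\<close> with lifted group \<open>\<Lambda>\<close>, the quotient of the
  cover by \<open>\<Lambda>\<close> is \<open>U\<close> itself, with projection \<open>qproj c \<circ> w\<close>; this is the model
  structure on \<open>U\<close> that is used here. If \<open>qlift c U\<close> is simply connected, it is its own universal
  cover.

  A universal cover of a nonempty connected open subset of \<open>complex^'k\<close> has the cardinality of
  the continuum. So it can always be realized by some topology, unrelated to the standard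
  one, on a set of points of type \<open>complex^'k\<close>. Universal covers being unique up to isomorphism, the
  choice of \<open>M\<close> and \<open>M'\<close> does not matter.\<close>

definition compatible_charts :: "('m, 'k::finite) qchart \<Rightarrow> ('m, 'k) qchart \<Rightarrow> bool" where
  "compatible_charts c c' \<longleftrightarrow>
     (qdom c \<inter> qdom c' \<noteq> {} \<longrightarrow>
       (let U = {x \<in> topspace (qspace c). qmap c x \<in> qdom c \<inter> qdom c'};
            U' = {x \<in> topspace (qspace c'). qmap c' x \<in> qdom c \<inter> qdom c'}
        in submodel c U \<and> submodel c' U' \<and>
           (\<exists>(M :: (complex^'k, 'k) cmfd) w (M' :: (complex^'k, 'k) cmfd) w'.
              universal_cover M w (open_mfd (qlift c U)) \<and>
              universal_cover M' w' (open_mfd (qlift c' U')) \<and>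
              biholomorphic_model_map M (qproj c \<circ> w) M' (qproj c' \<circ> w')
                (inv_into (topspace (qspace c')) (qmap c') \<circ> qmap c))))"

text \<open>\<open>complex_quasifold T A\<close>: \<open>A\<close> is a complex quasifold structure of dimension \<open>CARD('k)\<close>
  on \<open>T\<close>.\<close>

definition complex_quasifold :: "'m topology \<Rightarrow> ('m, 'k::finite) qchart set \<Rightarrow> bool" where
  "complex_quasifold T A \<longleftrightarrow>
     (\<Union>c\<in>A. qdom c) = topspace T \<and>
     (\<forall>c\<in>A. quasifold_chart T c) \<and>
     (\<forall>c\<in>A. \<forall>c'\<in>A. compatible_charts c c') \<and>
     (\<forall>c. quasifold_chart T c \<and> (\<forall>c'\<in>A. compatible_charts c c' \<and> compatible_charts c' c)
        \<longrightarrow> c \<in> A)"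

definition holomorphic_quasifold_map ::
  "'m topology \<Rightarrow> ('m, 'k::finite) qchart set \<Rightarrow> 'm2 topology \<Rightarrow> ('m2, 'l::finite) qchart set \<Rightarrow>
     ('m \<Rightarrow> 'm2) \<Rightarrow> bool" where
  "holomorphic_quasifold_map T A T' A' f \<longleftrightarrow>
     continuous_map T T' f \<and>
     (\<forall>m\<in>topspace T. \<exists>c\<in>A. \<exists>c'\<in>A'. m \<in> qdom c \<and> f m \<in> qdom c' \<and>
        (\<exists>f\<^sub>m. holomorphic_model_map (open_mfd (qcov c)) (qproj c)
                  (open_mfd (qcov c')) (qproj c') f\<^sub>m \<and>
               (\<forall>x\<in>topspace (qspace c). qmap c' (f\<^sub>m x) = f (qmap c x))))"

definition vjoin :: "complex^'k \<Rightarrow> complex^'l \<Rightarrow> complex^('k::finite + 'l::finite)" where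
  "vjoin x y = (\<chi> i. case i of Inl a \<Rightarrow> x $ a | Inr b \<Rightarrow> y $ b)"

definition vleft :: "complex^('k::finite + 'l::finite) \<Rightarrow> complex^'k" where
  "vleft z = (\<chi> a. z $ Inl a)"

definition vright :: "complex^('k::finite + 'l::finite) \<Rightarrow> complex^'l" where
  "vright z = (\<chi> b. z $ Inr b)"

definition product_chart ::
  "('m, 'k::finite) qchart \<Rightarrow> ('m2, 'l::finite) qchart \<Rightarrow> ('m \<times> 'm2, 'k + 'l) qchart" where
  "product_chart c c' =
     (let S = {z. vleft z \<in> qcov c \<and> vright z \<in> qcov c'}
      in \<lparr>qdom = qdom c \<times> qdom c',
          qmap = (\<lambda>x. (qmap c (vleft ` x), qmap c' (vright ` x))),
          qcov = S,
          qgrp = {\<lambda>z\<in>S. vjoin (\<gamma> (vleft z)) (\<delta> (vright z)) |\<gamma> \<delta>. \<gamma> \<in> qgrp c \<and> \<delta> \<in> qgrp c'}\<rparr>)"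

definition product_quasifold ::
  "'m topology \<Rightarrow> ('m, 'k::finite) qchart set \<Rightarrow> 'm2 topology \<Rightarrow> ('m2, 'l::finite) qchart set \<Rightarrow>
     ('m \<times> 'm2, 'k + 'l) qchart set \<Rightarrow> bool" where
  "product_quasifold T A T' A' P \<longleftrightarrow>
     complex_quasifold (prod_topology T T') P \<and>
     (\<forall>c\<in>A. \<forall>c'\<in>A'. product_chart c c' \<in> P)"

section \<open>Quasilattices, quasitori and their actions\<close>

definition int_span :: "'a::real_vector set \<Rightarrow> 'a set" where
  "int_span S = {\<Sum>v\<in>t. of_int (k v) *\<^sub>R v |t k. finite t \<and> t \<subseteq> S}"

definition quasilattice :: "'a::real_vector set \<Rightarrow> bool" where
  "quasilattice Q \<longleftrightarrow> (\<exists>S. span S = UNIV \<and> Q = int_span S)"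

definition complexify :: "real^'n \<Rightarrow> complex^'n" where
  "complexify v = (\<chi> i. complex_of_real (v $ i))"

definition additive_group :: "'a::ab_group_add monoid" where
  "additive_group = \<lparr>carrier = UNIV, mult = (+), one = 0\<rparr>"

definition quasitorus :: "(real^'n) set \<Rightarrow> (complex^'n) set monoid" where
  "quasitorus Q = additive_group Mod (complexify ` Q)"

definition quasitorus_proj :: "(real^'n) set \<Rightarrow> complex^'n \<Rightarrow> (complex^'n) set" where
  "quasitorus_proj Q z = (complexify ` Q) #>\<^bsub>additive_group\<^esub> z"

definition quasitorus_space :: "(real^'n) set \<Rightarrow> (complex^'n) set topology" where
  "quasitorus_space Q = quotient_topology euclidean (quasitorus_proj Q)"

definition quasitorus_chart :: "(real^'n::finite) set \<Rightarrow> ((complex^'n) set, 'n) qchart" where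
  "quasitorus_chart Q =
     \<lparr>qdom = carrier (quasitorus Q), qmap = (\<lambda>x. x), qcov = UNIV,
      qgrp = (\<lambda>a z. z + complexify a) ` Q\<rparr>"

definition quasitorus_quasifold ::
  "(real^'n::finite) set \<Rightarrow> ((complex^'n) set, 'n) qchart set \<Rightarrow> bool" where
  "quasitorus_quasifold Q B \<longleftrightarrow>
     complex_quasifold (quasitorus_space Q) B \<and> quasitorus_chart Q \<in> B"

text \<open>A maximal atlas containing a given collection of charts is not determined by it in general
  (submodels are connected, so charts with disconnected overlaps are not compatible). A
  holomorphic action is therefore required to be holomorphic for all maximal atlases \<open>B\<close> and \<open>P\<close> on
  the quasitorus and on the product that contain the single chart and the product charts,
  respectively. The first clause says that there are such atlases.\<close>

definition holomorphic_quasitorus_action ::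
  "(real^'n::finite) set \<Rightarrow> 'm topology \<Rightarrow> ('m, 'k::finite) qchart set \<Rightarrow>
     ((complex^'n) set \<Rightarrow> 'm \<Rightarrow> 'm) \<Rightarrow> bool" where
  "holomorphic_quasitorus_action Q T A act \<longleftrightarrow>
     group_action (quasitorus Q) (topspace T) act \<and>
     (\<exists>B P. quasitorus_quasifold Q B \<and> product_quasifold (quasitorus_space Q) B T A P) \<and>
     (\<forall>B P. quasitorus_quasifold Q B \<and> product_quasifold (quasitorus_space Q) B T A P \<longrightarrow>
        holomorphic_quasifold_map (prod_topology (quasitorus_space Q) T) P T A (\<lambda>(g, x). act g x))"

section \<open>Polytopes and the associated quotients\<close>

text \<open>The dual space is identified with \<open>real^'n\<close> by the dual basis, so that the pairing is the
  inner product.\<close>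

definition simple_polytope :: "(real^'n) set \<Rightarrow> bool" where
  "simple_polytope \<Delta> \<longleftrightarrow>
     polytope \<Delta> \<and> aff_dim \<Delta> = int CARD('n) \<and>
     (\<forall>v. v extreme_point_of \<Delta> \<longrightarrow> card {E. E edge_of \<Delta> \<and> v \<in> E} = CARD('n))"

definition inward_normals ::
  "(real^'n) set \<Rightarrow> ('d \<Rightarrow> real^'n) \<Rightarrow> ('d \<Rightarrow> real) \<Rightarrow> bool" where
  "inward_normals \<Delta> X l \<longleftrightarrow>
     \<Delta> = (\<Inter>j. {\<mu>. \<mu> \<bullet> X j \<ge> l j}) \<and>
     bij_betw (\<lambda>j. {\<mu> \<in> \<Delta>. \<mu> \<bullet> X j = l j}) UNIV {F. F facet_of \<Delta>}"

definition face_index ::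
  "('d \<Rightarrow> real^'n) \<Rightarrow> ('d \<Rightarrow> real) \<Rightarrow> (real^'n) set \<Rightarrow> 'd set" where
  "face_index X l F = {j. \<forall>\<mu>\<in>F. \<mu> \<bullet> X j = l j}"

definition C_Delta ::
  "(real^'n) set \<Rightarrow> ('d::finite \<Rightarrow> real^'n) \<Rightarrow> ('d \<Rightarrow> real) \<Rightarrow> (complex^'d) set" where
  "C_Delta \<Delta> X l =
     (\<Union>F\<in>{F. F face_of \<Delta> \<and> F \<noteq> {}}. {z. \<forall>j. z $ j = 0 \<longleftrightarrow> j \<in> face_index X l F})"

definition complex_torus :: "(complex^'d) set monoid" where
  "complex_torus = additive_group Mod {z. \<forall>j. z $ j \<in> \<int>}"

definition torus_act :: "(complex^'d) set \<Rightarrow> complex^'d \<Rightarrow> complex^'d" where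
  "torus_act t z = (\<chi> j. exp (2 * complex_of_real pi * \<i> * (SOME Z. Z \<in> t) $ j) * z $ j)"

definition pi_C :: "('d::finite \<Rightarrow> real^'n) \<Rightarrow> complex^'d \<Rightarrow> complex^'n" where
  "pi_C X z = (\<Sum>j\<in>UNIV. z $ j *s complexify (X j))"

text \<open>For \<open>X j \<in> Q\<close>, all members of the union are equal.\<close>

definition Pi_C ::
  "('d::finite \<Rightarrow> real^'n) \<Rightarrow> (real^'n) set \<Rightarrow> (complex^'d) set \<Rightarrow> (complex^'n) set" where
  "Pi_C X Q t = (\<Union>z\<in>t. quasitorus_proj Q (pi_C X z))"

definition N_C :: "('d::finite \<Rightarrow> real^'n) \<Rightarrow> (real^'n) set \<Rightarrow> (complex^'d) set set" where
  "N_C X Q = kernel complex_torus (quasitorus Q) (Pi_C X Q)"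

definition N_orbit ::
  "('d::finite \<Rightarrow> real^'n) \<Rightarrow> (real^'n) set \<Rightarrow> complex^'d \<Rightarrow> (complex^'d) set" where
  "N_orbit X Q z = {torus_act t z |t. t \<in> N_C X Q}"

definition toric_quotient ::
  "(real^'n) set \<Rightarrow> ('d::finite \<Rightarrow> real^'n) \<Rightarrow> ('d \<Rightarrow> real) \<Rightarrow> (real^'n) set \<Rightarrow>
     (complex^'d) set topology" where
  "toric_quotient \<Delta> X l Q = quotient_topology (top_of_set (C_Delta \<Delta> X l)) (N_orbit X Q)"

text \<open>The induced action of \<open>g = Pi_C X Q t\<close> takes the orbit of \<open>z\<close> to the orbit of
  \<open>torus_act t z\<close>. Since the fibres of \<open>Pi_C X Q\<close> are the cosets of \<open>N_C X Q\<close>, this orbit is the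
  set below.\<close>

definition induced_act ::
  "('d::finite \<Rightarrow> real^'n) \<Rightarrow> (real^'n) set \<Rightarrow> (complex^'n) set \<Rightarrow> (complex^'d) set \<Rightarrow>
     (complex^'d) set" where
  "induced_act X Q g x =
     {torus_act t z |t z. t \<in> carrier complex_torus \<and> Pi_C X Q t = g \<and> z \<in> x}"

end

theory Submission
  imports Defs
begin

text \<open>
  The \<open>n\<close> edges at a vertex of a simple polytope generate its cone there, so the facet normals at
  the vertex are, up to scaling, the dual basis of the edge directions. Moving the other coordinates to
  \<open>1\<close> by the action of \<open>N\<close> identifies an open subset of the quotient with \<open>complex^'n\<close> modulo a
  diagonal action of \<open>Q\<close>. Over the overlap of two such charts the cover is a product of copies of the plane and
  of the punctured plane; on its universal cover, given by exponentials, the change of charts is an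
  explicit biholomorphism, linear in the logarithmic coordinates. A chart is compatible with itself
  and products of compatible charts are compatible, so Zorn's lemma yields the maximal atlases. In a
  chart, the quasitorus acts by multiplication with exponentials of linear coordinates.
\<close>

section \<open>Simple polytopes\<close>

text \<open>Compatibility asks for a biholomorphism between universal covers of the overlaps,
  because on the overlaps themselves the change of charts need not be single valued: moving a point
  from one slice to another takes real, in general non-integral, powers of its nonzero coordinates.
  In logarithms these powers become linear, and both covers become all of \<open>complex^'n\<close>.
  The frame dual to the normals at a vertex makes this explicit. It gives a linear right inverse of
  \<open>pi_C\<close> that is supported on the facets through the vertex, so any exponent can be
  corrected into the kernel of \<open>pi_C\<close> without touching the other coordinates. It also
  yields the chart group: the exponentials of \<open>Q\<close> in the coordinates of the frame.
  Integral combinations of the normals at the vertex act trivially, and what is left may be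
  infinite. The charts that Zorn's lemma adds to an atlas are not explicit. Compatibility of
  products is therefore proved for arbitrary charts and covers with arbitrary topologies, while
  holomorphy of the action is checked in charts that lie in every admissible atlas.\<close>

lemma small_step_in_halfspaces:
  fixes X :: "'d::finite \<Rightarrow> 'a::real_inner"
  assumes "\<And>j. h \<bullet> X j \<ge> l j" and "\<And>j. h \<bullet> X j = l j \<Longrightarrow> w \<bullet> X j \<ge> 0"
  obtains e where "e > 0" "\<And>j. (h + e *\<^sub>R w) \<bullet> X j \<ge> l j"
    "\<And>j. h \<bullet> X j > l j \<Longrightarrow> (h + e *\<^sub>R w) \<bullet> X j > l j"
proof -
  have "\<exists>d>0. \<forall>t. 0 < t \<and> t < d \<longrightarrow>
      (h + t *\<^sub>R w) \<bullet> X j \<ge> l j \<and> (h \<bullet> X j > l j \<longrightarrow> (h + t *\<^sub>R w) \<bullet> X j > l j)" for j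
  proof (cases "h \<bullet> X j = l j")
    case True
    then show ?thesis
      using assms(2)[OF True] by (intro exI[of _ 1]) (auto simp: inner_add_left)
  next
    case False
    then have s: "h \<bullet> X j - l j > 0" using assms(1)[of j] by simp
    \<comment> \<open>For \<open>t\<close> below this bound, \<open>t\<close> times the change of
      the pairing stays below the slack; the added 1 keeps the denominator positive when the pairing
      does not change.\<close>
    define d where "d = (h \<bullet> X j - l j) / (\<bar>w \<bullet> X j\<bar> + 1)"
    have "d > 0" using s by (simp add: d_def)
    moreover have "(h + t *\<^sub>R w) \<bullet> X j > l j" if "0 < t" "t < d" for t
    proof -
      have "t * (\<bar>w \<bullet> X j\<bar> + 1) < h \<bullet> X j - l j"
        using that s by (simp add: d_def pos_less_divide_eq add_nonneg_pos)
      moreover have "t * (- (w \<bullet> X j)) \<le> t * (\<bar>w \<bullet> X j\<bar> + 1)"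
        using \<open>0 < t\<close> by (intro mult_left_mono) auto
      ultimately show ?thesis by (simp add: inner_add_left)
    qed
    ultimately show ?thesis by (intro exI[of _ d]) (auto intro: less_imp_le)
  qed
  then obtain d where d: "\<And>j. d j > 0" "\<And>j t. 0 < t \<Longrightarrow> t < d j \<Longrightarrow>
      (h + t *\<^sub>R w) \<bullet> X j \<ge> l j \<and> (h \<bullet> X j > l j \<longrightarrow> (h + t *\<^sub>R w) \<bullet> X j > l j)"
    by metis
  \<comment> \<open>Half the minimum lies strictly below every \<open>d j\<close>.\<close>
  define e where "e = Min (range d) / 2"
  have "Min (range d) > 0" using d(1) by simp
  then have "e > 0" by (simp add: e_def)
  have "e < d j" for j
  proof -
    have "Min (range d) \<le> d j" by simp
    with \<open>Min (range d) > 0\<close> show ?thesis unfolding e_def by linarith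
  qed
  then show ?thesis using d(2) \<open>e > 0\<close> by (intro that[of e]) auto
qed

text \<open>Each equation cuts \<open>P\<close> by a supporting hyperplane, and intersections of
  faces are faces.\<close>

lemma face_of_active_constraints:
  fixes X :: "'d \<Rightarrow> 'a::euclidean_space"
  assumes "P = (\<Inter>j. {\<mu>. \<mu> \<bullet> X j \<ge> l j})"
  shows "{x \<in> P. \<forall>j\<in>J. x \<bullet> X j = l j} face_of P"
proof -
  have "convex P"
    unfolding assms using convex_halfspace_ge[of _ "X _"]
    by (intro convex_INT) (simp add: inner_commute)
  \<comment> \<open>\<open>P\<close> is a member of the family, which is therefore nonempty and
    yields \<open>P\<close> when \<open>J\<close> is empty.\<close>
  have "\<Inter> (insert P ((\<lambda>j. P \<inter> {x. X j \<bullet> x = l j}) ` J)) face_of P"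
  proof (rule face_of_Inter)
    fix T assume "T \<in> insert P ((\<lambda>j. P \<inter> {x. X j \<bullet> x = l j}) ` J)"
    moreover have "P \<inter> {x. X j \<bullet> x = l j} face_of P" for j
      by (rule face_of_Int_supporting_hyperplane_ge) (use \<open>convex P\<close> assms in \<open>auto simp: inner_commute\<close>)
    ultimately show "T face_of P"
      using \<open>convex P\<close> by (auto simp: face_of_refl)
  qed simp
  also have "\<Inter> (insert P ((\<lambda>j. P \<inter> {x. X j \<bullet> x = l j}) ` J)) = {x \<in> P. \<forall>j\<in>J. x \<bullet> X j = l j}"
    by (auto simp: inner_commute)
  finally show ?thesis .
qed

section \<open>The cone generated by the edges at a vertex\<close>

text \<open>A hyperplane separating \<open>v\<close> from the other vertices cuts \<open>P\<close> in a polytope all of whose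
  vertices lie on edges through \<open>v\<close>.\<close>

lemma polytope_subset_edge_cone:
  fixes X :: "'d::finite \<Rightarrow> 'a::euclidean_space"
  assumes P: "P = (\<Inter>j. {\<mu>. \<mu> \<bullet> X j \<ge> l j})" and "polytope P" and v: "v extreme_point_of P"
  defines "W \<equiv> {b. b \<noteq> v \<and> closed_segment v b edge_of P}"
  assumes "finite W" and "x \<in> P"
  shows "\<exists>a. (\<forall>b\<in>W. a b \<ge> 0) \<and> x = v + (\<Sum>b\<in>W. a b *\<^sub>R (b - v))"
proof -
  define K where "K = {x. \<exists>a. (\<forall>b\<in>W. a b \<ge> 0) \<and> x = v + (\<Sum>b\<in>W. a b *\<^sub>R (b - v))}"
  have KI: "v + s *\<^sub>R (b - v) \<in> K" if "b \<in> W" "s \<ge> 0" for b s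
  proof -
    have "(\<Sum>c\<in>W. (if c = b then s else 0) *\<^sub>R (c - v)) = (\<Sum>c\<in>W. if c = b then s *\<^sub>R (b - v) else 0)"
      by (rule sum.cong) auto
    also have "\<dots> = s *\<^sub>R (b - v)" using \<open>finite W\<close> that by simp
    finally show ?thesis
      using that unfolding K_def by (intro CollectI exI[of _ "\<lambda>c. if c = b then s else 0"]) auto
  qed
  have Kscale: "v + c *\<^sub>R (x - v) \<in> K" if "x \<in> K" "c \<ge> 0" for x c
  proof -
    obtain a where a: "\<forall>b\<in>W. a b \<ge> 0" "x = v + (\<Sum>b\<in>W. a b *\<^sub>R (b - v))"
      using \<open>x \<in> K\<close> K_def by blast
    show ?thesis unfolding K_def using a that
      by (intro CollectI exI[of _ "\<lambda>b. c * a b"]) (auto simp: scaleR_sum_right)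
  qed
  have "convex K"
    unfolding convex_def
  proof (intro ballI allI impI)
    fix x y and s t :: real assume "x \<in> K" "y \<in> K" and st: "0 \<le> s" "0 \<le> t" "s + t = 1"
    then obtain a c where a: "\<forall>b\<in>W. a b \<ge> 0" "x = v + (\<Sum>b\<in>W. a b *\<^sub>R (b - v))"
      and c: "\<forall>b\<in>W. c b \<ge> 0" "y = v + (\<Sum>b\<in>W. c b *\<^sub>R (b - v))" unfolding K_def by blast
    have "s *\<^sub>R x + t *\<^sub>R y = (s + t) *\<^sub>R v + (\<Sum>b\<in>W. (s * a b + t * c b) *\<^sub>R (b - v))"
      by (simp only: a(2) c(2) scaleR_add_right scaleR_sum_right scaleR_add_left sum.distrib scaleR_scaleR)
        (simp add: algebra_simps)
    then show "s *\<^sub>R x + t *\<^sub>R y \<in> K"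
      using st a c unfolding K_def by (intro CollectI exI[of _ "\<lambda>b. s * a b + t * c b"]) auto
  qed
  have cP: "compact P" "convex P" using \<open>polytope P\<close> polytope_imp_compact polytope_imp_convex by auto
  define T where "T = {y. y extreme_point_of P} - {v}"
  have "finite T"
    using \<open>polytope P\<close> by (simp add: T_def finite_polyhedron_extreme_points polytope_imp_polyhedron)
  have PT: "P = convex hull (insert v T)"
  proof -
    have "insert v T = {y. y extreme_point_of P}" using v by (auto simp: T_def)
    then show ?thesis using Krein_Milman_Minkowski[OF cP] by simp
  qed
  have "T \<subseteq> P - {v}" by (auto simp: T_def extreme_point_of_def)
  \<comment> \<open>Removing an extreme point from a convex set leaves a convex set, so the hull of
    the other vertices misses \<open>v\<close> and can be strictly separated from it.\<close>
  then have "convex hull T \<subseteq> P - {v}"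
    using extreme_point_of_stillconvex cP v by (metis subset_hull)
  then have "v \<notin> convex hull T" by blast
  moreover have "closed (convex hull T)"
    using \<open>finite T\<close> by (simp add: compact_imp_closed finite_imp_compact_convex_hull)
  ultimately obtain a b where ab: "a \<bullet> v < b" "\<forall>y\<in>convex hull T. a \<bullet> y > b"
    using separating_hyperplane_closed_point[of "convex hull T" v] by auto
  have extP: "y = v" if "y extreme_point_of P" "a \<bullet> y \<le> b" for y
  proof (rule ccontr)
    assume "y \<noteq> v"
    then have "y \<in> convex hull T" using that by (simp add: T_def hull_inc)
    then show False using ab that by force
  qed
  define S where "S = P \<inter> {y. a \<bullet> y = b}"
  have cS: "compact S" "convex S"
    unfolding S_def using cP by (auto simp: compact_Int_closed closed_hyperplane convex_Int convex_hyperplane)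
  have extK: "h \<in> K" if h: "h extreme_point_of S" for h
  proof -
    have hS: "h \<in> P" "a \<bullet> h = b" using h by (auto simp: extreme_point_of_def S_def)
    \<comment> \<open>The smallest face containing \<open>h\<close>: the constraints inactive at
      \<open>h\<close> tolerate small moves in every direction. It will turn out to be an
      edge.\<close>
    define F where "F = {x \<in> P. \<forall>j\<in>{j. h \<bullet> X j = l j}. x \<bullet> X j = l j}"
    have F: "F face_of P" unfolding F_def by (rule face_of_active_constraints[OF P])
    have hF: "h \<in> F" using hS by (simp add: F_def)
    \<comment> \<open>Otherwise \<open>h\<close> could move both ways inside the section, against
      its extremality. Hence \<open>a\<close> is injective on the directions of \<open>F\<close>,
      and \<open>F\<close> is contained in a line.\<close>
    have L0: "w = 0" if w: "\<And>j. h \<bullet> X j = l j \<Longrightarrow> w \<bullet> X j = 0" "a \<bullet> w = 0" for w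
    proof (rule ccontr)
      assume "w \<noteq> 0"
      have hl: "h \<bullet> X j \<ge> l j" for j using hS P by auto
      obtain e1 where e1: "e1 > 0" "\<And>j. (h + e1 *\<^sub>R w) \<bullet> X j \<ge> l j"
        using small_step_in_halfspaces[of l h X w] w(1) hl by (metis order_refl)
      obtain e2 where e2: "e2 > 0" "\<And>j. (h + e2 *\<^sub>R (- w)) \<bullet> X j \<ge> l j"
        using small_step_in_halfspaces[of l h X "-w"] w(1) hl by (metis order_refl inner_minus_left neg_0_equal_iff_equal)
      have "h + e1 *\<^sub>R w \<in> S" "h + e2 *\<^sub>R (- w) \<in> S"
        using e1 e2 w hS by (auto simp: S_def P inner_add_right inner_diff_right)
      moreover have "h \<in> open_segment (h + e1 *\<^sub>R w) (h + e2 *\<^sub>R (- w))"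
      proof -
        \<comment> \<open>The weight balances the displacements \<open>e1\<close> and
          \<open>- e2\<close> along \<open>w\<close>.\<close>
        have "h = (1 - e1/(e1+e2)) *\<^sub>R (h + e1 *\<^sub>R w) + (e1/(e1+e2)) *\<^sub>R (h + e2 *\<^sub>R (- w))"
        proof -
          have eq: "(1 - e1/(e1+e2)) * e1 = (e1/(e1+e2)) * e2"
            using e1 e2 by (simp add: divide_simps)
          have "(1 - e1/(e1+e2)) *\<^sub>R (h + e1 *\<^sub>R w) + (e1/(e1+e2)) *\<^sub>R (h + e2 *\<^sub>R (- w))
             = h + ((1 - e1/(e1+e2)) * e1 - (e1/(e1+e2)) * e2) *\<^sub>R w"
            by (simp only: scaleR_add_right scaleR_diff_left scaleR_minus_right scaleR_scaleR left_diff_distrib) (simp add: algebra_simps)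
          then show ?thesis using eq by simp
        qed
        moreover have "0 < e1/(e1+e2)" "e1/(e1+e2) < 1" using e1 e2 by auto
        moreover have "h + e1 *\<^sub>R w \<noteq> h + e2 *\<^sub>R (- w)"
        proof
          assume "h + e1 *\<^sub>R w = h + e2 *\<^sub>R (- w)"
          then have "(e1 + e2) *\<^sub>R w = 0" by (simp add: algebra_simps)
          then show False using e1 e2 \<open>w \<noteq> 0\<close> by simp
        qed
        ultimately show ?thesis unfolding in_segment(2) by blast
      qed
      ultimately show False using h by (auto simp: extreme_point_of_def)
    qed
    \<comment> \<open>A vertex of \<open>P\<close> in the section would have to be \<open>v\<close>,
      which lies strictly on one side. So \<open>h\<close> is interior to a segment of
      \<open>P\<close>, and a face that contains \<open>h\<close> contains this segment; the
      dimension of \<open>F\<close> is then exactly 1.\<close>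
    have "\<not> h extreme_point_of P"
      using extP[of h] hS ab by auto
    then obtain p q where pq: "p \<in> P" "q \<in> P" "h \<in> open_segment p q"
      using hS by (auto simp: extreme_point_of_def)
    then have pqF: "p \<in> F" "q \<in> F" "p \<noteq> q"
      using F hF by (auto simp: face_of_def)
    define w0 where "w0 = p - q"
    have w0: "w0 \<bullet> X j = 0" if "h \<bullet> X j = l j" for j
      using pqF that by (auto simp: F_def w0_def inner_diff_left)
    have aw0: "a \<bullet> w0 \<noteq> 0" using L0[of w0] w0 pqF by (auto simp: w0_def)
    have line: "x = h + ((a \<bullet> (x - h)) / (a \<bullet> w0)) *\<^sub>R w0" if "x \<in> F" for x
    proof -
      have "x - h - ((a \<bullet> (x - h)) / (a \<bullet> w0)) *\<^sub>R w0 = 0"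
        using that w0 aw0 by (intro L0) (auto simp: F_def inner_diff_left inner_diff_right)
      then show ?thesis by (simp add: algebra_simps)
    qed
    have "collinear F"
    proof -
      have "\<exists>c. x = h + c *\<^sub>R w0" if "x \<in> F" for x using line[OF that] by blast
      then show ?thesis by (auto simp: collinear_alt)
    qed
    then have "aff_dim F \<le> 1" by (simp add: collinear_aff_dim)
    moreover have "aff_dim {p, q} \<le> aff_dim F" using pqF by (intro aff_dim_subset) auto
    ultimately have "aff_dim F = 1" using pqF by (simp add: aff_dim_2)
    then have edge: "F edge_of P" using F by (simp add: edge_of_def)
    have "compact F" "convex F" using F cP face_of_imp_compact face_of_imp_convex by blast+
    then obtain p' q' where F': "F = closed_segment p' q'"
      using compact_convex_collinear_segment[of F] \<open>collinear F\<close> hF by blast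
    have "p' extreme_point_of P" "q' extreme_point_of P"
      using extreme_point_of_face[OF F] F' by (auto simp: extreme_point_of_segment)
    obtain u where u: "0 \<le> u" "u \<le> 1" "h = (1 - u) *\<^sub>R p' + u *\<^sub>R q'"
      using hF F' by (auto simp: in_segment)
    \<comment> \<open>The ends of the edge cannot both lie beyond the hyperplane through
      \<open>h\<close>. An end that does not is a vertex on the side of \<open>v\<close>, hence
      \<open>v\<close> itself.\<close>
    have "a \<bullet> p' \<le> b \<or> a \<bullet> q' \<le> b"
    proof (rule ccontr)
      assume "\<not> ?thesis"
      then have 1: "a \<bullet> p' > b" "a \<bullet> q' > b" by auto
      have "a \<bullet> h = (1-u) * (a \<bullet> p') + u * (a \<bullet> q')" by (simp add: u inner_add_right)
      moreover have "(1-u) * (a \<bullet> p') + u * (a \<bullet> q') > b"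
      proof (cases "u = 0")
        case False
        then have "(1-u) * (a \<bullet> p') \<ge> (1-u) * b" "u * (a \<bullet> q') > u * b"
          using 1 u by (auto intro!: mult_left_mono)
        then show ?thesis by (simp add: algebra_simps)
      qed (use 1 in simp)
      ultimately show False using hS by simp
    qed
    then have "p' = v \<or> q' = v"
      using extP \<open>p' extreme_point_of P\<close> \<open>q' extreme_point_of P\<close> by blast
    then obtain c where c: "F = closed_segment v c" using F' closed_segment_commute by blast
    have "c \<noteq> v" using c \<open>aff_dim F = 1\<close> by auto
    then have "c \<in> W" using c edge by (simp add: W_def)
    obtain s where "0 \<le> s" "h = (1 - s) *\<^sub>R v + s *\<^sub>R c" using hF c by (auto simp: in_segment)
    then have "h = v + s *\<^sub>R (c - v)" by (simp add: algebra_simps)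
    then show ?thesis using KI[OF \<open>c \<in> W\<close> \<open>0 \<le> s\<close>] by simp
  qed
  have "S \<subseteq> K"
    using Krein_Milman_Minkowski[OF cS] extK \<open>convex K\<close> by (metis mem_Collect_eq subsetI subset_hull)
  have vK: "v \<in> K" unfolding K_def by (intro CollectI exI[of _ "\<lambda>_. 0"]) auto
  have "x \<in> K"
  proof (cases "T = {}")
    \<comment> \<open>Without other vertices \<open>P\<close> is the single point
      \<open>v\<close>.\<close>
    case True
    then show ?thesis using PT \<open>x \<in> P\<close> vK by auto
  next
    case False
    then obtain s t y where y: "0 \<le> s" "0 \<le> t" "s + t = 1" "y \<in> convex hull T" "x = s *\<^sub>R v + t *\<^sub>R y"
      using \<open>x \<in> P\<close> PT convex_hull_insert[OF False, of v] by auto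
    have x: "x = v + t *\<^sub>R (y - v)"
      using y by (simp add: algebra_simps flip: scaleR_add_left)
    \<comment> \<open>The parameter at which the segment from \<open>v\<close> to \<open>y\<close>
      crosses the hyperplane; \<open>x\<close> is a rescaling, with centre \<open>v\<close>, of the
      crossing point.\<close>
    define r where "r = (b - a \<bullet> v) / (a \<bullet> y - a \<bullet> v)"
    have ay: "a \<bullet> y > b" using ab y by blast
    then have r: "0 < r" "r < 1" using ab by (auto simp: r_def)
    define h where "h = v + r *\<^sub>R (y - v)"
    have "h = (1 - r) *\<^sub>R v + r *\<^sub>R y" by (simp add: h_def algebra_simps)
    moreover have "y \<in> P" using y PT by (meson hull_mono subset_insertI subsetD)
    ultimately have "h \<in> P"
      using r cP v by (auto simp: extreme_point_of_def intro!: convexD)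
    moreover have "a \<bullet> h = b"
      using ay ab by (simp add: h_def r_def inner_add_right inner_diff_right)
    ultimately have "h \<in> K" using \<open>S \<subseteq> K\<close> S_def by blast
    then have "v + (t / r) *\<^sub>R (h - v) \<in> K" using r y by (intro Kscale) auto
    then show ?thesis using r by (simp add: h_def x)
  qed
  then show ?thesis by (simp add: K_def)
qed


text \<open>\<open>\<sigma>\<close> numbers the facets through a vertex by the coordinate indices of
  a chart, and \<open>D\<close> is the basis dual to their normals, that is, the edge directions at
  the vertex suitably scaled.\<close>

definition normal_frame :: "('d \<Rightarrow> real^'n) \<Rightarrow> ('n::finite \<Rightarrow> 'd) \<Rightarrow> ('n \<Rightarrow> real^'n) \<Rightarrow> bool" where
  "normal_frame X \<sigma> D \<longleftrightarrow> inj \<sigma> \<and> (\<forall>i k. D i \<bullet> X (\<sigma> k) = (if i = k then 1 else 0)) \<and>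
     (\<forall>x. x = (\<Sum>i\<in>UNIV. (D i \<bullet> x) *\<^sub>R X (\<sigma> i)))"

text \<open>Transfers the count of edges in the definition of simplicity to the far ends of these
  edges. An edge is a compact segment, and a vertex on it is extreme in it, hence an end.\<close>

lemma edges_at_vertex_bij:
  assumes "polytope P" and v: "v extreme_point_of P"
  shows "bij_betw (closed_segment v) {b. b \<noteq> v \<and> closed_segment v b edge_of P} {E. E edge_of P \<and> v \<in> E}"
proof (rule bij_betw_imageI)
  show "inj_on (closed_segment v) {b. b \<noteq> v \<and> closed_segment v b edge_of P}"
    by (rule inj_onI) (auto simp: closed_segment_eq doubleton_eq_iff)
  have "\<exists>b. b \<noteq> v \<and> closed_segment v b edge_of P \<and> E = closed_segment v b" if E: "E edge_of P" "v \<in> E" for E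
  proof -
    have F: "E face_of P" "aff_dim E = 1" using E by (auto simp: edge_of_def)
    then have "compact E" "convex E" "collinear E"
      using assms polytope_imp_compact polytope_imp_convex face_of_imp_compact face_of_imp_convex
      by (auto simp: collinear_aff_dim)
    then obtain p q where pq: "E = closed_segment p q"
      using compact_convex_collinear_segment[of E] E by blast
    have "v extreme_point_of E" using extreme_point_of_face[OF F(1)] v E by simp
    then have "v = p \<or> v = q" using pq by (simp add: extreme_point_of_segment)
    then obtain b where b: "E = closed_segment v b" using pq closed_segment_commute by blast
    with F have "b \<noteq> v" by auto
    then show ?thesis using b E by blast
  qed
  then show "closed_segment v ` {b. b \<noteq> v \<and> closed_segment v b edge_of P} = {E. E edge_of P \<and> v \<in> E}"
    by auto
qed

section \<open>Facet normals as a dual basis of the edge directions\<close>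

lemma aff_dim_subset_translated_span:
  fixes S :: "'a::euclidean_space set"
  assumes "\<And>x. x \<in> S \<Longrightarrow> x - v \<in> span B" "finite B"
  shows "aff_dim S \<le> int (dim B)"
proof -
  have "S \<subseteq> (+) v ` span B"
    using assms(1) by (auto simp: image_iff) (metis add.commute diff_add_cancel)
  then have "aff_dim S \<le> aff_dim ((+) v ` span B)" by (rule aff_dim_subset)
  also have "\<dots> = int (dim B)" by (simp add: aff_dim_translation_eq aff_dim_subspace)
  finally show ?thesis .
qed

text \<open>A facet normal at \<open>v\<close> is positive on exactly one of the edge directions at \<open>v\<close>, since the
  facet spans a hyperplane and is generated by the edges in it.\<close>

lemma normal_frame_at_vertex:
  fixes \<Delta> :: "(real^'n) set" and X :: "'d::finite \<Rightarrow> real^'n"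
  assumes simple: "simple_polytope \<Delta>" and nor: "inward_normals \<Delta> X l" and v: "v extreme_point_of \<Delta>"
  obtains \<sigma> D where "normal_frame X \<sigma> D" "range \<sigma> = {j. v \<bullet> X j = l j}"
proof -
  define W where "W = {b. b \<noteq> v \<and> closed_segment v b edge_of \<Delta>}"
  have poly: "polytope \<Delta>" and dim: "aff_dim \<Delta> = int CARD('n)" using simple by (auto simp: simple_polytope_def)
  have \<Delta>: "\<Delta> = (\<Inter>j. {\<mu>. \<mu> \<bullet> X j \<ge> l j})"
    and facets: "bij_betw (\<lambda>j. {\<mu> \<in> \<Delta>. \<mu> \<bullet> X j = l j}) UNIV {F. F facet_of \<Delta>}"
    using nor by (auto simp: inward_normals_def)
  have vD: "v \<in> \<Delta>" using v by (simp add: extreme_point_of_def)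
  have "card W = CARD('n)"
    using bij_betw_same_card[OF edges_at_vertex_bij[OF poly v]] simple v
    by (simp add: simple_polytope_def W_def)
  then have "finite W" by (metis card.infinite zero_less_card_finite less_irrefl)
  have cone: "\<exists>a. (\<forall>b\<in>W. a b \<ge> 0) \<and> x = v + (\<Sum>b\<in>W. a b *\<^sub>R (b - v))" if "x \<in> \<Delta>" for x
    using polytope_subset_edge_cone[OF \<Delta> poly v, folded W_def] \<open>finite W\<close> that by blast
  define B where "B = (\<lambda>b. b - v) ` W"
  have "finite B" using \<open>finite W\<close> by (simp add: B_def)
  have cB: "card B \<le> CARD('n)" using card_image_le[OF \<open>finite W\<close>] \<open>card W = _\<close> B_def by metis
  \<comment> \<open>The polytope is full-dimensional and lies in the cone of its \<open>n\<close>
    edges at \<open>v\<close>, so their directions form a basis.\<close>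
  have "int CARD('n) \<le> int (dim B)"
    unfolding dim[symmetric]
  proof (rule aff_dim_subset_translated_span[of _ v])
    fix x assume "x \<in> \<Delta>"
    then obtain a where "x = v + (\<Sum>b\<in>W. a b *\<^sub>R (b - v))" using cone by blast
    then show "x - v \<in> span B"
      by (simp add: B_def) (intro span_sum span_scale span_base imageI)
  qed fact
  then have dB: "dim B = CARD('n)" using dim_le_card'[OF \<open>finite B\<close>] cB by simp
  then have spanB: "span B = UNIV"
    using dim_eq_full[of B] by simp
  have W\<Delta>: "b \<in> \<Delta>" if "b \<in> W" for b
    using that edge_of_imp_subset by (fastforce simp: W_def)
  have Xge: "X j \<bullet> (b - v) \<ge> 0" if "b \<in> W" "v \<bullet> X j = l j" for b j
    using W\<Delta>[OF that(1)] that(2) \<Delta> by (auto simp: inner_diff_right inner_commute)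
  have pair: "(v + (\<Sum>b\<in>W. a b *\<^sub>R (b - v))) \<bullet> X j = v \<bullet> X j + (\<Sum>b\<in>W. a b * (X j \<bullet> (b - v)))" for a j
    by (simp add: inner_add_left inner_sum_left inner_commute[of "X j"])
  have uniq: "\<exists>b\<in>W. X j \<bullet> (b - v) > 0 \<and> (\<forall>c\<in>W. c \<noteq> b \<longrightarrow> X j \<bullet> (c - v) = 0)"
    if j: "v \<bullet> X j = l j" for j
  proof -
    define F where "F = {\<mu> \<in> \<Delta>. \<mu> \<bullet> X j = l j}"
    have "F facet_of \<Delta>" using facets by (auto simp: bij_betw_def F_def)
    then have Fd: "aff_dim F = int CARD('n) - 1" "F \<noteq> {}" using dim by (auto simp: facet_of_def)
    define W0 where "W0 = {b \<in> W. X j \<bullet> (b - v) = 0}"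
    have "finite W0" using \<open>finite W\<close> by (simp add: W0_def)
    \<comment> \<open>On the facet the nonnegative terms
      \<open>a b * (X j \<bullet> (b - v))\<close> add up to zero, so only edges inside the facet
      contribute. Its dimension forces at least \<open>n - 1\<close> of them.\<close>
    have "aff_dim F \<le> int (dim ((\<lambda>b. b - v) ` W0))"
    proof (rule aff_dim_subset_translated_span[of _ v])
      fix x assume x: "x \<in> F"
      then obtain a where a: "\<forall>b\<in>W. a b \<ge> 0" "x = v + (\<Sum>b\<in>W. a b *\<^sub>R (b - v))"
        using cone F_def by blast
      have "(\<Sum>b\<in>W. a b * (X j \<bullet> (b - v))) = 0"
        using x pair[of a j] a j by (simp add: F_def)
      then have z: "\<forall>b\<in>W. a b * (X j \<bullet> (b - v)) = 0"
        using \<open>finite W\<close> a Xge j by (subst (asm) sum_nonneg_eq_0_iff) auto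
      have "(\<Sum>b\<in>W. a b *\<^sub>R (b - v)) = (\<Sum>b\<in>W0. a b *\<^sub>R (b - v))"
        using \<open>finite W\<close> z by (intro sum.mono_neutral_right) (auto simp: W0_def)
      then show "x - v \<in> span ((\<lambda>b. b - v) ` W0)"
        using a by (simp, intro span_sum span_scale span_base imageI)
    qed (use \<open>finite W0\<close> in simp)
    also have "dim ((\<lambda>b. b - v) ` W0) \<le> card W0"
      using dim_le_card'[of "(\<lambda>b. b - v) ` W0"] card_image_le[OF \<open>finite W0\<close>] \<open>finite W0\<close>
      by (meson finite_imageI le_trans)
    finally have "card W0 \<ge> CARD('n) - 1" using Fd by linarith
    \<comment> \<open>If all edges lay in the facet, it would be the whole polytope.\<close>
    moreover have "W0 \<noteq> W"
    proof
      assume "W0 = W"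
      then have "X j \<bullet> (b - v) = 0" if "b \<in> W" for b using that by (auto simp: W0_def)
      then have "(\<Sum>b\<in>W. a b * (X j \<bullet> (b - v))) = 0" for a by (simp add: sum.neutral)
      then have "x \<bullet> X j = l j" if "x \<in> \<Delta>" for x
        using cone[OF that] pair[of _ j] j by auto
      then have "F = \<Delta>" by (auto simp: F_def)
      then show False using Fd dim by simp
    qed
    moreover have "W0 \<subseteq> W" by (auto simp: W0_def)
    ultimately have "card (W - W0) \<le> 1" "W - W0 \<noteq> {}"
      using \<open>card W = CARD('n)\<close> \<open>finite W0\<close> by (auto simp: card_Diff_subset)
    then have "card (W - W0) = 1"
      using \<open>finite W\<close> by (metis card_0_eq finite_Diff le_neq_implies_less less_one)
    then obtain b where b: "W - W0 = {b}" by (metis card_1_singletonE)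
    then have "b \<in> W" "X j \<bullet> (b - v) \<noteq> 0" by (auto simp: W0_def)
    moreover have "X j \<bullet> (c - v) = 0" if "c \<in> W" "c \<noteq> b" for c using that b by (auto simp: W0_def)
    ultimately show ?thesis using Xge[of b j] j by (intro bexI[of _ b]) (auto simp: less_le)
  qed
  define I where "I = {j. v \<bullet> X j = l j}"
  have "\<forall>j\<in>I. \<exists>b. b \<in> W \<and> X j \<bullet> (b - v) > 0 \<and> (\<forall>c\<in>W. c \<noteq> b \<longrightarrow> X j \<bullet> (c - v) = 0)"
    using uniq unfolding I_def by blast
  from bchoice[OF this] obtain \<beta>
    where "\<forall>j\<in>I. \<beta> j \<in> W \<and> X j \<bullet> (\<beta> j - v) > 0 \<and> (\<forall>c\<in>W. c \<noteq> \<beta> j \<longrightarrow> X j \<bullet> (c - v) = 0)" ..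
  then have \<beta>: "\<And>j. j \<in> I \<Longrightarrow> \<beta> j \<in> W" "\<And>j. j \<in> I \<Longrightarrow> X j \<bullet> (\<beta> j - v) > 0"
    "\<And>j c. j \<in> I \<Longrightarrow> c \<in> W \<Longrightarrow> c \<noteq> \<beta> j \<Longrightarrow> X j \<bullet> (c - v) = 0"
    by blast+
  have val: "(v + (\<Sum>b\<in>W. a b *\<^sub>R (b - v))) \<bullet> X j = l j + a (\<beta> j) * (X j \<bullet> (\<beta> j - v))"
    if "j \<in> I" for a j
  proof -
    have "(\<Sum>b\<in>W. a b * (X j \<bullet> (b - v))) = (\<Sum>b\<in>W. if b = \<beta> j then a (\<beta> j) * (X j \<bullet> (\<beta> j - v)) else 0)"
      using \<beta>(3)[OF that] by (intro sum.cong) auto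
    then show ?thesis using pair[of a j] that \<beta>(1)[OF that] \<open>finite W\<close> by (simp add: I_def)
  qed
  \<comment> \<open>Lying on the facet of \<open>j\<close> means that the coefficient of the edge
    \<open>\<beta> j\<close> vanishes, so normals with the same edge have the same facet.\<close>
  have "inj_on \<beta> I"
  proof (rule inj_onI)
    fix j k assume jk: "j \<in> I" "k \<in> I" "\<beta> j = \<beta> k"
    have "x \<bullet> X j = l j \<longleftrightarrow> x \<bullet> X k = l k" if x: "x \<in> \<Delta>" for x
    proof -
      obtain a where "x = v + (\<Sum>b\<in>W. a b *\<^sub>R (b - v))" using cone[OF x] by blast
      then show ?thesis using val[of j a] val[of k a] jk \<beta>(2)[of j] \<beta>(2)[of k] by auto
    qed
    then have "{\<mu> \<in> \<Delta>. \<mu> \<bullet> X j = l j} = {\<mu> \<in> \<Delta>. \<mu> \<bullet> X k = l k}" by blast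
    then show "j = k" using facets by (auto simp: bij_betw_def inj_def)
  qed
  have "\<beta> ` I = W"
  proof
    show "W \<subseteq> \<beta> ` I"
    proof (rule ccontr)
      assume "\<not> W \<subseteq> \<beta> ` I"
      \<comment> \<open>All active normals vanish on such an edge, so it could be prolonged
        backwards beyond the vertex \<open>v\<close>.\<close>
      then obtain b where b: "b \<in> W" "b \<notin> \<beta> ` I" by blast
      then have "X j \<bullet> (b - v) = 0" if "j \<in> I" for j using \<beta>(3)[OF that] that by blast
      then have "(v - b) \<bullet> X j \<ge> 0" if "v \<bullet> X j = l j" for j
        using that by (simp add: I_def inner_diff_right inner_diff_left inner_commute)
      moreover have "v \<bullet> X j \<ge> l j" for j using vD \<Delta> by auto
      ultimately obtain e where e: "e > 0" "\<And>j. (v + e *\<^sub>R (v - b)) \<bullet> X j \<ge> l j"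
        using small_step_in_halfspaces[of l v X "v - b"] by blast
      then have "v + e *\<^sub>R (v - b) \<in> \<Delta>" using \<Delta> by blast
      moreover have "v \<in> open_segment (v + e *\<^sub>R (v - b)) b"
      proof -
        have "(1 - e/(1+e)) *\<^sub>R (v + e *\<^sub>R (v - b)) + (e/(1+e)) *\<^sub>R b
           = ((1 - e/(1+e)) * (1 + e)) *\<^sub>R v + (e/(1+e) - (1 - e/(1+e)) * e) *\<^sub>R b"
          by (simp only: scaleR_add_right scaleR_diff_right scaleR_add_left scaleR_diff_left
              scaleR_scaleR distrib_left) (simp add: scaleR_diff_left)
        moreover have "(1 - e/(1+e)) * (1 + e) = 1" "e/(1+e) - (1 - e/(1+e)) * e = 0"
          using e(1) by (simp_all add: divide_simps)
        ultimately have "v = (1 - e/(1+e)) *\<^sub>R (v + e *\<^sub>R (v - b)) + (e/(1+e)) *\<^sub>R b" by simp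
        moreover have "0 < e/(1+e)" "e/(1+e) < 1" using e by auto
        moreover have "v + e *\<^sub>R (v - b) \<noteq> b"
        proof
          assume "v + e *\<^sub>R (v - b) = b"
          then have "(1 + e) *\<^sub>R (v - b) = 0" by (simp add: algebra_simps)
          then show False using e b by (auto simp: W_def)
        qed
        ultimately show ?thesis unfolding in_segment(2) by blast
      qed
      ultimately show False using v W\<Delta>[OF b(1)] by (auto simp: extreme_point_of_def)
    qed
  qed (use \<beta> in auto)
  then have "card I = CARD('n)" using \<open>inj_on \<beta> I\<close> \<open>card W = _\<close> card_image by fastforce
  then obtain \<sigma> :: "'n \<Rightarrow> 'd" where \<sigma>: "bij_betw \<sigma> UNIV I"
    by (metis finite_same_card_bij finite)
  \<comment> \<open>The scaling makes each direction pair to 1 with its own normal.\<close>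
  define D where "D i = (1 / (X (\<sigma> i) \<bullet> (\<beta> (\<sigma> i) - v))) *\<^sub>R (\<beta> (\<sigma> i) - v)" for i
  have \<sigma>I: "\<sigma> i \<in> I" for i using \<sigma> by (auto simp: bij_betw_def)
  have inj: "inj \<sigma>" and ran: "range \<sigma> = I" using \<sigma> by (auto simp: bij_betw_def)
  have DX: "D i \<bullet> X (\<sigma> k) = (if i = k then 1 else 0)" for i k
  proof (cases "i = k")
    case True
    then show ?thesis using \<beta>(2)[OF \<sigma>I[of i]] by (simp add: D_def inner_commute)
  next
    case False
    then have "\<beta> (\<sigma> i) \<noteq> \<beta> (\<sigma> k)"
      using inj \<open>inj_on \<beta> I\<close> \<sigma>I by (metis inj_onD injD)
    then have "X (\<sigma> k) \<bullet> (\<beta> (\<sigma> i) - v) = 0" using \<beta> \<sigma>I by blast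
    then show ?thesis using False by (simp add: D_def inner_commute)
  qed
  have "x = (\<Sum>i\<in>UNIV. (D i \<bullet> x) *\<^sub>R X (\<sigma> i))" for x
  proof -
    \<comment> \<open>The defect of the expansion is orthogonal to every edge direction at
      \<open>v\<close>, and these span the space.\<close>
    define y where "y = x - (\<Sum>i\<in>UNIV. (D i \<bullet> x) *\<^sub>R X (\<sigma> i))"
    have Dy: "D k \<bullet> y = 0" for k
      by (simp add: y_def inner_diff_right inner_sum_right DX if_distrib cong: if_cong)
    have yb: "y \<bullet> (\<beta> (\<sigma> k) - v) = 0" for k
      using Dy[of k] \<beta>(2)[OF \<sigma>I[of k]] by (simp add: D_def inner_commute[of y])
    have "y \<bullet> c = 0" if "c \<in> span B" for c
      using that
    proof (induction rule: span_induct_alt)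
      case (step a c z)
      then obtain k where "c = \<beta> (\<sigma> k) - v" using \<open>\<beta> ` I = W\<close> ran B_def by force
      then show ?case using yb[of k] step by (simp add: inner_add_right)
    qed simp
    then have "y \<bullet> y = 0" using spanB by blast
    then show ?thesis by (simp add: y_def)
  qed
  then have "normal_frame X \<sigma> D" unfolding normal_frame_def using inj DX by blast
  then show ?thesis using that ran I_def by blast
qed

text \<open>At a simple vertex every set of facets through it is the active set of some face, since
  the dual frame allows a point to leave any chosen facets while staying on the others. So the
  strata of the faces through a vertex make up all points whose vanishing coordinates belong to
  facets at that vertex.\<close>

lemma C_Delta_eq_vertex_charts:
  fixes \<Delta> :: "(real^'n) set" and X :: "'d::finite \<Rightarrow> real^'n"
  assumes simple: "simple_polytope \<Delta>" and nor: "inward_normals \<Delta> X l"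
  obtains S where "S \<noteq> {}" "\<forall>(\<sigma>, D)\<in>S. normal_frame X \<sigma> D"
    "C_Delta \<Delta> X l = (\<Union>(\<sigma>, D)\<in>S. {z. \<forall>j. z $ j = 0 \<longrightarrow> j \<in> range \<sigma>})"
proof -
  have poly: "polytope \<Delta>" and dim: "aff_dim \<Delta> = int CARD('n)" using simple by (auto simp: simple_polytope_def)
  have c\<Delta>: "compact \<Delta>" "convex \<Delta>" using poly polytope_imp_compact polytope_imp_convex by auto
  have \<Delta>: "\<Delta> = (\<Inter>j. {\<mu>. \<mu> \<bullet> X j \<ge> l j})" using nor by (auto simp: inward_normals_def)
  define S where "S = {(\<sigma>, D). normal_frame X \<sigma> D \<and> (\<exists>v. v extreme_point_of \<Delta> \<and> range \<sigma> = {j. v \<bullet> X j = l j})}"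
  have ex: "\<exists>v. v extreme_point_of \<Delta> \<and> v \<in> F" if "F face_of \<Delta>" "F \<noteq> {}" for F
  proof -
    have "compact F" "convex F" using that c\<Delta> face_of_imp_compact face_of_imp_convex by blast+
    then obtain v where "v extreme_point_of F" using extreme_point_exists_convex[of F] \<open>F \<noteq> {}\<close> by blast
    then show ?thesis using extreme_point_of_face[OF that(1)] by blast
  qed
  have "\<Delta> \<noteq> {}" using dim by auto
  then obtain v where v: "v extreme_point_of \<Delta>" using ex[of \<Delta>] c\<Delta> face_of_refl by blast
  obtain \<sigma> D where "normal_frame X \<sigma> D" "range \<sigma> = {j. v \<bullet> X j = l j}"
    using normal_frame_at_vertex[OF simple nor v] .
  then have "(\<sigma>, D) \<in> S" using \<open>v extreme_point_of \<Delta>\<close> unfolding S_def by blast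
  then have "S \<noteq> {}" by blast
  have sub: "C_Delta \<Delta> X l \<subseteq> (\<Union>(\<sigma>, D)\<in>S. {z. \<forall>j. z $ j = 0 \<longrightarrow> j \<in> range \<sigma>})"
  proof
    fix z assume "z \<in> C_Delta \<Delta> X l"
    then obtain F where F: "F face_of \<Delta>" "F \<noteq> {}" "\<And>j. z $ j = 0 \<longleftrightarrow> j \<in> face_index X l F"
      by (auto simp: C_Delta_def)
    then obtain v where v: "v extreme_point_of \<Delta>" "v \<in> F" using ex by blast
    obtain \<sigma> D where s: "normal_frame X \<sigma> D" "range \<sigma> = {j. v \<bullet> X j = l j}"
      using normal_frame_at_vertex[OF simple nor v(1)] .
    have "(\<sigma>, D) \<in> S" using s v S_def by blast
    moreover have "\<forall>j. z $ j = 0 \<longrightarrow> j \<in> range \<sigma>" using F(3) v(2) s(2) by (auto simp: face_index_def)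
    ultimately show "z \<in> (\<Union>(\<sigma>, D)\<in>S. {z. \<forall>j. z $ j = 0 \<longrightarrow> j \<in> range \<sigma>})" by blast
  qed
  have sup: "z \<in> C_Delta \<Delta> X l" if "(\<sigma>, D) \<in> S" and z: "\<And>j. z $ j = 0 \<Longrightarrow> j \<in> range \<sigma>" for z \<sigma> D
  proof -
    obtain v where fr: "normal_frame X \<sigma> D" and v: "v extreme_point_of \<Delta>" "range \<sigma> = {j. v \<bullet> X j = l j}"
      using \<open>(\<sigma>, D) \<in> S\<close> S_def by blast
    define J where "J = {j. z $ j = 0}"
    \<comment> \<open>Moving along \<open>w\<close> leaves precisely those facets at
      \<open>v\<close> that are not indexed by \<open>J\<close>.\<close>
    define w where "w = (\<Sum>i\<in>{i. \<sigma> i \<notin> J}. D i)"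
    have w: "w \<bullet> X (\<sigma> k) = (if \<sigma> k \<notin> J then 1 else 0)" for k
    proof -
      have "w \<bullet> X (\<sigma> k) = (\<Sum>i\<in>{i. \<sigma> i \<notin> J}. if i = k then 1 else 0)"
        using fr by (simp add: w_def inner_sum_left normal_frame_def)
      then show ?thesis by simp
    qed
    have vl: "v \<bullet> X j \<ge> l j" for j using v \<Delta> by (auto simp: extreme_point_of_def)
    have "w \<bullet> X j \<ge> 0" if "v \<bullet> X j = l j" for j
      using that v(2) w by (metis (mono_tags, lifting) mem_Collect_eq order_refl rangeE zero_le_one)
    \<comment> \<open>A small move also meets no facet away from \<open>v\<close>, so the active set
      of the new point is exactly \<open>J\<close>.\<close>
    then obtain e where e: "e > 0" "\<And>j. (v + e *\<^sub>R w) \<bullet> X j \<ge> l j"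
      "\<And>j. v \<bullet> X j > l j \<Longrightarrow> (v + e *\<^sub>R w) \<bullet> X j > l j"
      using small_step_in_halfspaces[of l v X w] vl by blast
    have act: "(v + e *\<^sub>R w) \<bullet> X j = l j \<longleftrightarrow> j \<in> J" for j
    proof (cases "v \<bullet> X j = l j")
      case True
      then obtain k where "j = \<sigma> k" using v(2) by blast
      then show ?thesis using True w[of k] e(1) by (simp add: inner_add_left)
    next
      case False
      then have "j \<notin> J" using z v(2) J_def by auto
      moreover have "(v + e *\<^sub>R w) \<bullet> X j > l j" using False vl[of j] by (intro e(3)) simp
      ultimately show ?thesis by simp
    qed
    define F where "F = {x \<in> \<Delta>. \<forall>j\<in>J. x \<bullet> X j = l j}"
    have "F face_of \<Delta>" unfolding F_def by (rule face_of_active_constraints[OF \<Delta>])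
    moreover have mem: "v + e *\<^sub>R w \<in> F" using e(2) act \<Delta> by (auto simp: F_def)
    moreover have "face_index X l F = J"
      using mem act by (auto simp: face_index_def F_def)
    ultimately show ?thesis by (auto simp: C_Delta_def J_def)
  qed
  have "(\<Union>(\<sigma>, D)\<in>S. {z. \<forall>j. z $ j = 0 \<longrightarrow> j \<in> range \<sigma>}) \<subseteq> C_Delta \<Delta> X l"
    using sup by blast
  with sub show ?thesis using \<open>S \<noteq> {}\<close> by (intro that[of S]) (auto simp: S_def)
qed

section \<open>Complex differentiability\<close>

text \<open>The pointwise form of \<open>holomorphic_vec_on\<close>, so that at each point a
  different branch of an inverse can be used.\<close>

definition cdiff_at :: "(complex^'k \<Rightarrow> complex^'l) \<Rightarrow> complex^'k \<Rightarrow> bool" where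
  "cdiff_at f z \<longleftrightarrow> (\<exists>f'. (f has_derivative f') (at z) \<and> (\<forall>c v. f' (c *s v) = c *s f' v))"

definition cdiff_at1 :: "(complex^'k \<Rightarrow> complex) \<Rightarrow> complex^'k \<Rightarrow> bool" where
  "cdiff_at1 f z \<longleftrightarrow> (\<exists>f'. (f has_derivative f') (at z) \<and> (\<forall>c v. f' (c *s v) = c * f' v))"

lemma holomorphic_vec_on_iff: "holomorphic_vec_on f S \<longleftrightarrow> (\<forall>z\<in>S. cdiff_at f z)"
  by (simp add: holomorphic_vec_on_def cdiff_at_def)

text \<open>Reduces holomorphy of vector-valued maps to the calculus of scalar functions.\<close>

lemma cdiff_at_iff_components: "cdiff_at f z \<longleftrightarrow> (\<forall>i. cdiff_at1 (\<lambda>y. f y $ i) z)"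
proof
  assume "cdiff_at f z"
  then obtain f' where f': "(f has_derivative f') (at z)" "\<And>c v. f' (c *s v) = c *s f' v"
    by (auto simp: cdiff_at_def)
  have "((\<lambda>y. f y $ i) has_derivative (\<lambda>v. f' v $ i)) (at z)" for i
    using bounded_linear.has_derivative[OF bounded_linear_vec_nth f'(1)] .
  then have "cdiff_at1 (\<lambda>y. f y $ i) z" for i
    unfolding cdiff_at1_def using f'(2) by (intro exI[of _ "\<lambda>v. f' v $ i"]) simp
  then show "\<forall>i. cdiff_at1 (\<lambda>y. f y $ i) z" ..
next
  assume "\<forall>i. cdiff_at1 (\<lambda>y. f y $ i) z"
  then have "\<forall>i. \<exists>g. ((\<lambda>y. f y $ i) has_derivative g) (at z) \<and> (\<forall>c v. g (c *s v) = c * g v)"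
    by (simp add: cdiff_at1_def)
  from choice[OF this] obtain g
    where "\<forall>i. ((\<lambda>y. f y $ i) has_derivative g i) (at z) \<and> (\<forall>c v. g i (c *s v) = c * g i v)" ..
  then have g: "\<And>i. ((\<lambda>y. f y $ i) has_derivative g i) (at z)" "\<And>i c v. g i (c *s v) = c * g i v"
    by simp_all
  have lin: "bounded_linear (\<lambda>x::complex. axis i x)" for i
    by (intro linear_conv_bounded_linear[THEN iffD1] linearI) (auto simp: axis_def vec_eq_iff)
  have sum_axis: "(\<Sum>i\<in>UNIV. axis i (h i)) = (\<chi> i. h i)" for h :: "'b \<Rightarrow> complex"
    by (simp add: vec_eq_iff axis_def if_distrib cong: if_cong)
  \<comment> \<open>A vector is the sum of its components along the axes, and each axis embedding is
    bounded linear, so the derivatives of the components can be assembled.\<close>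
  have "((\<lambda>y. \<Sum>i\<in>UNIV. axis i (f y $ i)) has_derivative (\<lambda>v. \<Sum>i\<in>UNIV. axis i (g i v))) (at z)"
    by (intro has_derivative_sum bounded_linear.has_derivative[OF lin] g)
  then have "(f has_derivative (\<lambda>v. \<chi> i. g i v)) (at z)"
    by (simp add: sum_axis)
  then show "cdiff_at f z"
    unfolding cdiff_at_def using g(2) by (intro exI conjI) (auto simp: vec_eq_iff)
qed

lemma cdiff_at1_const [simp]: "cdiff_at1 (\<lambda>_. c) z"
  unfolding cdiff_at1_def by (intro exI[of _ "\<lambda>_. 0"]) auto

lemma cdiff_at1_nth [simp]: "cdiff_at1 (\<lambda>y. y $ i) z"
  unfolding cdiff_at1_def using bounded_linear_vec_nth bounded_linear_imp_has_derivative
  by (intro exI[of _ "\<lambda>y. y $ i"]) auto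

lemma cdiff_at1_add: "cdiff_at1 f z \<Longrightarrow> cdiff_at1 g z \<Longrightarrow> cdiff_at1 (\<lambda>y. f y + g y) z"
  unfolding cdiff_at1_def
proof (elim exE conjE)
  fix f' g' assume "(f has_derivative f') (at z)" "(g has_derivative g') (at z)"
    "\<forall>c v. f' (c *s v) = c * f' v" "\<forall>c v. g' (c *s v) = c * g' v"
  then show "\<exists>f'. ((\<lambda>y. f y + g y) has_derivative f') (at z) \<and> (\<forall>c v. f' (c *s v) = c * f' v)"
    by (intro exI[of _ "\<lambda>v. f' v + g' v"] conjI has_derivative_add) (auto simp: algebra_simps)
qed

lemma cdiff_at1_mult: "cdiff_at1 f z \<Longrightarrow> cdiff_at1 g z \<Longrightarrow> cdiff_at1 (\<lambda>y. f y * g y) z"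
  unfolding cdiff_at1_def
proof (elim exE conjE)
  fix f' g' assume "(f has_derivative f') (at z)" "(g has_derivative g') (at z)"
    "\<forall>c v. f' (c *s v) = c * f' v" "\<forall>c v. g' (c *s v) = c * g' v"
  then show "\<exists>f'. ((\<lambda>y. f y * g y) has_derivative f') (at z) \<and> (\<forall>c v. f' (c *s v) = c * f' v)"
    by (intro exI[of _ "\<lambda>v. f z * g' v + f' v * g z"] conjI has_derivative_mult) (auto simp: algebra_simps)
qed

lemma cdiff_at1_sum: "(\<And>i. i \<in> I \<Longrightarrow> cdiff_at1 (f i) z) \<Longrightarrow> cdiff_at1 (\<lambda>y. \<Sum>i\<in>I. f i y) z"
  by (induction I rule: infinite_finite_induct) (auto intro: cdiff_at1_add)

lemma cdiff_at1_compose_deriv: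
  assumes "cdiff_at1 f z" "(g has_field_derivative d) (at (f z))"
  shows "cdiff_at1 (\<lambda>y. g (f y)) z"
proof -
  obtain f' where f': "(f has_derivative f') (at z)" "\<And>c v. f' (c *s v) = c * f' v"
    using assms(1) by (auto simp: cdiff_at1_def)
  have "((\<lambda>y. g (f y)) has_derivative (\<lambda>v. d * f' v)) (at z)"
    using has_derivative_compose[OF f'(1)] assms(2) by (simp add: has_field_derivative_def)
  then show ?thesis using f'(2) unfolding cdiff_at1_def by (intro exI conjI) auto
qed

lemma cdiff_at1_exp: "cdiff_at1 f z \<Longrightarrow> cdiff_at1 (\<lambda>y. exp (f y)) z"
  by (rule cdiff_at1_compose_deriv) (auto intro: DERIV_exp)

lemma cdiff_at_transform:
  assumes "cdiff_at f z" "open S" "z \<in> S" "\<And>y. y \<in> S \<Longrightarrow> f y = g y"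
  shows "cdiff_at g z"
proof -
  obtain f' where f': "(f has_derivative f') (at z)" "\<And>c v. f' (c *s v) = c *s f' v"
    using assms(1) by (auto simp: cdiff_at_def)
  have "(g has_derivative f') (at z)"
    using has_derivative_transform_within_open[OF f'(1) assms(2,3)] assms(4) by simp
  then show ?thesis using f'(2) by (auto simp: cdiff_at_def)
qed

lemma cdiff_at_compose:
  assumes "cdiff_at f z" "cdiff_at g (f z)" shows "cdiff_at (\<lambda>y. g (f y)) z"
proof -
  obtain f' g' where "(f has_derivative f') (at z)" "\<And>c v. f' (c *s v) = c *s f' v"
    "(g has_derivative g') (at (f z))" "\<And>c v. g' (c *s v) = c *s g' v"
    using assms by (auto simp: cdiff_at_def)
  then show ?thesis unfolding cdiff_at_def
    by (intro exI[of _ "\<lambda>v. g' (f' v)"] conjI) (auto intro: has_derivative_compose)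
qed

lemma cdiff_at_id [simp]: "cdiff_at (\<lambda>z. z) z"
  by (simp add: cdiff_at_iff_components)

lemma cdiff_at_imp_continuous_on:
  "(\<And>z. z \<in> S \<Longrightarrow> cdiff_at f z) \<Longrightarrow> continuous_on S f"
  unfolding cdiff_at_def by (meson continuous_at_imp_continuous_on has_derivative_continuous)

section \<open>Transformation groups and models on open sets\<close>

text \<open>In a group a left inverse is the inverse, so closure under inverses can be stated with
  \<open>compose\<close> alone. The transformation groups below are checked in this form.\<close>

lemma subgroup_BijGroup_iff:
  "subgroup \<Gamma> (BijGroup S) \<longleftrightarrow>
     \<Gamma> \<subseteq> Bij S \<and> (\<lambda>x\<in>S. x) \<in> \<Gamma> \<and> (\<forall>g\<in>\<Gamma>. \<forall>h\<in>\<Gamma>. compose S g h \<in> \<Gamma>) \<and>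
     (\<forall>g\<in>\<Gamma>. \<exists>h\<in>\<Gamma>. compose S h g = (\<lambda>x\<in>S. x))"
proof -
  interpret group "BijGroup S" by (rule group_BijGroup)
  have mult: "g \<otimes>\<^bsub>BijGroup S\<^esub> h = compose S g h" if "g \<in> Bij S" "h \<in> Bij S" for g h
    using that by (simp add: BijGroup_def)
  have car: "carrier (BijGroup S) = Bij S" and one: "\<one>\<^bsub>BijGroup S\<^esub> = (\<lambda>x\<in>S. x)"
    by (simp_all add: BijGroup_def)
  show ?thesis (is "?L = ?R")
  proof
    assume L: ?L
    then have sub: "\<Gamma> \<subseteq> Bij S" using subgroup.subset car by blast
    show ?R
    proof (intro conjI ballI)
      show "(\<lambda>x\<in>S. x) \<in> \<Gamma>" using subgroup.one_closed[OF L] one by simp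
      show "compose S g h \<in> \<Gamma>" if "g \<in> \<Gamma>" "h \<in> \<Gamma>" for g h
        using subgroup.m_closed[OF L that] mult that sub by (metis subsetD)
      show "\<exists>h\<in>\<Gamma>. compose S h g = (\<lambda>x\<in>S. x)" if "g \<in> \<Gamma>" for g
      proof (intro bexI)
        show i: "inv\<^bsub>BijGroup S\<^esub> g \<in> \<Gamma>" using subgroup.m_inv_closed[OF L that] .
        show "compose S (inv\<^bsub>BijGroup S\<^esub> g) g = (\<lambda>x\<in>S. x)"
        proof -
          have B: "g \<in> Bij S" "inv\<^bsub>BijGroup S\<^esub> g \<in> Bij S" using that i sub by blast+
          then show ?thesis using l_inv[of g] by (simp add: mult car one)
        qed
      qed
    qed (use sub in auto)
  next
    assume R: ?R
    show ?L
    proof (rule subgroupI)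
      show "inv\<^bsub>BijGroup S\<^esub> g \<in> \<Gamma>" if g: "g \<in> \<Gamma>" for g
      proof -
        obtain h where h: "h \<in> \<Gamma>" "compose S h g = (\<lambda>x\<in>S. x)" using R g by blast
        then have "inv\<^bsub>BijGroup S\<^esub> g = h"
          using R g by (intro inv_equality) (auto simp: car one mult subset_iff)
        then show ?thesis using h by simp
      qed
      show "g \<otimes>\<^bsub>BijGroup S\<^esub> h \<in> \<Gamma>" if "g \<in> \<Gamma>" "h \<in> \<Gamma>" for g h
        using R that mult by (metis subsetD)
    qed (use R car in auto)
  qed
qed

lemma transformation_group_apply:
  assumes "subgroup \<Gamma> (BijGroup S)" "\<gamma> \<in> \<Gamma>" "x \<in> S" shows "\<gamma> x \<in> S"
  using assms Bij_imp_funcset[of \<gamma> S] by (auto simp: subgroup_BijGroup_iff)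

lemma transformation_group_inverse:
  assumes "subgroup \<Gamma> (BijGroup S)" "\<gamma> \<in> \<Gamma>"
  obtains \<delta> where "\<delta> \<in> \<Gamma>" "\<forall>x\<in>S. \<delta> (\<gamma> x) = x"
proof -
  obtain \<delta> where "\<delta> \<in> \<Gamma>" "compose S \<delta> \<gamma> = (\<lambda>x\<in>S. x)" using assms by (auto simp: subgroup_BijGroup_iff)
  moreover have "\<delta> (\<gamma> x) = x" if "x \<in> S" for x
    using fun_cong[OF \<open>compose S \<delta> \<gamma> = (\<lambda>x\<in>S. x)\<close>, of x] that by (simp add: compose_eq)
  ultimately show ?thesis using that by blast
qed

lemma tg_orbit_eq_iff:
  assumes G: "subgroup \<Gamma> (BijGroup S)" and "x \<in> S" "y \<in> S"
  shows "tg_orbit \<Gamma> x = tg_orbit \<Gamma> y \<longleftrightarrow> (\<exists>\<gamma>\<in>\<Gamma>. y = \<gamma> x)"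
proof
  assume eq: "tg_orbit \<Gamma> x = tg_orbit \<Gamma> y"
  have "(\<lambda>x\<in>S. x) \<in> \<Gamma>" using G by (simp add: subgroup_BijGroup_iff)
  from imageI[OF this, of "\<lambda>\<gamma>. \<gamma> y"] have "y \<in> tg_orbit \<Gamma> y"
    using \<open>y \<in> S\<close> by (simp add: tg_orbit_def)
  then show "\<exists>\<gamma>\<in>\<Gamma>. y = \<gamma> x" using eq by (auto simp: tg_orbit_def)
next
  have sub: "tg_orbit \<Gamma> (\<gamma> u) \<subseteq> tg_orbit \<Gamma> u" if "\<gamma> \<in> \<Gamma>" "u \<in> S" for \<gamma> u
  proof
    fix w assume "w \<in> tg_orbit \<Gamma> (\<gamma> u)"
    then obtain \<delta> where "\<delta> \<in> \<Gamma>" "w = \<delta> (\<gamma> u)" by (auto simp: tg_orbit_def)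
    moreover have "compose S \<delta> \<gamma> \<in> \<Gamma>" using G \<open>\<delta> \<in> \<Gamma>\<close> that by (simp add: subgroup_BijGroup_iff)
    ultimately show "w \<in> tg_orbit \<Gamma> u"
      using that by (auto simp: tg_orbit_def image_iff compose_eq intro!: bexI[of _ "compose S \<delta> \<gamma>"])
  qed
  assume "\<exists>\<gamma>\<in>\<Gamma>. y = \<gamma> x"
  then obtain \<gamma> where \<gamma>: "\<gamma> \<in> \<Gamma>" "y = \<gamma> x" by blast
  obtain \<delta> where "\<delta> \<in> \<Gamma>" "\<delta> (\<gamma> x) = x"
    using transformation_group_inverse[OF G \<gamma>(1)] \<open>x \<in> S\<close> by blast
  then show "tg_orbit \<Gamma> x = tg_orbit \<Gamma> y"
    using sub[OF \<gamma>(1) \<open>x \<in> S\<close>] sub[of \<delta> y] \<gamma>(2) \<open>y \<in> S\<close> by auto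
qed

lemma open_mfd_simps [simp]: "mtop (open_mfd S) = top_of_set S" "mcharts (open_mfd S) = {(S, \<lambda>z. z)}"
  by (simp_all add: open_mfd_def)

lemma inv_into_ident: "z \<in> S \<Longrightarrow> inv_into S (\<lambda>z. z) z = z"
  using f_inv_into_f[of z "\<lambda>z. z" S] by simp

lemma second_countable_euclidean: "second_countable (euclidean :: 'a::second_countable_topology topology)"
proof -
  obtain B :: "'a set set" where B: "countable B" "topological_basis B"
    using ex_countable_basis by blast
  have "\<exists>V\<in>B. x \<in> V \<and> V \<subseteq> U" if "open U" "x \<in> U" for U x
    by (rule topological_basisE[OF B(2) that]) auto
  then show ?thesis
    unfolding second_countable_def using B(1) topological_basis_open[OF B(2)]
    by (intro exI[of _ B] conjI) auto
qed

lemma complex_manifold_open_mfd: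
  assumes "open S" shows "complex_manifold (open_mfd S)"
proof -
  have "cdiff_at ((\<lambda>z. z) \<circ> inv_into S (\<lambda>z. z)) z" if "z \<in> S" for z
    using cdiff_at_transform[OF cdiff_at_id assms that] by (simp add: inv_into_ident)
  moreover have "homeomorphic_map (top_of_set S) (top_of_set S) (\<lambda>z. z)"
    using homeomorphic_map_id[of "top_of_set S" "top_of_set S"] by (simp add: id_def)
  moreover have "Hausdorff_space (top_of_set S)"
    by (simp add: Hausdorff_space_subtopology Hausdorff_space_euclidean)
  ultimately show ?thesis
    using assms by (simp add: complex_manifold_def holomorphic_vec_on_iff second_countable_subtopology
        second_countable_euclidean subtopology_subtopology)
qed

lemma holomorphic_open_mfd_iff:
  assumes "open S"
  shows "holomorphic_mfd_map (open_mfd S) (open_mfd S') f \<longleftrightarrow> f ` S \<subseteq> S' \<and> (\<forall>z\<in>S. cdiff_at f z)"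
proof -
  have "cdiff_at ((\<lambda>z. z) \<circ> f \<circ> inv_into S (\<lambda>z. z)) z \<longleftrightarrow> cdiff_at f z" if "z \<in> S" for z
    using cdiff_at_transform[OF _ assms that, of "(\<lambda>z. z) \<circ> f \<circ> inv_into S (\<lambda>z. z)" f]
      cdiff_at_transform[OF _ assms that, of f "(\<lambda>z. z) \<circ> f \<circ> inv_into S (\<lambda>z. z)"]
    by (auto simp: inv_into_ident)
  moreover have "{x \<in> S. f x \<in> S'} = S" if "f ` S \<subseteq> S'" using that by auto
  ultimately show ?thesis
    by (auto simp: holomorphic_mfd_map_def holomorphic_vec_on_iff cdiff_at_imp_continuous_on)
qed

lemma pre_model_open_mfd_iff:
  "pre_model (open_mfd S) \<Gamma> \<longleftrightarrow> open S \<and> connected S \<and> subgroup \<Gamma> (BijGroup S) \<and>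
     (\<forall>\<gamma>\<in>\<Gamma>. \<forall>z\<in>S. cdiff_at \<gamma> z) \<and> connected (free_points S \<Gamma>) \<and> S \<subseteq> closure (free_points S \<Gamma>)"
proof (cases "open S")
  case True
  have fS: "free_points S \<Gamma> \<subseteq> S" by (auto simp: free_points_def)
  have "top_of_set S closure_of free_points S \<Gamma> = S \<inter> closure (free_points S \<Gamma>)"
    using fS by (simp add: closure_of_subtopology Int_absorb1)
  then have cl: "top_of_set S closure_of free_points S \<Gamma> = S \<longleftrightarrow> S \<subseteq> closure (free_points S \<Gamma>)"
    by blast
  have "\<gamma> ` S \<subseteq> S" if "subgroup \<Gamma> (BijGroup S)" "\<gamma> \<in> \<Gamma>" for \<gamma>
    using transformation_group_apply[OF that] by blast
  moreover have "connected_space (top_of_set S) \<longleftrightarrow> connected S"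
    using connectedin_def[of euclidean S] by simp
  ultimately show ?thesis
    using True fS complex_manifold_open_mfd[OF True]
    by (auto simp: pre_model_def holomorphic_open_mfd_iff connectedin_subtopology cl)
next
  case False
  then show ?thesis by (auto simp: pre_model_def complex_manifold_def)
qed

section \<open>Quasifold charts\<close>

text \<open>The parametrization of the chart domain by the covering set. Stating all chart
  properties for it avoids reasoning about sets of orbits.\<close>

definition qparam :: "('m, 'k::finite) qchart \<Rightarrow> complex^'k \<Rightarrow> 'm" where
  "qparam c z = qmap c (qproj c z)"

lemma topspace_quotient_topology [simp]: "topspace (quotient_topology T p) = p ` topspace T"
  using quotient_map_quotient_topology[of T p] by (simp add: quotient_map_def)

lemma topspace_qspace [simp]: "topspace (qspace c) = qproj c ` qcov c"
  by (simp add: model_space_def)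

lemma quotient_map_qproj: "quotient_map (top_of_set (qcov c)) (qspace c) (qproj c)"
  using quotient_map_quotient_topology[of "top_of_set (qcov c)" "qproj c"] by (simp add: model_space_def)

text \<open>A continuous open surjection is a quotient map. So is the projection to the orbits,
  hence also the map induced on orbits, and an injective quotient map is a homeomorphism.\<close>

lemma quasifold_chartI:
  assumes "openin T (qdom c)" "complex_model (open_mfd (qcov c)) (qgrp c)"
    and cont: "continuous_map (top_of_set (qcov c)) T (qparam c)"
    and op: "\<And>U. open U \<Longrightarrow> U \<subseteq> qcov c \<Longrightarrow> openin T (qparam c ` U)"
    and surj: "qparam c ` qcov c = qdom c"
    and inj: "\<And>z z'. z \<in> qcov c \<Longrightarrow> z' \<in> qcov c \<Longrightarrow> qparam c z = qparam c z' \<Longrightarrow> qproj c z = qproj c z'"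
  shows "quasifold_chart T c"
proof -
  have "open (qcov c)" using assms(2) by (simp add: complex_model_def pre_model_open_mfd_iff)
  have eq: "qmap c \<circ> qproj c = qparam c" by (auto simp: qparam_def)
  have dT: "topspace (subtopology T (qdom c)) = qdom c"
    using openin_subset[OF assms(1)] by auto
  have c: "continuous_map (top_of_set (qcov c)) (subtopology T (qdom c)) (qparam c)"
    using cont surj by (auto simp: continuous_map_in_subtopology)
  have "quotient_map (top_of_set (qcov c)) (subtopology T (qdom c)) (qparam c)"
  proof (rule continuous_open_imp_quotient_map[OF c])
    show "open_map (top_of_set (qcov c)) (subtopology T (qdom c)) (qparam c)"
      unfolding open_map_def
    proof (intro allI impI)
      fix U assume U: "openin (top_of_set (qcov c)) U"
      then have "open U" "U \<subseteq> qcov c"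
        using \<open>open (qcov c)\<close> by (auto simp: openin_open_eq)
      then show "openin (subtopology T (qdom c)) (qparam c ` U)"
        using op surj assms(1) by (auto simp: openin_open_subtopology)
    qed
  qed (use surj dT in auto)
  then have "quotient_map (qspace c) (subtopology T (qdom c)) (qmap c)"
    using quotient_map_compose_eq[OF quotient_map_qproj, of c _ "qmap c"] eq by simp
  moreover have "inj_on (qmap c) (topspace (qspace c))"
  proof (rule inj_onI)
    fix x x' assume "x \<in> topspace (qspace c)" "x' \<in> topspace (qspace c)" and e: "qmap c x = qmap c x'"
    then obtain z z' where z: "z \<in> qcov c" "z' \<in> qcov c" "x = qproj c z" "x' = qproj c z'" by auto
    with e inj[OF z(1,2)] show "x = x'" by (simp add: qparam_def)
  qed
  ultimately show ?thesis
    using assms(1,2) \<open>open (qcov c)\<close> by (simp add: quasifold_chart_def homeomorphic_map_def)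
qed

lemma quasifold_chartD:
  assumes c: "quasifold_chart T c"
  shows qchart_openin_dom: "openin T (qdom c)"
    and qchart_model: "complex_model (open_mfd (qcov c)) (qgrp c)"
    and qchart_pre_model: "pre_model (open_mfd (qcov c)) (qgrp c)"
    and qchart_open: "open (qcov c)"
    and qchart_group: "subgroup (qgrp c) (BijGroup (qcov c))"
    and qparam_continuous: "continuous_map (top_of_set (qcov c)) T (qparam c)"
    and qparam_open: "\<And>U. open U \<Longrightarrow> U \<subseteq> qcov c \<Longrightarrow> openin T (qparam c ` U)"
    and qparam_surj: "qparam c ` qcov c = qdom c"
    and qmap_inj: "inj_on (qmap c) (topspace (qspace c))"
    and qparam_inj: "\<And>z z'. z \<in> qcov c \<Longrightarrow> z' \<in> qcov c \<Longrightarrow> qparam c z = qparam c z' \<Longrightarrow> qproj c z = qproj c z'"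
proof -
  show dom: "openin T (qdom c)" and model: "complex_model (open_mfd (qcov c)) (qgrp c)" and "open (qcov c)"
    using c by (auto simp: quasifold_chart_def)
  show pre: "pre_model (open_mfd (qcov c)) (qgrp c)" using model by (simp add: complex_model_def)
  show grp: "subgroup (qgrp c) (BijGroup (qcov c))" using pre by (simp add: pre_model_open_mfd_iff)
  have h: "homeomorphic_map (qspace c) (subtopology T (qdom c)) (qmap c)"
    using c by (auto simp: quasifold_chart_def)
  have eq: "qmap c \<circ> qproj c = qparam c" by (auto simp: qparam_def)
  have dT: "topspace (subtopology T (qdom c)) = qdom c"
    using openin_subset[OF dom] by auto
  have "continuous_map (qspace c) T (qmap c)"
    using homeomorphic_imp_continuous_map[OF h] continuous_map_in_subtopology by blast
  then show "continuous_map (top_of_set (qcov c)) T (qparam c)"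
    using continuous_map_compose[OF quotient_imp_continuous_map[OF quotient_map_qproj[of c]]]
    unfolding eq[symmetric] by blast
  show "qparam c ` qcov c = qdom c"
    using homeomorphic_imp_surjective_map[OF h] dT eq by (simp add: image_comp)
  show inj: "inj_on (qmap c) (topspace (qspace c))"
    using h by (simp add: homeomorphic_map_def)
  show "qproj c z = qproj c z'" if "z \<in> qcov c" "z' \<in> qcov c" "qparam c z = qparam c z'" for z z'
    using that by (intro inj_onD[OF inj]) (auto simp: qparam_def)
  fix U assume U: "open U" "U \<subseteq> qcov c"
  have cont: "continuous_on (qcov c) \<gamma>" if "\<gamma> \<in> qgrp c" for \<gamma>
    using pre that by (intro cdiff_at_imp_continuous_on) (auto simp: pre_model_open_mfd_iff)
  \<comment> \<open>The saturation of \<open>U\<close> is the union of its preimages under the group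
    elements; this makes the projection open.\<close>
  have "{z \<in> qcov c. qproj c z \<in> qproj c ` U} = (\<Union>\<gamma>\<in>qgrp c. {z \<in> qcov c. \<gamma> z \<in> U})"
    using tg_orbit_eq_iff[OF grp] U(2) by (fastforce simp: image_iff)
  moreover have "openin (top_of_set (qcov c)) {z \<in> qcov c. \<gamma> z \<in> U}" if "\<gamma> \<in> qgrp c" for \<gamma>
    using continuous_openin_preimage_gen[OF cont[OF that] U(1)] by (simp add: vimage_def Int_def)
  ultimately have "openin (top_of_set (qcov c)) {z \<in> qcov c. qproj c z \<in> qproj c ` U}"
    by auto
  then have "openin (qspace c) (qproj c ` U)"
    using U(2) by (simp add: model_space_def openin_quotient_topology image_mono)
  then have "openin (subtopology T (qdom c)) (qmap c ` qproj c ` U)"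
    using homeomorphic_imp_open_map[OF h] by (simp add: open_map_def)
  then show "openin T (qparam c ` U)"
    using openin_trans_full[OF _ dom] unfolding eq[symmetric] by (simp add: image_comp)
qed

section \<open>Covers of open sets\<close>

text \<open>The base has the identity as its only chart, so every chart of a cover is
  \<open>w\<close> on some open set. A universal cover of an open set is thus determined by a
  topology and the covering map.\<close>

definition cover_mfd :: "'a topology \<Rightarrow> (complex^'k::finite) set \<Rightarrow> ('a \<Rightarrow> complex^'k) \<Rightarrow> ('a, 'k) cmfd" where
  "cover_mfd T S w = \<lparr>mtop = T, mcharts = {(U, w) |U. openin T U \<and> openin (top_of_set S) (w ` U) \<and>
     homeomorphic_map (subtopology T U) (subtopology (top_of_set S) (w ` U)) w}\<rparr>"

lemma mtop_cover_mfd [simp]: "mtop (cover_mfd T S w) = T"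
  by (simp add: cover_mfd_def)

lemma universal_cover_open_mfd_iff:
  "universal_cover M w (open_mfd S) \<longleftrightarrow>
     simply_connected_space (mtop M) \<and> covering_map (mtop M) (top_of_set S) w \<and> M = cover_mfd (mtop M) S w"
proof -
  have "{(U, h \<circ> w) |U V h. (V, h) \<in> mcharts (open_mfd S) \<and> openin (mtop M) U \<and>
        openin (mtop (open_mfd S)) (w ` U) \<and> w ` U \<subseteq> V \<and>
        homeomorphic_map (subtopology (mtop M) U) (subtopology (mtop (open_mfd S)) (w ` U)) w} =
     {(U, w) |U. openin (mtop M) U \<and> openin (top_of_set S) (w ` U) \<and>
        homeomorphic_map (subtopology (mtop M) U) (subtopology (top_of_set S) (w ` U)) w}"
    by (auto simp: o_def dest: openin_imp_subset)
  moreover have "M = cover_mfd (mtop M) S w \<longleftrightarrow> mcharts M =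
     {(U, w) |U. openin (mtop M) U \<and> openin (top_of_set S) (w ` U) \<and>
        homeomorphic_map (subtopology (mtop M) U) (subtopology (top_of_set S) (w ` U)) w}"
    by (cases M) (simp add: cover_mfd_def)
  ultimately show ?thesis
    by (simp only: universal_cover_def open_mfd_simps)
qed

text \<open>A branch of the inverse of \<open>w\<close> through \<open>x\<close>. It need not come
  from a chart of the cover and may be any convenient formula, such as a logarithm.\<close>

definition local_section :: "'a topology \<Rightarrow> ('a \<Rightarrow> complex^'k) \<Rightarrow> 'a \<Rightarrow> (complex^'k) set \<Rightarrow> (complex^'k \<Rightarrow> 'a) \<Rightarrow> bool" where
  "local_section T w x N s \<longleftrightarrow> open N \<and> w x \<in> N \<and> continuous_map (top_of_set N) T s \<and> s (w x) = x \<and>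
     (\<forall>y\<in>N. w (s y) = y)"

lemma mcharts_cover_mfd_iff:
  assumes "open S"
  shows "(U, h) \<in> mcharts (cover_mfd T S w) \<longleftrightarrow> h = w \<and> openin T U \<and> open (w ` U) \<and> w ` U \<subseteq> S \<and>
     homeomorphic_map (subtopology T U) (top_of_set (w ` U)) w"
proof -
  have "openin (top_of_set S) (w ` U) \<longleftrightarrow> open (w ` U) \<and> w ` U \<subseteq> S"
    using assms by (auto simp: openin_open_eq)
  moreover have "subtopology (top_of_set S) (w ` U) = top_of_set (w ` U)" if "w ` U \<subseteq> S"
    using that by (simp add: subtopology_subtopology Int_absorb1)
  ultimately show ?thesis by (auto simp: cover_mfd_def)
qed

text \<open>The sheet through \<open>x\<close> over an evenly covered neighbourhood, cut down to
  \<open>N\<close>, is mapped homeomorphically onto an open set.\<close>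

lemma covering_chart_at:
  assumes cov: "covering_map T (top_of_set S) w" and "open S" and "openin T N" "x \<in> N"
  obtains U where "x \<in> U" "U \<subseteq> N" "(U, w) \<in> mcharts (cover_mfd T S w)"
proof -
  have xT: "x \<in> topspace T" using assms(3,4) openin_subset by blast
  then have pt: "w x \<in> topspace (top_of_set S)"
    using cov unfolding covering_map_def by blast
  have ev: "\<forall>x\<in>topspace (top_of_set S). \<exists>U. x \<in> U \<and> openin (top_of_set S) U \<and>
        (\<exists>\<V>. \<Union>\<V> = {u \<in> topspace T. w u \<in> U} \<and> (\<forall>V\<in>\<V>. openin T V) \<and> disjoint \<V> \<and>
             (\<forall>V\<in>\<V>. homeomorphic_map (subtopology T V) (subtopology (top_of_set S) U) w))"
    using cov unfolding covering_map_def by (elim conjE)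
  from bspec[OF ev pt] obtain E \<V> where E: "w x \<in> E" "openin (top_of_set S) E" "\<Union>\<V> = {u \<in> topspace T. w u \<in> E}"
    "\<forall>V\<in>\<V>. openin T V"
    "\<forall>V\<in>\<V>. homeomorphic_map (subtopology T V) (subtopology (top_of_set S) E) w"
    by (elim exE conjE) (rule that)
  have "x \<in> \<Union>\<V>" using E(1) xT unfolding E(3) by simp
  then obtain V where V: "V \<in> \<V>" "x \<in> V" by blast
  have ES: "E \<subseteq> S" "open E" using E(2) \<open>open S\<close> by (auto simp: openin_open_eq)
  have h: "homeomorphic_map (subtopology T V) (top_of_set E) w"
    using bspec[OF E(5) V(1)] ES by (simp add: subtopology_subtopology Int_absorb1)
  have VT: "openin T V" using E(4) V by blast
  define U where "U = V \<inter> N"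
  have UT: "openin T U" unfolding U_def using VT assms(3) by blast
  have "openin (subtopology T V) U" using UT by (auto simp: openin_subtopology U_def)
  then have op: "openin (top_of_set E) (w ` U)"
    using homeomorphic_imp_open_map[OF h] by (simp add: open_map_def)
  then have oU: "open (w ` U)" "w ` U \<subseteq> E" using ES by (auto simp: openin_open_eq)
  have "homeomorphic_map (subtopology (subtopology T V) U) (subtopology (top_of_set E) (w ` U)) w"
    using openin_subset[OF UT] oU by (intro homeomorphic_map_subtopologies[OF h]) (auto simp: U_def)
  then have "homeomorphic_map (subtopology T U) (top_of_set (w ` U)) w"
    using oU by (simp add: subtopology_subtopology U_def Int_absorb1)
  then have "(U, w) \<in> mcharts (cover_mfd T S w)"
    using mcharts_cover_mfd_iff[OF \<open>open S\<close>] UT oU ES by blast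
  then show ?thesis using that[of U] V assms(4) by (simp add: U_def)
qed

lemma local_section_inv_into:
  assumes "open S" and U: "(U, w) \<in> mcharts (cover_mfd T S w)" and "x \<in> U"
  shows "local_section T w x (w ` U) (inv_into U w)"
proof -
  have UT: "openin T U" and op: "open (w ` U)" and h: "homeomorphic_map (subtopology T U) (top_of_set (w ` U)) w"
    using U mcharts_cover_mfd_iff[OF \<open>open S\<close>] by blast+
  have tU: "topspace (subtopology T U) = U" using openin_subset[OF UT] by auto
  have inj: "inj_on w U" using h tU by (simp add: homeomorphic_map_def)
  obtain g where g: "homeomorphic_maps (subtopology T U) (top_of_set (w ` U)) w g"
    using h homeomorphic_map_maps by blast
  then have "continuous_map (top_of_set (w ` U)) T g"
    by (auto simp: homeomorphic_maps_def continuous_map_in_subtopology)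
  moreover have "g y = inv_into U w y" if y: "y \<in> topspace (top_of_set (w ` U))" for y
  proof -
    obtain u where u: "u \<in> U" "y = w u" using y by auto
    then have "g y = u" using g tU by (auto simp: homeomorphic_maps_def)
    then show ?thesis using u inj by simp
  qed
  ultimately have "continuous_map (top_of_set (w ` U)) T (inv_into U w)"
    by (rule continuous_map_eq)
  then show ?thesis
    using op \<open>x \<in> U\<close> inj by (auto simp: local_section_def)
qed

text \<open>A section through \<open>x\<close> stays near \<open>w x\<close> inside any given chart
  domain around \<open>x\<close>, where \<open>w\<close> is injective, and so agrees there with the
  inverse of the chart. One section at each point therefore decides holomorphy in all
  charts.\<close>

lemma cover_holomorphicI:
  assumes "open S" "open S'" and cont: "continuous_map T T' f"
    and loc: "\<And>x. x \<in> topspace T \<Longrightarrow> \<exists>N s. local_section T w x N s \<and> cdiff_at (\<lambda>y. w' (f (s y))) (w x)"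
  shows "holomorphic_mfd_map (cover_mfd T S w) (cover_mfd T' S' w') f"
proof -
  have "cdiff_at (w' \<circ> f \<circ> inv_into U w) (w x)"
    if U: "(U, w) \<in> mcharts (cover_mfd T S w)" and "x \<in> U" for U x
  proof -
    have UT: "openin T U" and h: "homeomorphic_map (subtopology T U) (top_of_set (w ` U)) w"
      using U mcharts_cover_mfd_iff[OF \<open>open S\<close>] by blast+
    have tU: "topspace (subtopology T U) = U" using openin_subset[OF UT] by auto
    have inj: "inj_on w U" using h tU by (simp add: homeomorphic_map_def)
    have "x \<in> topspace T" using \<open>x \<in> U\<close> openin_subset[OF UT] by blast
    then obtain N s where s: "open N" "w x \<in> N" "continuous_map (top_of_set N) T s" "s (w x) = x"
        "\<And>y. y \<in> N \<Longrightarrow> w (s y) = y" and d: "cdiff_at (\<lambda>y. w' (f (s y))) (w x)"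
      using loc[of x] unfolding local_section_def by blast
    define N' where "N' = {y \<in> N. s y \<in> U}"
    have "openin (top_of_set N) N'"
      using openin_continuous_map_preimage[OF s(3) UT] by (simp add: N'_def)
    then have "open N'" using s(1) openin_open_eq by blast
    moreover have "w x \<in> N'" using s \<open>x \<in> U\<close> by (simp add: N'_def)
    moreover have "w' (f (s y)) = (w' \<circ> f \<circ> inv_into U w) y" if "y \<in> N'" for y
    proof -
      have "inv_into U w (w (s y)) = s y" using that inj by (simp add: N'_def)
      then show ?thesis using that s(5) by (simp add: N'_def)
    qed
    ultimately show ?thesis using cdiff_at_transform[OF d] by blast
  qed
  then have *: "holomorphic_vec_on (w' \<circ> f \<circ> inv_into U w) (w ` {x \<in> U. f x \<in> U'})"
    if "(U, w) \<in> mcharts (cover_mfd T S w)" for U U'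
    using that unfolding holomorphic_vec_on_iff by auto
  have "holomorphic_vec_on (h' \<circ> f \<circ> inv_into U h) (h ` {x \<in> U. f x \<in> U'})"
    if "(U, h) \<in> mcharts (cover_mfd T S w)" "(U', h') \<in> mcharts (cover_mfd T' S' w')" for U h U' h'
  proof -
    have "h = w" "h' = w'"
      using that by (simp_all add: mcharts_cover_mfd_iff[OF \<open>open S\<close>] mcharts_cover_mfd_iff[OF \<open>open S'\<close>])
    then show ?thesis using * that by simp
  qed
  note ** = this
  have "\<forall>(U, h)\<in>mcharts (cover_mfd T S w). \<forall>(U', h')\<in>mcharts (cover_mfd T' S' w').
      holomorphic_vec_on (h' \<circ> f \<circ> inv_into U h) (h ` {x \<in> U. f x \<in> U'})"
    by clarify (rule **)
  then show ?thesis
    unfolding holomorphic_mfd_map_def mtop_cover_mfd using cont by (intro conjI)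
qed

text \<open>For the converse direction the inverse of a chart serves as the section.\<close>

lemma cover_holomorphicD:
  assumes "open S" "open S'" and cov: "covering_map T (top_of_set S) w" "covering_map T' (top_of_set S') w'"
    and hol: "holomorphic_mfd_map (cover_mfd T S w) (cover_mfd T' S' w') f" and x: "x \<in> topspace T"
  shows "\<exists>N s. local_section T w x N s \<and> cdiff_at (\<lambda>y. w' (f (s y))) (w x)"
proof -
  have cont: "continuous_map T T' f" using hol by (simp add: holomorphic_mfd_map_def)
  have fx: "f x \<in> topspace T'" using continuous_map_funspace[OF cont] x by blast
  obtain U where U: "x \<in> U" "(U, w) \<in> mcharts (cover_mfd T S w)"
    by (rule covering_chart_at[OF cov(1) assms(1) openin_topspace x])
  obtain U' where U': "f x \<in> U'" "(U', w') \<in> mcharts (cover_mfd T' S' w')"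
    by (rule covering_chart_at[OF cov(2) assms(2) openin_topspace fx])
  have "\<forall>(U, h)\<in>mcharts (cover_mfd T S w). \<forall>(U', h')\<in>mcharts (cover_mfd T' S' w').
      holomorphic_vec_on (h' \<circ> f \<circ> inv_into U h) (h ` {x \<in> U. f x \<in> U'})"
    using hol unfolding holomorphic_mfd_map_def by (elim conjE)
  from bspec[OF this U(2)] have "\<forall>(U', h')\<in>mcharts (cover_mfd T' S' w').
      holomorphic_vec_on (h' \<circ> f \<circ> inv_into U w) (w ` {x \<in> U. f x \<in> U'})" by (simp only: prod.case)
  from bspec[OF this U'(2)]
  have "holomorphic_vec_on (w' \<circ> f \<circ> inv_into U w) (w ` {x \<in> U. f x \<in> U'})" by (simp only: prod.case)
  then have "cdiff_at (w' \<circ> f \<circ> inv_into U w) (w x)"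
    using U(1) U'(1) by (auto simp: holomorphic_vec_on_iff)
  then show ?thesis
    using local_section_inv_into[OF assms(1) U(2,1)] by (auto simp: o_def)
qed

text \<open>\<open>biholomorphic_mfd_map\<close> speaks of \<open>inv_into\<close>, which is only
  known to agree with the explicit inverse \<open>G\<close> on the underlying space. Holomorphy is
  carried over along this agreement.\<close>

lemma cover_biholomorphicI:
  assumes "open S" "open S'" and cov: "covering_map T (top_of_set S) w" "covering_map T' (top_of_set S') w'"
    and F: "holomorphic_mfd_map (cover_mfd T S w) (cover_mfd T' S' w') F"
    and G: "holomorphic_mfd_map (cover_mfd T' S' w') (cover_mfd T S w) G"
    and GF: "\<And>x. x \<in> topspace T \<Longrightarrow> G (F x) = x" and FG: "\<And>y. y \<in> topspace T' \<Longrightarrow> F (G y) = y"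
  shows "biholomorphic_mfd_map (cover_mfd T S w) (cover_mfd T' S' w') F"
proof -
  have cF: "continuous_map T T' F" and cG: "continuous_map T' T G"
    using F G by (auto simp: holomorphic_mfd_map_def)
  have FT: "F x \<in> topspace T'" if "x \<in> topspace T" for x using continuous_map_funspace[OF cF] that by blast
  have GT: "G y \<in> topspace T" if "y \<in> topspace T'" for y using continuous_map_funspace[OF cG] that by blast
  have bij: "bij_betw F (topspace T) (topspace T')"
    by (rule bij_betw_byWitness[where f' = G]) (use FT GT GF FG in auto)
  have eq: "G y = inv_into (topspace T) F y" if "y \<in> topspace T'" for y
    using inv_into_f_f[OF bij_betw_imp_inj_on[OF bij] GT[OF that]] FG[OF that] by simp
  have "holomorphic_mfd_map (cover_mfd T' S' w') (cover_mfd T S w) (inv_into (topspace T) F)"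
  proof (rule cover_holomorphicI[OF assms(2,1)])
    show "continuous_map T' T (inv_into (topspace T) F)" using continuous_map_eq[OF cG eq] .
    fix y assume "y \<in> topspace T'"
    from cover_holomorphicD[OF assms(2,1) cov(2,1) G this]
    obtain N s where s: "local_section T' w' y N s" and d: "cdiff_at (\<lambda>u. w (G (s u))) (w' y)" by blast
    have sT: "s u \<in> topspace T'" if "u \<in> N" for u
      using s that continuous_map_funspace[of "top_of_set N" T' s] by (auto simp: local_section_def)
    have "cdiff_at (\<lambda>u. w (inv_into (topspace T) F (s u))) (w' y)"
    proof (rule cdiff_at_transform[OF d])
      show "open N" "w' y \<in> N" using s by (auto simp: local_section_def)
      show "w (G (s u)) = w (inv_into (topspace T) F (s u))" if "u \<in> N" for u
        using eq[OF sT[OF that]] by simp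
    qed
    then show "\<exists>N s. local_section T' w' y N s \<and> cdiff_at (\<lambda>u. w (inv_into (topspace T) F (s u))) (w' y)"
      using s by blast
  qed
  then show ?thesis using bij F by (simp add: biholomorphic_mfd_map_def)
qed

lemma covering_map_ident: "covering_map T T (\<lambda>z. z)"
  unfolding covering_map_def
proof (intro conjI ballI)
  fix x assume "x \<in> topspace T"
  have "homeomorphic_map (subtopology T (topspace T)) (subtopology T (topspace T)) (\<lambda>z. z)"
    using homeomorphic_map_id[of "subtopology T (topspace T)" "subtopology T (topspace T)"] by (simp add: id_def)
  then show "\<exists>U. x \<in> U \<and> openin T U \<and> (\<exists>\<V>. \<Union>\<V> = {u \<in> topspace T. u \<in> U} \<and> (\<forall>V\<in>\<V>. openin T V) \<and>
      disjoint \<V> \<and> (\<forall>V\<in>\<V>. homeomorphic_map (subtopology T V) (subtopology T U) (\<lambda>z. z)))"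
    using \<open>x \<in> topspace T\<close> by (intro exI[of _ "topspace T"] conjI exI[of _ "{topspace T}"]) auto
qed auto

section \<open>Compatibility of charts\<close>

definition qoverlap :: "('m, 'k::finite) qchart \<Rightarrow> ('m, 'k) qchart \<Rightarrow> (complex^'k) set" where
  "qoverlap c c' = {z \<in> qcov c. qparam c z \<in> qdom c'}"

text \<open>Both orders of the intersection occur, since \<open>compatible_charts\<close> writes the
  preimages in the two charts with the same order of the domains.\<close>

lemma qlift_overlap:
  assumes "quasifold_chart T c"
  shows "qlift c {x \<in> topspace (qspace c). qmap c x \<in> qdom c \<inter> qdom c'} = qoverlap c c'"
    and "qlift c {x \<in> topspace (qspace c). qmap c x \<in> qdom c' \<inter> qdom c} = qoverlap c c'"
  using qparam_surj[OF assms] by (auto simp: qlift_def qoverlap_def qparam_def)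

lemma openin_qspace_overlap:
  assumes c: "quasifold_chart T c" and c': "quasifold_chart T c'"
  shows "openin (qspace c) {x \<in> topspace (qspace c). qmap c x \<in> qdom c \<inter> qdom c'}"
proof -
  have "homeomorphic_map (qspace c) (subtopology T (qdom c)) (qmap c)"
    using c by (auto simp: quasifold_chart_def)
  then have "continuous_map (qspace c) T (qmap c)"
    using homeomorphic_imp_continuous_map continuous_map_in_subtopology by blast
  then show ?thesis
    by (rule openin_continuous_map_preimage)
      (intro openin_Int qchart_openin_dom[OF c] qchart_openin_dom[OF c'])
qed

text \<open>What \<open>submodel\<close> demands of an overlap beyond openness; the openness is
  automatic.\<close>

definition overlap_model :: "('m, 'k::finite) qchart \<Rightarrow> ('m, 'k) qchart \<Rightarrow> bool" where
  "overlap_model c c' \<longleftrightarrow>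
     pre_model (open_mfd (qoverlap c c')) ((\<lambda>\<gamma>. restrict \<gamma> (qoverlap c c')) ` qgrp c)"

text \<open>The map of orbit spaces is forced by the two chart maps, and it is bijective because
  both charts parametrize the same intersection. What remains is a biholomorphism of the covers that
  preserves the parametrized point.\<close>

lemma compatible_chartsI:
  fixes c c' :: "('m, 'k::finite) qchart" and T1 T2 :: "(complex^'k) topology"
  assumes c: "quasifold_chart T c" and c': "quasifold_chart T c'"
    and "overlap_model c c'" "overlap_model c' c"
    and sc: "simply_connected_space T1" "simply_connected_space T2"
    and cov: "covering_map T1 (top_of_set (qoverlap c c')) w" "covering_map T2 (top_of_set (qoverlap c' c)) w'"
    and F: "biholomorphic_mfd_map (cover_mfd T1 (qoverlap c c') w) (cover_mfd T2 (qoverlap c' c) w') F"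
    and eq: "\<And>u. u \<in> topspace T1 \<Longrightarrow> qparam c' (w' (F u)) = qparam c (w u)"
  shows "compatible_charts c c'"
proof -
  define U where "U = {x \<in> topspace (qspace c). qmap c x \<in> qdom c \<inter> qdom c'}"
  define U' where "U' = {x \<in> topspace (qspace c'). qmap c' x \<in> qdom c \<inter> qdom c'}"
  have qU: "qlift c U = qoverlap c c'" "qlift c' U' = qoverlap c' c"
    unfolding U_def U'_def using qlift_overlap[OF c] qlift_overlap[OF c'] by blast+
  have "openin (qspace c) U" unfolding U_def by (rule openin_qspace_overlap[OF c c'])
  then have s1: "submodel c U" using assms(3) by (simp add: submodel_def overlap_model_def qU)
  have "openin (qspace c') U'"
    using openin_qspace_overlap[OF c' c] by (simp add: U'_def Int_commute)
  then have s2: "submodel c' U'" using assms(4) by (simp add: submodel_def overlap_model_def qU)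
  let ?f = "inv_into (topspace (qspace c')) (qmap c') \<circ> qmap c"
  \<comment> \<open>The injective map \<open>qmap c'\<close> is undone by \<open>inv_into\<close>,
    so \<open>?f\<close> relates the orbits of any two parameters of the same point.\<close>
  have f: "?f (qproj c z) = qproj c' z'" if "z \<in> qcov c" "z' \<in> qcov c'" "qparam c z = qparam c' z'" for z z'
    using that inv_into_f_f[OF qmap_inj[OF c'], of "qproj c' z'"] by (simp add: qparam_def)
  have wT: "w ` topspace T1 = qoverlap c c'" "w' ` topspace T2 = qoverlap c' c"
    using cov by (auto simp: covering_map_def)
  have bij: "bij_betw ?f (qproj c ` qoverlap c c') (qproj c' ` qoverlap c' c)"
  proof (rule bij_betw_imageI)
    have 1: "\<exists>z'\<in>qoverlap c' c. qparam c z = qparam c' z'" if "z \<in> qoverlap c c'" for z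
      using that qparam_surj[OF c] qparam_surj[OF c'] by (force simp: qoverlap_def image_iff)
    have 2: "\<exists>z\<in>qoverlap c c'. qparam c z = qparam c' z'" if "z' \<in> qoverlap c' c" for z'
      using that qparam_surj[OF c] qparam_surj[OF c'] by (force simp: qoverlap_def image_iff)
    have sub: "qoverlap c c' \<subseteq> qcov c" "qoverlap c' c \<subseteq> qcov c'" by (auto simp: qoverlap_def)
    show "inj_on ?f (qproj c ` qoverlap c c')"
    proof (rule inj_onI)
      fix x y assume "x \<in> qproj c ` qoverlap c c'" "y \<in> qproj c ` qoverlap c c'" and e: "?f x = ?f y"
      then obtain a b where ab: "a \<in> qoverlap c c'" "b \<in> qoverlap c c'" "x = qproj c a" "y = qproj c b" by blast
      obtain a' where a': "a' \<in> qoverlap c' c" "qparam c a = qparam c' a'" using 1[OF ab(1)] by blast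
      obtain b' where b': "b' \<in> qoverlap c' c" "qparam c b = qparam c' b'" using 1[OF ab(2)] by blast
      have "?f x = qproj c' a'" unfolding ab(3) by (rule f) (use ab a' sub in auto)
      moreover have "?f y = qproj c' b'" unfolding ab(4) by (rule f) (use ab b' sub in auto)
      ultimately have "qproj c' a' = qproj c' b'" using e by simp
      then have "qparam c a = qparam c b" using a' b' by (simp add: qparam_def)
      then show "x = y" using qparam_inj[OF c, of a b] ab sub by auto
    qed
    show "?f ` qproj c ` qoverlap c c' = qproj c' ` qoverlap c' c"
    proof (intro equalityI subsetI)
      fix y assume "y \<in> ?f ` qproj c ` qoverlap c c'"
      then obtain a where a: "a \<in> qoverlap c c'" "y = ?f (qproj c a)" by blast
      obtain a' where a': "a' \<in> qoverlap c' c" "qparam c a = qparam c' a'" using 1[OF a(1)] by blast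
      have "y = qproj c' a'" unfolding a(2) by (rule f) (use a a' sub in auto)
      then show "y \<in> qproj c' ` qoverlap c' c" using a' by blast
    next
      fix y assume "y \<in> qproj c' ` qoverlap c' c"
      then obtain a' where a': "a' \<in> qoverlap c' c" "y = qproj c' a'" by blast
      obtain a where a: "a \<in> qoverlap c c'" "qparam c a = qparam c' a'" using 2[OF a'(1)] by blast
      have "?f (qproj c a) = y" unfolding a'(2) by (rule f) (use a a' sub in auto)
      then show "y \<in> ?f ` qproj c ` qoverlap c c'" using a by blast
    qed
  qed
  have "biholomorphic_model_map (cover_mfd T1 (qoverlap c c') w) (qproj c \<circ> w)
      (cover_mfd T2 (qoverlap c' c) w') (qproj c' \<circ> w') ?f"
    unfolding biholomorphic_model_map_def
  proof (intro conjI exI[of _ F] ballI F)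
    show "bij_betw ?f ((qproj c \<circ> w) ` topspace (mtop (cover_mfd T1 (qoverlap c c') w)))
       ((qproj c' \<circ> w') ` topspace (mtop (cover_mfd T2 (qoverlap c' c) w')))"
      unfolding mtop_cover_mfd image_comp[symmetric] wT by (rule bij)
    fix u assume u: "u \<in> topspace (mtop (cover_mfd T1 (qoverlap c c') w))"
    then have "F u \<in> topspace T2" using F by (auto simp: biholomorphic_mfd_map_def bij_betw_def)
    then have "w' (F u) \<in> qcov c'" "w u \<in> qcov c" using wT u by (auto simp: qoverlap_def)
    then have "?f (qproj c (w u)) = qproj c' (w' (F u))" using eq u by (intro f) simp_all
    then show "(qproj c' \<circ> w') (F u) = ?f ((qproj c \<circ> w) u)" by simp
  qed
  then have "\<exists>(M :: (complex^'k, 'k) cmfd) w (M' :: (complex^'k, 'k) cmfd) w'.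
              universal_cover M w (open_mfd (qlift c U)) \<and>
              universal_cover M' w' (open_mfd (qlift c' U')) \<and>
              biholomorphic_model_map M (qproj c \<circ> w) M' (qproj c' \<circ> w') ?f"
    using sc cov unfolding universal_cover_open_mfd_iff qU
    by (intro exI[of _ "cover_mfd T1 (qoverlap c c') w"] exI[of _ w]
        exI[of _ "cover_mfd T2 (qoverlap c' c) w'"] exI[of _ w'] conjI) simp_all
  then show ?thesis
    using s1 s2 unfolding compatible_charts_def Let_def U_def U'_def by blast
qed

text \<open>The converse form, for charts whose covers are not known explicitly, as in products of
  maximal atlases.\<close>

lemma compatible_chartsE:
  fixes c c' :: "('m, 'k::finite) qchart"
  assumes c: "quasifold_chart T c" and c': "quasifold_chart T c'" and comp: "compatible_charts c c'"
    and "qdom c \<inter> qdom c' \<noteq> {}"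
  obtains T1 T2 :: "(complex^'k) topology" and w w' F
  where "overlap_model c c'" "overlap_model c' c" "simply_connected_space T1" "simply_connected_space T2"
    "covering_map T1 (top_of_set (qoverlap c c')) w" "covering_map T2 (top_of_set (qoverlap c' c)) w'"
    "biholomorphic_mfd_map (cover_mfd T1 (qoverlap c c') w) (cover_mfd T2 (qoverlap c' c) w') F"
    "\<forall>u\<in>topspace T1. qparam c' (w' (F u)) = qparam c (w u)"
proof -
  define U where "U = {x \<in> topspace (qspace c). qmap c x \<in> qdom c \<inter> qdom c'}"
  define U' where "U' = {x \<in> topspace (qspace c'). qmap c' x \<in> qdom c \<inter> qdom c'}"
  let ?f = "inv_into (topspace (qspace c')) (qmap c') \<circ> qmap c"
  have qU: "qlift c U = qoverlap c c'" "qlift c' U' = qoverlap c' c"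
    unfolding U_def U'_def using qlift_overlap[OF c] qlift_overlap[OF c'] by blast+
  have *: "submodel c U \<and> submodel c' U' \<and>
           (\<exists>(M :: (complex^'k, 'k) cmfd) w (M' :: (complex^'k, 'k) cmfd) w'.
              universal_cover M w (open_mfd (qlift c U)) \<and>
              universal_cover M' w' (open_mfd (qlift c' U')) \<and>
              biholomorphic_model_map M (qproj c \<circ> w) M' (qproj c' \<circ> w') ?f)"
    using comp assms(4) unfolding compatible_charts_def Let_def U_def U'_def by blast
  then have m: "overlap_model c c'" "overlap_model c' c"
    by (simp_all add: submodel_def overlap_model_def qU)
  from * obtain M M' :: "(complex^'k, 'k) cmfd" and w w' where
    M: "universal_cover M w (open_mfd (qoverlap c c'))" "universal_cover M' w' (open_mfd (qoverlap c' c))"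
    and b: "biholomorphic_model_map M (qproj c \<circ> w) M' (qproj c' \<circ> w') ?f"
    unfolding qU by blast
  obtain F where F: "biholomorphic_mfd_map M M' F"
    and eq: "\<And>u. u \<in> topspace (mtop M) \<Longrightarrow> (qproj c' \<circ> w') (F u) = ?f ((qproj c \<circ> w) u)"
    using b unfolding biholomorphic_model_map_def by blast
  have cM: "simply_connected_space (mtop M)" "covering_map (mtop M) (top_of_set (qoverlap c c')) w"
    "M = cover_mfd (mtop M) (qoverlap c c') w"
    using M(1) unfolding universal_cover_open_mfd_iff by blast+
  have cM': "simply_connected_space (mtop M')" "covering_map (mtop M') (top_of_set (qoverlap c' c)) w'"
    "M' = cover_mfd (mtop M') (qoverlap c' c) w'"
    using M(2) unfolding universal_cover_open_mfd_iff by blast+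
  have eq': "qparam c' (w' (F u)) = qparam c (w u)" if u: "u \<in> topspace (mtop M)" for u
  proof -
    have "w u \<in> qoverlap c c'" using cM(2) u unfolding covering_map_def by auto
    then have "qparam c (w u) \<in> qparam c' ` qcov c'"
      using qparam_surj[OF c'] by (simp add: qoverlap_def)
    then have "qmap c (qproj c (w u)) \<in> qmap c' ` topspace (qspace c')"
      by (auto simp: qparam_def)
    from f_inv_into_f[OF this] show ?thesis using eq[OF u] by (simp add: qparam_def)
  qed
  have F': "biholomorphic_mfd_map (cover_mfd (mtop M) (qoverlap c c') w) (cover_mfd (mtop M') (qoverlap c' c) w') F"
    using F cM(3) cM'(3) by simp
  show ?thesis by (rule that[OF m cM(1) cM'(1) cM(2) cM'(2) F']) (intro ballI eq')
qed

text \<open>The overlap of a chart with itself is its whole covering set. This is simply connected,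
  hence its own universal cover, and the identity is the lift.\<close>

lemma compatible_charts_refl:
  assumes c: "quasifold_chart T c" shows "compatible_charts c c"
proof -
  have ov: "qoverlap c c = qcov c" using qparam_surj[OF c] by (auto simp: qoverlap_def)
  have "restrict \<gamma> (qcov c) = \<gamma>" if "\<gamma> \<in> qgrp c" for \<gamma>
    using qchart_group[OF c] that Bij_imp_extensional[of \<gamma> "qcov c"]
    by (auto simp: subgroup_BijGroup_iff extensional_restrict)
  then have "(\<lambda>\<gamma>. restrict \<gamma> (qcov c)) ` qgrp c = qgrp c" by simp
  then have m: "overlap_model c c"
    using qchart_pre_model[OF c] by (simp add: overlap_model_def ov)
  have sc: "simply_connected_space (top_of_set (qcov c))"
    using qchart_model[OF c] by (simp add: complex_model_def)
  have cov: "covering_map (top_of_set (qcov c)) (top_of_set (qoverlap c c)) (\<lambda>z. z)"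
    unfolding ov by (rule covering_map_ident)
  note op = qchart_open[OF c]
  have hol: "holomorphic_mfd_map (cover_mfd (top_of_set (qcov c)) (qcov c) (\<lambda>z. z))
      (cover_mfd (top_of_set (qcov c)) (qcov c) (\<lambda>z. z)) (\<lambda>z. z)"
  proof (rule cover_holomorphicI[OF op op])
    fix x assume "x \<in> topspace (top_of_set (qcov c))"
    then show "\<exists>N s. local_section (top_of_set (qcov c)) (\<lambda>z. z) x N s \<and> cdiff_at s x"
      using op by (intro exI[of _ "qcov c"] exI[of _ "\<lambda>z. z"]) (auto simp: local_section_def)
  qed simp
  have bi: "biholomorphic_mfd_map (cover_mfd (top_of_set (qcov c)) (qoverlap c c) (\<lambda>z. z))
      (cover_mfd (top_of_set (qcov c)) (qoverlap c c) (\<lambda>z. z)) (\<lambda>z. z)"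
    unfolding ov by (rule cover_biholomorphicI[OF op op _ _ hol hol]) (simp_all add: covering_map_ident)
  show ?thesis
    by (rule compatible_chartsI[OF c c m m sc sc cov cov bi]) simp
qed

text \<open>Every chart is compatible with itself, so a maximal family of pairwise compatible charts
  contains all charts compatible with its members.\<close>

lemma maximal_atlas_exists:
  assumes "\<And>c. c \<in> A\<^sub>0 \<Longrightarrow> quasifold_chart T c"
    and "\<And>c c'. c \<in> A\<^sub>0 \<Longrightarrow> c' \<in> A\<^sub>0 \<Longrightarrow> compatible_charts c c'"
    and "topspace T \<subseteq> (\<Union>c\<in>A\<^sub>0. qdom c)"
  obtains A where "A\<^sub>0 \<subseteq> A" "complex_quasifold T A"
proof -
  define \<A> where "\<A> = {A. A\<^sub>0 \<subseteq> A \<and> (\<forall>c\<in>A. quasifold_chart T c) \<and> (\<forall>c\<in>A. \<forall>c'\<in>A. compatible_charts c c')}"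
  have "A\<^sub>0 \<in> \<A>" using assms(1,2) by (simp add: \<A>_def)
  have "\<exists>M\<in>\<A>. \<forall>X\<in>\<A>. M \<subseteq> X \<longrightarrow> X = M"
  proof (rule subset_Zorn_nonempty)
    show "\<A> \<noteq> {}" using \<open>A\<^sub>0 \<in> \<A>\<close> by blast
    fix \<C> assume ne: "\<C> \<noteq> {}" and ch: "subset.chain \<A> \<C>"
    then have sub: "\<C> \<subseteq> \<A>" and tot: "\<And>X Y. X \<in> \<C> \<Longrightarrow> Y \<in> \<C> \<Longrightarrow> X \<subseteq> Y \<or> Y \<subseteq> X"
      by (auto simp: subset_chain_def)
    \<comment> \<open>Two charts of the union of a chain lie in a common member of the
      chain.\<close>
    have "compatible_charts c c'" if cc: "c \<in> \<Union>\<C>" "c' \<in> \<Union>\<C>" for c c'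
    proof -
      obtain X Y where "X \<in> \<C>" "c \<in> X" "Y \<in> \<C>" "c' \<in> Y" using cc by blast
      then obtain Z where "Z \<in> \<C>" "c \<in> Z" "c' \<in> Z" using tot[of X Y] by blast
      then show ?thesis using sub by (auto simp: \<A>_def)
    qed
    moreover have "quasifold_chart T c" if "c \<in> \<Union>\<C>" for c using that sub by (auto simp: \<A>_def)
    moreover have "A\<^sub>0 \<subseteq> \<Union>\<C>"
    proof -
      obtain X where "X \<in> \<C>" using ne by blast
      moreover from this have "A\<^sub>0 \<subseteq> X" using sub by (auto simp: \<A>_def)
      ultimately show ?thesis by blast
    qed
    ultimately show "\<Union>\<C> \<in> \<A>" by (simp add: \<A>_def)
  qed
  then obtain A where A: "A \<in> \<A>" and max: "\<And>X. X \<in> \<A> \<Longrightarrow> A \<subseteq> X \<Longrightarrow> X = A" by blast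
  have "c \<in> A" if c: "quasifold_chart T c" "\<forall>c'\<in>A. compatible_charts c c' \<and> compatible_charts c' c" for c
  proof -
    \<comment> \<open>The assumption covers the pairs of \<open>c\<close> with members of
      \<open>A\<close> in either order; reflexivity covers the pair of \<open>c\<close> with
      itself.\<close>
    have "insert c A \<in> \<A>"
      using A c compatible_charts_refl[OF c(1)] by (auto simp: \<A>_def)
    then show ?thesis using max[of "insert c A"] by blast
  qed
  moreover have "(\<Union>c\<in>A. qdom c) = topspace T"
  proof
    show "(\<Union>c\<in>A. qdom c) \<subseteq> topspace T"
      using A openin_subset[OF qchart_openin_dom] by (fastforce simp: \<A>_def)
    have "A\<^sub>0 \<subseteq> A" using A by (simp add: \<A>_def)
    then show "topspace T \<subseteq> (\<Union>c\<in>A. qdom c)" using assms(3) by blast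
  qed
  ultimately have "complex_quasifold T A" using A by (simp add: complex_quasifold_def \<A>_def)
  then show ?thesis using that A by (auto simp: \<A>_def)
qed

section \<open>Products\<close>

definition vprod :: "(complex^'k) set \<Rightarrow> (complex^'l) set \<Rightarrow> (complex^('k::finite + 'l::finite)) set" where
  "vprod A B = {z. vleft z \<in> A \<and> vright z \<in> B}"

definition vmap :: "(complex^'k \<Rightarrow> complex^'k2) \<Rightarrow> (complex^'l \<Rightarrow> complex^'l2) \<Rightarrow>
    complex^('k::finite + 'l::finite) \<Rightarrow> complex^('k2::finite + 'l2::finite)" where
  "vmap f g z = vjoin (f (vleft z)) (g (vright z))"

text \<open>The covers in \<open>compatible_charts\<close> carry arbitrary topologies on a
  coordinate space. Their product has to be realized on the coordinate space of the product chart,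
  so the product topology is transported along \<open>vjoin\<close>.\<close>

definition vtop :: "(complex^'k) topology \<Rightarrow> (complex^'l) topology \<Rightarrow> (complex^('k::finite + 'l::finite)) topology" where
  "vtop T T' = pullback_topology UNIV (\<lambda>z. (vleft z, vright z)) (prod_topology T T')"

definition vgroup :: "(complex^'k) set \<Rightarrow> (complex^'l) set \<Rightarrow> (complex^'k \<Rightarrow> complex^'k) set \<Rightarrow>
    (complex^'l \<Rightarrow> complex^'l) set \<Rightarrow> (complex^('k::finite + 'l::finite) \<Rightarrow> complex^('k + 'l)) set" where
  "vgroup A B \<Gamma> \<Gamma>' = {restrict (vmap \<gamma> \<delta>) (vprod A B) |\<gamma> \<delta>. \<gamma> \<in> \<Gamma> \<and> \<delta> \<in> \<Gamma>'}"

section \<open>Topology and holomorphy in joined coordinates\<close>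

lemma vleft_vjoin [simp]: "vleft (vjoin x y) = x" and vright_vjoin [simp]: "vright (vjoin x y) = y"
  by (simp_all add: vleft_def vright_def vjoin_def vec_eq_iff)

lemma vjoin_collapse [simp]: "vjoin (vleft z) (vright z) = z"
proof -
  have "vjoin (vleft z) (vright z) $ i = z $ i" for i
    by (cases i) (simp_all add: vleft_def vright_def vjoin_def)
  then show ?thesis by (simp add: vec_eq_iff)
qed

lemma vleft_vmap [simp]: "vleft (vmap f g z) = f (vleft z)"
  and vright_vmap [simp]: "vright (vmap f g z) = g (vright z)"
  by (simp_all add: vmap_def)

lemma vec_sum_eqI: "vleft z = vleft z' \<Longrightarrow> vright z = vright z' \<Longrightarrow> z = z'"
  by (metis vjoin_collapse)

lemma vjoin_in_vprod [simp]: "vjoin x y \<in> vprod A B \<longleftrightarrow> x \<in> A \<and> y \<in> B"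
  by (simp add: vprod_def)

lemma vprod_eq_image: "vprod A B = (\<lambda>p. vjoin (fst p) (snd p)) ` (A \<times> B)"
proof (intro equalityI subsetI)
  fix z assume "z \<in> vprod A B"
  then have "(vleft z, vright z) \<in> A \<times> B" by (simp add: vprod_def)
  from imageI[OF this, of "\<lambda>p. vjoin (fst p) (snd p)"]
  show "z \<in> (\<lambda>p. vjoin (fst p) (snd p)) ` (A \<times> B)" by simp
qed auto

lemma continuous_on_vleft: "continuous_on S vleft" and continuous_on_vright: "continuous_on S vright"
  unfolding vleft_def vright_def by (intro continuous_intros)+

lemma continuous_on_vjoin:
  fixes S :: "((complex^'k::finite) \<times> (complex^'l::finite)) set"
  shows "continuous_on S (\<lambda>p. vjoin (fst p) (snd p))"
  unfolding vjoin_def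
proof (rule continuous_on_vec_lambda)
  fix i :: "'k + 'l"
  show "continuous_on S (\<lambda>p. case i of Inl a \<Rightarrow> fst p $ a | Inr b \<Rightarrow> snd p $ b)"
    by (cases i) (auto intro!: continuous_intros)
qed

lemma topspace_vtop [simp]: "topspace (vtop T T') = vprod (topspace T) (topspace T')"
  by (auto simp: vtop_def topspace_pullback_topology vprod_def)

lemma openin_vtop_iff:
  "openin (vtop T T') S \<longleftrightarrow>
     (\<forall>z\<in>S. \<exists>U V. openin T U \<and> openin T' V \<and> vleft z \<in> U \<and> vright z \<in> V \<and> vprod U V \<subseteq> S)" (is "_ \<longleftrightarrow> ?R")
proof
  assume "openin (vtop T T') S"
  then obtain W where W: "openin (prod_topology T T') W" "S = (\<lambda>z. (vleft z, vright z)) -` W"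
    by (auto simp: vtop_def openin_pullback_topology)
  show ?R
  proof
    fix z assume "z \<in> S"
    then have "(vleft z, vright z) \<in> W" using W(2) by simp
    from W(1)[unfolded openin_prod_topology_alt, rule_format, OF this]
    obtain U V where "openin T U" "openin T' V" "vleft z \<in> U" "vright z \<in> V" "U \<times> V \<subseteq> W"
      by (elim exE conjE) (rule that)
    moreover have "vprod U V \<subseteq> S" using \<open>U \<times> V \<subseteq> W\<close> unfolding W(2) vprod_def by auto
    ultimately show "\<exists>U V. openin T U \<and> openin T' V \<and> vleft z \<in> U \<and> vright z \<in> V \<and> vprod U V \<subseteq> S"
      by blast
  qed
next
  assume R: ?R
  define W where "W = {p. vjoin (fst p) (snd p) \<in> S}"
  have "openin (prod_topology T T') W"
    unfolding openin_prod_topology_alt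
  proof (intro allI impI)
    fix x y assume "(x, y) \<in> W"
    then have "vjoin x y \<in> S" by (simp add: W_def)
    from bspec[OF R this] obtain U V where UV: "openin T U" "openin T' V" "x \<in> U" "y \<in> V" "vprod U V \<subseteq> S"
      by auto
    have "U \<times> V \<subseteq> W" using UV(5) by (auto simp: W_def subset_iff)
    then show "\<exists>U V. openin T U \<and> openin T' V \<and> x \<in> U \<and> y \<in> V \<and> U \<times> V \<subseteq> W"
      using UV by blast
  qed
  moreover have "S = (\<lambda>z. (vleft z, vright z)) -` W" by (auto simp: W_def)
  ultimately show "openin (vtop T T') S" by (auto simp: vtop_def openin_pullback_topology)
qed

lemma openin_vprod: "openin T U \<Longrightarrow> openin T' V \<Longrightarrow> openin (vtop T T') (vprod U V)"
  unfolding openin_vtop_iff by (auto simp: vprod_def)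

lemma continuous_map_vleft: "continuous_map (vtop T T') T vleft"
  and continuous_map_vright: "continuous_map (vtop T T') T' vright"
  using continuous_map_pullback[OF continuous_map_fst, of UNIV "\<lambda>z. (vleft z, vright z)" T T']
    continuous_map_pullback[OF continuous_map_snd, of UNIV "\<lambda>z. (vleft z, vright z)" T T']
  by (simp_all add: vtop_def o_def)

lemma continuous_map_vtop_iff:
  "continuous_map Z (vtop T T') g \<longleftrightarrow> continuous_map Z T (\<lambda>x. vleft (g x)) \<and> continuous_map Z T' (\<lambda>x. vright (g x))"
proof
  assume "continuous_map Z (vtop T T') g"
  then show "continuous_map Z T (\<lambda>x. vleft (g x)) \<and> continuous_map Z T' (\<lambda>x. vright (g x))"
    using continuous_map_compose[OF _ continuous_map_vleft] continuous_map_compose[OF _ continuous_map_vright]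
    by (auto simp: o_def)
next
  assume "continuous_map Z T (\<lambda>x. vleft (g x)) \<and> continuous_map Z T' (\<lambda>x. vright (g x))"
  then have "continuous_map Z (prod_topology T T') ((\<lambda>z. (vleft z, vright z)) \<circ> g)"
    by (simp add: continuous_map_pairwise o_def)
  then show "continuous_map Z (vtop T T') g" unfolding vtop_def by (rule continuous_map_pullback') simp
qed

text \<open>Lets topologies be compared through continuity of the identity, which for
  \<open>vtop\<close> is decided componentwise.\<close>

lemma topology_eq_if_ident_continuous:
  assumes "continuous_map T T' (\<lambda>x. x)" "continuous_map T' T (\<lambda>x. x)" shows "T = T'"
proof -
  have sub: "openin Y U" if "continuous_map Y Z (\<lambda>x. x)" "openin Z U" "U \<subseteq> topspace Y" for Y Z :: "'a topology" and U
  proof -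
    have "{x \<in> topspace Y. x \<in> U} = U" using that(3) by auto
    then show ?thesis using openin_continuous_map_preimage[OF that(1,2)] by simp
  qed
  have "topspace T \<subseteq> topspace T'" "topspace T' \<subseteq> topspace T"
    using assms[THEN continuous_map_image_subset_topspace] by auto
  then have "openin T U \<longleftrightarrow> openin T' U" for U
    using sub[OF assms(1), of U] sub[OF assms(2), of U] openin_subset[of T U] openin_subset[of T' U] by blast
  then show ?thesis by (simp add: topology_eq)
qed

text \<open>For standard topologies on the factors \<open>vtop\<close> gives back the standard
  topology, so products of charts are again charts on open sets.\<close>

lemma vtop_top_of_set: "vtop (top_of_set A) (top_of_set B) = top_of_set (vprod A B)"
proof (rule topology_eq_if_ident_continuous)
  have "continuous_map (prod_topology (top_of_set A) (top_of_set B)) euclidean (\<lambda>p. vjoin (fst p) (snd p))"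
    using continuous_on_vjoin[of "A \<times> B"] by (simp flip: subtopology_Times)
  from continuous_map_pullback[OF this, of UNIV "\<lambda>z. (vleft z, vright z)"]
  have "continuous_map (vtop (top_of_set A) (top_of_set B)) euclidean (\<lambda>x. x)"
    by (simp add: vtop_def o_def)
  then show "continuous_map (vtop (top_of_set A) (top_of_set B)) (top_of_set (vprod A B)) (\<lambda>x. x)"
    by (simp add: continuous_map_in_subtopology)
  show "continuous_map (top_of_set (vprod A B)) (vtop (top_of_set A) (top_of_set B)) (\<lambda>x. x)"
    unfolding continuous_map_vtop_iff
    by (auto simp: vprod_def continuous_on_vleft continuous_on_vright)
qed

lemma subtopology_vtop: "subtopology (vtop T T') (vprod U V) = vtop (subtopology T U) (subtopology T' V)"
proof (rule topology_eq_if_ident_continuous)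
  show "continuous_map (subtopology (vtop T T') (vprod U V)) (vtop (subtopology T U) (subtopology T' V)) (\<lambda>x. x)"
    unfolding continuous_map_vtop_iff
    using continuous_map_from_subtopology[OF continuous_map_vleft[of T T']]
      continuous_map_from_subtopology[OF continuous_map_vright[of T T']]
    by (auto simp: continuous_map_in_subtopology vprod_def)
  have "continuous_map (vtop (subtopology T U) (subtopology T' V)) T vleft"
    using continuous_map_vleft[of "subtopology T U" "subtopology T' V"] by (simp add: continuous_map_in_subtopology)
  moreover have "continuous_map (vtop (subtopology T U) (subtopology T' V)) T' vright"
    using continuous_map_vright[of "subtopology T U" "subtopology T' V"] by (simp add: continuous_map_in_subtopology)
  ultimately show "continuous_map (vtop (subtopology T U) (subtopology T' V)) (subtopology (vtop T T') (vprod U V)) (\<lambda>x. x)"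
    by (auto simp: continuous_map_in_subtopology continuous_map_vtop_iff vprod_def)
qed

lemma continuous_map_vmap:
  assumes "continuous_map T1 S1 f" "continuous_map T2 S2 g"
  shows "continuous_map (vtop T1 T2) (vtop S1 S2) (vmap f g)"
  unfolding continuous_map_vtop_iff
  using continuous_map_compose[OF continuous_map_vleft[of T1 T2] assms(1)]
    continuous_map_compose[OF continuous_map_vright[of T1 T2] assms(2)]
  by (simp add: o_def)

lemma homeomorphic_map_vmap:
  assumes "homeomorphic_map T1 S1 f" "homeomorphic_map T2 S2 g"
  shows "homeomorphic_map (vtop T1 T2) (vtop S1 S2) (vmap f g)"
proof -
  obtain f' where f': "homeomorphic_maps T1 S1 f f'" using assms(1) homeomorphic_map_maps by blast
  obtain g' where g': "homeomorphic_maps T2 S2 g g'" using assms(2) homeomorphic_map_maps by blast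
  have "homeomorphic_maps (vtop T1 T2) (vtop S1 S2) (vmap f g) (vmap f' g')"
    using f' g' by (auto simp: homeomorphic_maps_def continuous_map_vmap vprod_def intro!: vec_sum_eqI)
  then show ?thesis using homeomorphic_map_maps by blast
qed

lemma cdiff_at_vleft: "cdiff_at vleft z" and cdiff_at_vright: "cdiff_at vright z"
  by (simp_all add: cdiff_at_iff_components vleft_def vright_def)

lemma cdiff_at_vmap:
  assumes "cdiff_at f (vleft z)" "cdiff_at g (vright z)" shows "cdiff_at (vmap f g) z"
  unfolding cdiff_at_iff_components
proof
  have 1: "cdiff_at (\<lambda>y. f (vleft y)) z" using cdiff_at_compose[OF cdiff_at_vleft assms(1)] .
  have 2: "cdiff_at (\<lambda>y. g (vright y)) z" using cdiff_at_compose[OF cdiff_at_vright assms(2)] .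
  fix i show "cdiff_at1 (\<lambda>y. vmap f g y $ i) z"
    using 1 2 unfolding cdiff_at_iff_components by (cases i) (auto simp: vmap_def vjoin_def)
qed

text \<open>Homotopies of the component loops are joined. The intermediate paths are closed because
  both of their components are.\<close>

lemma simply_connected_space_vtop:
  assumes "simply_connected_space T" "simply_connected_space T'"
  shows "simply_connected_space (vtop T T')"
  unfolding simply_connected_space_def
proof (intro allI impI)
  fix p q assume pq: "pathin (vtop T T') p \<and> p 1 = p 0 \<and> pathin (vtop T T') q \<and> q 1 = q 0"
  have "homotopic_with (\<lambda>r. r 1 = r 0) (top_of_set {0..1}) T (\<lambda>t. vleft (p t)) (\<lambda>t. vleft (q t))"
    using assms(1) pq by (simp add: simply_connected_space_def pathin_def continuous_map_vtop_iff)
  then obtain h where h: "continuous_map (prod_topology (top_of_set {0..1::real}) (top_of_set {0..1::real})) T h"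
    "\<forall>x. h (0, x) = vleft (p x)" "\<forall>x. h (1, x) = vleft (q x)" "\<forall>t\<in>{0..1}. h (t, 1) = h (t, 0)"
    unfolding homotopic_with_def by (elim exE conjE) (rule that, assumption+)
  have "homotopic_with (\<lambda>r. r 1 = r 0) (top_of_set {0..1}) T' (\<lambda>t. vright (p t)) (\<lambda>t. vright (q t))"
    using assms(2) pq by (simp add: simply_connected_space_def pathin_def continuous_map_vtop_iff)
  then obtain k where k: "continuous_map (prod_topology (top_of_set {0..1::real}) (top_of_set {0..1::real})) T' k"
    "\<forall>x. k (0, x) = vright (p x)" "\<forall>x. k (1, x) = vright (q x)" "\<forall>t\<in>{0..1}. k (t, 1) = k (t, 0)"
    unfolding homotopic_with_def by (elim exE conjE) (rule that, assumption+)
  show "homotopic_with (\<lambda>r. r 1 = r 0) (top_of_set {0..1}) (vtop T T') p q"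
    unfolding homotopic_with_def
    using h k by (intro exI[of _ "\<lambda>x. vjoin (h x) (k x)"]) (simp add: continuous_map_vtop_iff)
qed

text \<open>Products of evenly covered sets are evenly covered, with the products of sheets as
  sheets. Distinct product sheets differ in one factor, where they are disjoint.\<close>

lemma covering_map_vmap:
  assumes c1: "covering_map T1 S1 w1" and c2: "covering_map T2 S2 w2"
  shows "covering_map (vtop T1 T2) (vtop S1 S2) (vmap w1 w2)"
  unfolding covering_map_def
proof (intro conjI ballI)
  have im: "w1 ` topspace T1 = topspace S1" "w2 ` topspace T2 = topspace S2"
    and cont: "continuous_map T1 S1 w1" "continuous_map T2 S2 w2"
    using c1 c2 by (auto simp: covering_map_def)
  show "continuous_map (vtop T1 T2) (vtop S1 S2) (vmap w1 w2)" by (rule continuous_map_vmap[OF cont])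
  show "vmap w1 w2 ` topspace (vtop T1 T2) = topspace (vtop S1 S2)"
  proof (intro equalityI subsetI)
    fix y assume "y \<in> vmap w1 w2 ` topspace (vtop T1 T2)"
    then show "y \<in> topspace (vtop S1 S2)" using im by (auto simp: vprod_def)
  next
    fix y assume "y \<in> topspace (vtop S1 S2)"
    then have "vleft y \<in> w1 ` topspace T1" "vright y \<in> w2 ` topspace T2" using im by (auto simp: vprod_def)
    then obtain a b where ab: "a \<in> topspace T1" "b \<in> topspace T2" "vleft y = w1 a" "vright y = w2 b" by blast
    then have "y = vmap w1 w2 (vjoin a b)" by (intro vec_sum_eqI) auto
    then show "y \<in> vmap w1 w2 ` topspace (vtop T1 T2)" using ab by simp
  qed
  fix x assume x: "x \<in> topspace (vtop S1 S2)"
  have ev1: "\<forall>x\<in>topspace S1. \<exists>U. x \<in> U \<and> openin S1 U \<and>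
        (\<exists>\<V>. \<Union>\<V> = {u \<in> topspace T1. w1 u \<in> U} \<and> (\<forall>V\<in>\<V>. openin T1 V) \<and> disjoint \<V> \<and>
             (\<forall>V\<in>\<V>. homeomorphic_map (subtopology T1 V) (subtopology S1 U) w1))"
    using c1 unfolding covering_map_def by (elim conjE)
  have ev2: "\<forall>x\<in>topspace S2. \<exists>U. x \<in> U \<and> openin S2 U \<and>
        (\<exists>\<V>. \<Union>\<V> = {u \<in> topspace T2. w2 u \<in> U} \<and> (\<forall>V\<in>\<V>. openin T2 V) \<and> disjoint \<V> \<and>
             (\<forall>V\<in>\<V>. homeomorphic_map (subtopology T2 V) (subtopology S2 U) w2))"
    using c2 unfolding covering_map_def by (elim conjE)
  have xx: "vleft x \<in> topspace S1" "vright x \<in> topspace S2" using x by (auto simp: vprod_def)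
  from bspec[OF ev1 xx(1)] obtain U1 \<V>1 where U1: "vleft x \<in> U1" "openin S1 U1"
    "\<Union>\<V>1 = {u \<in> topspace T1. w1 u \<in> U1}" "\<forall>V\<in>\<V>1. openin T1 V" "disjoint \<V>1"
    "\<forall>V\<in>\<V>1. homeomorphic_map (subtopology T1 V) (subtopology S1 U1) w1"
    by (elim exE conjE) (rule that)
  from bspec[OF ev2 xx(2)] obtain U2 \<V>2 where U2: "vright x \<in> U2" "openin S2 U2"
    "\<Union>\<V>2 = {u \<in> topspace T2. w2 u \<in> U2}" "\<forall>V\<in>\<V>2. openin T2 V" "disjoint \<V>2"
    "\<forall>V\<in>\<V>2. homeomorphic_map (subtopology T2 V) (subtopology S2 U2) w2"
    by (elim exE conjE) (rule that)
  define \<V> where "\<V> = (\<lambda>(V, V'). vprod V V') ` (\<V>1 \<times> \<V>2)"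
  have "\<Union>\<V> = vprod (\<Union>\<V>1) (\<Union>\<V>2)" by (auto simp: \<V>_def vprod_def)
  also have "\<dots> = {u \<in> topspace (vtop T1 T2). vmap w1 w2 u \<in> vprod U1 U2}"
    unfolding U1(3) U2(3) by (auto simp: vprod_def)
  finally have un: "\<Union>\<V> = {u \<in> topspace (vtop T1 T2). vmap w1 w2 u \<in> vprod U1 U2}" .
  have op: "\<forall>V\<in>\<V>. openin (vtop T1 T2) V" using U1(4) U2(4) by (auto simp: \<V>_def openin_vprod)
  have "A \<inter> B = {}" if "A \<in> \<V>" "B \<in> \<V>" "A \<noteq> B" for A B
  proof -
    obtain A1 A2 B1 B2 where AB: "A1 \<in> \<V>1" "A2 \<in> \<V>2" "B1 \<in> \<V>1" "B2 \<in> \<V>2" "A = vprod A1 A2" "B = vprod B1 B2"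
      using \<open>A \<in> \<V>\<close> \<open>B \<in> \<V>\<close> by (auto simp: \<V>_def)
    then have "A1 \<noteq> B1 \<or> A2 \<noteq> B2" using \<open>A \<noteq> B\<close> by auto
    moreover have "A1 \<inter> B1 = {}" if "A1 \<noteq> B1" using U1(5) AB(1,3) that by (simp add: disjoint_def)
    moreover have "A2 \<inter> B2 = {}" if "A2 \<noteq> B2" using U2(5) AB(2,4) that by (simp add: disjoint_def)
    ultimately have "A1 \<inter> B1 = {} \<or> A2 \<inter> B2 = {}" by blast
    then show ?thesis using AB by (auto simp: vprod_def)
  qed
  then have dis: "disjoint \<V>" by (simp add: disjoint_def)
  have hom: "\<forall>V\<in>\<V>. homeomorphic_map (subtopology (vtop T1 T2) V) (subtopology (vtop S1 S2) (vprod U1 U2)) (vmap w1 w2)"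
    using U1(6) U2(6) by (auto simp: \<V>_def subtopology_vtop intro!: homeomorphic_map_vmap)
  show "\<exists>U. x \<in> U \<and> openin (vtop S1 S2) U \<and>
        (\<exists>\<V>. \<Union>\<V> = {u \<in> topspace (vtop T1 T2). vmap w1 w2 u \<in> U} \<and> (\<forall>V\<in>\<V>. openin (vtop T1 T2) V) \<and> disjoint \<V> \<and>
             (\<forall>V\<in>\<V>. homeomorphic_map (subtopology (vtop T1 T2) V) (subtopology (vtop S1 S2) U) (vmap w1 w2)))"
    by (intro exI[of _ "vprod U1 U2"] exI[of _ \<V>] conjI un op dis hom openin_vprod U1(2) U2(2))
      (simp add: vprod_def U1(1) U2(1))
qed

lemma vtop_euclidean: "vtop euclidean euclidean = euclidean"
  using vtop_top_of_set[of UNIV UNIV] by (simp add: vprod_def)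

lemma open_vprod: "open A \<Longrightarrow> open B \<Longrightarrow> open (vprod A B)"
  using openin_vprod[of euclidean A euclidean B] by (simp add: vtop_euclidean)

lemma local_section_vmap:
  assumes "local_section T1 w1 (vleft x) N1 s1" "local_section T2 w2 (vright x) N2 s2"
  shows "local_section (vtop T1 T2) (vmap w1 w2) x (vprod N1 N2) (vmap s1 s2)"
proof -
  have "open (vprod N1 N2)" "continuous_map (top_of_set (vprod N1 N2)) (vtop T1 T2) (vmap s1 s2)"
    using assms continuous_map_vmap[of "top_of_set N1" T1 s1 "top_of_set N2" T2 s2]
    by (auto simp: local_section_def open_vprod vtop_top_of_set)
  moreover have "vmap w1 w2 x \<in> vprod N1 N2" "vmap s1 s2 (vmap w1 w2 x) = x"
    "\<forall>y\<in>vprod N1 N2. vmap w1 w2 (vmap s1 s2 y) = y"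
    using assms by (auto simp: local_section_def vprod_def intro!: vec_sum_eqI)
  ultimately show ?thesis by (simp add: local_section_def)
qed

lemma cover_holomorphic_vmap:
  assumes op: "open S1" "open S2" "open S1'" "open S2'"
    and cov: "covering_map T1 (top_of_set S1) w1" "covering_map T2 (top_of_set S2) w2"
      "covering_map T1' (top_of_set S1') w1'" "covering_map T2' (top_of_set S2') w2'"
    and hol: "holomorphic_mfd_map (cover_mfd T1 S1 w1) (cover_mfd T1' S1' w1') F1"
      "holomorphic_mfd_map (cover_mfd T2 S2 w2) (cover_mfd T2' S2' w2') F2"
  shows "holomorphic_mfd_map (cover_mfd (vtop T1 T2) (vprod S1 S2) (vmap w1 w2))
     (cover_mfd (vtop T1' T2') (vprod S1' S2') (vmap w1' w2')) (vmap F1 F2)"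
proof (rule cover_holomorphicI)
  show "continuous_map (vtop T1 T2) (vtop T1' T2') (vmap F1 F2)"
    using hol by (intro continuous_map_vmap) (auto simp: holomorphic_mfd_map_def)
  fix x assume "x \<in> topspace (vtop T1 T2)"
  then have x: "vleft x \<in> topspace T1" "vright x \<in> topspace T2" by (auto simp: vprod_def)
  from cover_holomorphicD[OF op(1,3) cov(1,3) hol(1) x(1)]
  obtain N1 s1 where 1: "local_section T1 w1 (vleft x) N1 s1" "cdiff_at (\<lambda>y. w1' (F1 (s1 y))) (w1 (vleft x))" by blast
  from cover_holomorphicD[OF op(2,4) cov(2,4) hol(2) x(2)]
  obtain N2 s2 where 2: "local_section T2 w2 (vright x) N2 s2" "cdiff_at (\<lambda>y. w2' (F2 (s2 y))) (w2 (vright x))" by blast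
  have "cdiff_at (vmap (\<lambda>y. w1' (F1 (s1 y))) (\<lambda>y. w2' (F2 (s2 y)))) (vmap w1 w2 x)"
    using 1(2) 2(2) by (intro cdiff_at_vmap) simp_all
  then have "cdiff_at (\<lambda>y. vmap w1' w2' (vmap F1 F2 (vmap s1 s2 y))) (vmap w1 w2 x)"
    by (simp add: vmap_def[abs_def])
  then show "\<exists>N s. local_section (vtop T1 T2) (vmap w1 w2) x N s \<and>
      cdiff_at (\<lambda>y. vmap w1' w2' (vmap F1 F2 (s y))) (vmap w1 w2 x)"
    using local_section_vmap[OF 1(1) 2(1)] by (intro exI conjI)
qed (use op open_vprod in auto)

text \<open>Points with both components free are free. They form a connected dense set, and a set
  between a connected set and its closure is connected; so the inclusion \<open>F\<close> settles
  both conditions on the free points.\<close>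

lemma pre_model_vprod:
  assumes A: "pre_model (open_mfd A) \<Gamma>" and B: "pre_model (open_mfd B) \<Gamma>'"
  shows "pre_model (open_mfd (vprod A B)) (vgroup A B \<Gamma> \<Gamma>')"
  unfolding pre_model_open_mfd_iff
proof (intro conjI ballI)
  note A' = A[unfolded pre_model_open_mfd_iff] and B' = B[unfolded pre_model_open_mfd_iff]
  have oA: "open A" and oB: "open B" and gA: "subgroup \<Gamma> (BijGroup A)" and gB: "subgroup \<Gamma>' (BijGroup B)"
    using A' B' by auto
  show op: "open (vprod A B)" using oA oB by (rule open_vprod)
  have conn: "connected (vprod C D)" if "connected C" "connected D" for C :: "(complex^'a) set" and D :: "(complex^'b) set"
    unfolding vprod_eq_image using that by (intro connected_continuous_image continuous_on_vjoin connected_Times)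
  show "connected (vprod A B)" using A' B' by (intro conn) auto
  have vm: "vmap \<gamma> \<delta> z \<in> vprod A B" if "\<gamma> \<in> \<Gamma>" "\<delta> \<in> \<Gamma>'" "z \<in> vprod A B" for \<gamma> \<delta> z
    using that transformation_group_apply[OF gA] transformation_group_apply[OF gB] by (simp add: vprod_def)
  have memI: "f \<in> vgroup A B \<Gamma> \<Gamma>'" if "\<gamma> \<in> \<Gamma>" "\<delta> \<in> \<Gamma>'" "f = restrict (vmap \<gamma> \<delta>) (vprod A B)" for f \<gamma> \<delta>
    using that by (auto simp: vgroup_def)
  have inv: "\<exists>h\<in>vgroup A B \<Gamma> \<Gamma>'. \<forall>z\<in>vprod A B. h (g z) = z" if "g \<in> vgroup A B \<Gamma> \<Gamma>'" for g
  proof -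
    obtain \<gamma> \<delta> where g: "\<gamma> \<in> \<Gamma>" "\<delta> \<in> \<Gamma>'" "g = restrict (vmap \<gamma> \<delta>) (vprod A B)" using \<open>g \<in> _\<close> by (auto simp: vgroup_def)
    obtain \<gamma>' where \<gamma>': "\<gamma>' \<in> \<Gamma>" "\<forall>x\<in>A. \<gamma>' (\<gamma> x) = x" 
      using transformation_group_inverse[OF gA g(1)] .
    obtain \<delta>' where \<delta>': "\<delta>' \<in> \<Gamma>'" "\<forall>x\<in>B. \<delta>' (\<delta> x) = x" 
      using transformation_group_inverse[OF gB g(2)] .
    have "restrict (vmap \<gamma>' \<delta>') (vprod A B) (g z) = z" if z: "z \<in> vprod A B" for z
      using vm[OF g(1,2) z] z \<gamma>'(2) \<delta>'(2) g(3) by (intro vec_sum_eqI) (auto simp: vprod_def)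
    then show ?thesis using memI[OF \<gamma>'(1) \<delta>'(1) refl] by (intro bexI ballI)
  qed
  have maps: "g z \<in> vprod A B" if "g \<in> vgroup A B \<Gamma> \<Gamma>'" "z \<in> vprod A B" for g z
    using that vm by (auto simp: vgroup_def)
  have ext: "g \<in> extensional (vprod A B)" if "g \<in> vgroup A B \<Gamma> \<Gamma>'" for g
    using that by (auto simp: vgroup_def)
  show grp: "subgroup (vgroup A B \<Gamma> \<Gamma>') (BijGroup (vprod A B))"
    unfolding subgroup_BijGroup_iff
  proof (intro conjI ballI subsetI)
    fix g assume g: "g \<in> vgroup A B \<Gamma> \<Gamma>'"
    obtain h where h: "h \<in> vgroup A B \<Gamma> \<Gamma>'" "\<And>z. z \<in> vprod A B \<Longrightarrow> h (g z) = z" using inv[OF g] by blast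
    obtain k where k: "k \<in> vgroup A B \<Gamma> \<Gamma>'" "\<And>z. z \<in> vprod A B \<Longrightarrow> k (h z) = z" using inv[OF h(1)] by blast
    \<comment> \<open>The left inverse \<open>h\<close> of \<open>g\<close> has a left inverse
      \<open>k\<close> of its own, which makes \<open>h\<close> a two-sided inverse.\<close>
    have gh: "g (h z) = z" if z: "z \<in> vprod A B" for z
    proof -
      have "h z \<in> vprod A B" using maps[OF h(1) z] .
      then have "h (g (h z)) = h z" "g (h z) \<in> vprod A B" using h(2) maps[OF g] by auto
      then have "k (h (g (h z))) = k (h z)" by simp
      then show ?thesis using k(2) z \<open>g (h z) \<in> vprod A B\<close> by simp
    qed
    have "bij_betw g (vprod A B) (vprod A B)"
      by (rule bij_betw_byWitness[where f' = h]) (use h(2) gh maps[OF g] maps[OF h(1)] in auto)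
    then show "g \<in> Bij (vprod A B)" using ext[OF g] by (simp add: Bij_def)
    have "compose (vprod A B) h g = (\<lambda>x\<in>vprod A B. x)"
      using h(2) by (auto simp: compose_def)
    then show "\<exists>h\<in>vgroup A B \<Gamma> \<Gamma>'. compose (vprod A B) h g = (\<lambda>x\<in>vprod A B. x)" using h(1) by blast
  next
    show "(\<lambda>x\<in>vprod A B. x) \<in> vgroup A B \<Gamma> \<Gamma>'"
      using gA gB by (intro memI[of "\<lambda>x\<in>A. x" "\<lambda>x\<in>B. x"])
        (auto simp: subgroup_BijGroup_iff vprod_def restrict_def vmap_def)
  next
    fix g h assume "g \<in> vgroup A B \<Gamma> \<Gamma>'" "h \<in> vgroup A B \<Gamma> \<Gamma>'"
    then obtain \<gamma> \<delta> \<gamma>' \<delta>' where gh: "\<gamma> \<in> \<Gamma>" "\<delta> \<in> \<Gamma>'" "g = restrict (vmap \<gamma> \<delta>) (vprod A B)"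
      "\<gamma>' \<in> \<Gamma>" "\<delta>' \<in> \<Gamma>'" "h = restrict (vmap \<gamma>' \<delta>') (vprod A B)" by (auto simp: vgroup_def)
    have m: "compose A \<gamma> \<gamma>' \<in> \<Gamma>" "compose B \<delta> \<delta>' \<in> \<Gamma>'"
      using gh gA gB by (auto simp: subgroup_BijGroup_iff)
    have "compose (vprod A B) g h = restrict (vmap (compose A \<gamma> \<gamma>') (compose B \<delta> \<delta>')) (vprod A B)"
    proof
      fix z show "compose (vprod A B) g h z = restrict (vmap (compose A \<gamma> \<gamma>') (compose B \<delta> \<delta>')) (vprod A B) z"
      proof (cases "z \<in> vprod A B")
        case True
        then show ?thesis using vm[OF gh(4,5) True] gh(3,6)
          by (auto simp: compose_eq vprod_def intro!: vec_sum_eqI)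
      qed (simp add: compose_def)
    qed
    then show "compose (vprod A B) g h \<in> vgroup A B \<Gamma> \<Gamma>'" by (rule memI[OF m])
  qed
  have F: "vprod (free_points A \<Gamma>) (free_points B \<Gamma>') \<subseteq> free_points (vprod A B) (vgroup A B \<Gamma> \<Gamma>')"
  proof
    fix z assume "z \<in> vprod (free_points A \<Gamma>) (free_points B \<Gamma>')"
    then have z: "vleft z \<in> A" "vright z \<in> B" "\<And>\<gamma>. \<gamma> \<in> \<Gamma> \<Longrightarrow> \<gamma> (vleft z) = vleft z \<Longrightarrow> \<gamma> = (\<lambda>y\<in>A. y)"
      "\<And>\<gamma>. \<gamma> \<in> \<Gamma>' \<Longrightarrow> \<gamma> (vright z) = vright z \<Longrightarrow> \<gamma> = (\<lambda>y\<in>B. y)"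
      by (auto simp: vprod_def free_points_def)
    have zAB: "z \<in> vprod A B" using z by (simp add: vprod_def)
    have "g = (\<lambda>y\<in>vprod A B. y)" if g: "g \<in> vgroup A B \<Gamma> \<Gamma>'" "g z = z" for g
    proof -
      obtain \<gamma> \<delta> where gd: "\<gamma> \<in> \<Gamma>" "\<delta> \<in> \<Gamma>'" "g = restrict (vmap \<gamma> \<delta>) (vprod A B)" using g by (auto simp: vgroup_def)
      then have "vmap \<gamma> \<delta> z = z" using g zAB by simp
      then have "\<gamma> (vleft z) = vleft z" "\<delta> (vright z) = vright z"
        using vleft_vmap[of \<gamma> \<delta> z] vright_vmap[of \<gamma> \<delta> z] by simp_all
      then have "\<gamma> = (\<lambda>y\<in>A. y)" "\<delta> = (\<lambda>y\<in>B. y)" using z gd by auto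
      then show ?thesis using gd(3) by (auto simp: vprod_def restrict_def vmap_def)
    qed
    then show "z \<in> free_points (vprod A B) (vgroup A B \<Gamma> \<Gamma>')" using zAB by (simp add: free_points_def)
  qed
  have cl: "vprod A B \<subseteq> closure (vprod (free_points A \<Gamma>) (free_points B \<Gamma>'))"
  proof -
    have "vprod A B \<subseteq> (\<lambda>p. vjoin (fst p) (snd p)) ` closure (free_points A \<Gamma> \<times> free_points B \<Gamma>')"
      unfolding vprod_eq_image closure_Times using A' B' by (intro image_mono Sigma_mono) auto
    also have "\<dots> \<subseteq> closure (vprod (free_points A \<Gamma>) (free_points B \<Gamma>'))"
      unfolding vprod_eq_image[of "free_points A \<Gamma>"] by (rule continuous_image_closure_subset[OF continuous_on_vjoin[of UNIV]]) auto
    finally show ?thesis .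
  qed
  have fs: "free_points (vprod A B) (vgroup A B \<Gamma> \<Gamma>') \<subseteq> vprod A B" by (auto simp: free_points_def)
  show "connected (free_points (vprod A B) (vgroup A B \<Gamma> \<Gamma>'))"
    by (rule connected_intermediate_closure[OF _ F]) (use A' B' fs cl in \<open>auto intro!: conn\<close>)
  show "vprod A B \<subseteq> closure (free_points (vprod A B) (vgroup A B \<Gamma> \<Gamma>'))"
    using cl closure_mono[OF F] by blast
  fix g z assume g: "g \<in> vgroup A B \<Gamma> \<Gamma>'" and z: "z \<in> vprod A B"
  then obtain \<gamma> \<delta> where gd: "\<gamma> \<in> \<Gamma>" "\<delta> \<in> \<Gamma>'" "g = restrict (vmap \<gamma> \<delta>) (vprod A B)" by (auto simp: vgroup_def)
  have "cdiff_at (vmap \<gamma> \<delta>) z" using gd z A' B' by (intro cdiff_at_vmap) (auto simp: vprod_def)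
  then show "cdiff_at g z" by (rule cdiff_at_transform[OF _ op z]) (simp add: gd)
qed

lemma complex_model_vprod:
  assumes "complex_model (open_mfd A) \<Gamma>" "complex_model (open_mfd B) \<Gamma>'"
  shows "complex_model (open_mfd (vprod A B)) (vgroup A B \<Gamma> \<Gamma>')"
  using assms pre_model_vprod[of A \<Gamma> B \<Gamma>'] simply_connected_space_vtop[of "top_of_set A" "top_of_set B"]
  by (simp add: complex_model_def vtop_top_of_set)

section \<open>Product charts and their compatibility\<close>

lemma product_chart_simps [simp]:
  "qdom (product_chart c c') = qdom c \<times> qdom c'"
  "qcov (product_chart c c') = vprod (qcov c) (qcov c')"
  "qgrp (product_chart c c') = vgroup (qcov c) (qcov c') (qgrp c) (qgrp c')"
  by (simp_all add: product_chart_def Let_def vprod_def vgroup_def vmap_def[abs_def])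

text \<open>An orbit of the product group is the product of the orbits. Since neither group is
  empty, its two projections recover the factors.\<close>

lemma qparam_product_chart:
  assumes "subgroup (qgrp c) (BijGroup (qcov c))" "subgroup (qgrp c') (BijGroup (qcov c'))"
    "z \<in> vprod (qcov c) (qcov c')"
  shows "qparam (product_chart c c') z = (qparam c (vleft z), qparam c' (vright z))"
proof -
  have ne: "qgrp c \<noteq> {}" "qgrp c' \<noteq> {}" using assms(1,2) by (auto simp: subgroup_BijGroup_iff)
  let ?O = "tg_orbit (vgroup (qcov c) (qcov c') (qgrp c) (qgrp c')) z"
  have O: "?O = {vmap \<gamma> \<delta> z |\<gamma> \<delta>. \<gamma> \<in> qgrp c \<and> \<delta> \<in> qgrp c'}"
  proof (intro equalityI subsetI)
    fix y assume "y \<in> {vmap \<gamma> \<delta> z |\<gamma> \<delta>. \<gamma> \<in> qgrp c \<and> \<delta> \<in> qgrp c'}"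
    then obtain \<gamma> \<delta> where y: "y = vmap \<gamma> \<delta> z" "\<gamma> \<in> qgrp c" "\<delta> \<in> qgrp c'" by blast
    then have "restrict (vmap \<gamma> \<delta>) (vprod (qcov c) (qcov c')) \<in> vgroup (qcov c) (qcov c') (qgrp c) (qgrp c')"
      by (auto simp: vgroup_def)
    from imageI[OF this, of "\<lambda>f. f z"] show "y \<in> ?O" using assms(3) y(1) by (simp add: tg_orbit_def)
  next
    fix y assume "y \<in> ?O"
    then obtain \<gamma> \<delta> where y: "\<gamma> \<in> qgrp c" "\<delta> \<in> qgrp c'" "y = restrict (vmap \<gamma> \<delta>) (vprod (qcov c) (qcov c')) z"
      by (auto simp: tg_orbit_def vgroup_def)
    then have "y = vmap \<gamma> \<delta> z" using assms(3) by simp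
    with y(1,2) show "y \<in> {vmap \<gamma> \<delta> z |\<gamma> \<delta>. \<gamma> \<in> qgrp c \<and> \<delta> \<in> qgrp c'}" by blast
  qed
  have O': "?O = (\<lambda>(\<gamma>, \<delta>). vmap \<gamma> \<delta> z) ` (qgrp c \<times> qgrp c')" unfolding O by auto
  have "vleft ` ?O = (\<lambda>\<gamma>. \<gamma> (vleft z)) ` fst ` (qgrp c \<times> qgrp c')"
    unfolding O' image_image by (intro image_cong) auto
  then have "vleft ` ?O = qproj c (vleft z)" using ne by (simp add: tg_orbit_def)
  moreover have "vright ` ?O = (\<lambda>\<gamma>. \<gamma> (vright z)) ` snd ` (qgrp c \<times> qgrp c')"
    unfolding O' image_image by (intro image_cong) auto
  then have "vright ` ?O = qproj c' (vright z)" using ne by (simp add: tg_orbit_def)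
  ultimately show ?thesis by (simp add: qparam_def product_chart_def Let_def vprod_def vgroup_def vmap_def[abs_def])
qed

lemma quasifold_chart_product:
  assumes c: "quasifold_chart T c" and c': "quasifold_chart T' c'"
  shows "quasifold_chart (prod_topology T T') (product_chart c c')"
proof (rule quasifold_chartI)
  note qp = qparam_product_chart[OF qchart_group[OF c] qchart_group[OF c']]
  show "openin (prod_topology T T') (qdom (product_chart c c'))"
    using qchart_openin_dom[OF c] qchart_openin_dom[OF c'] by (simp add: openin_prod_Times_iff)
  show "complex_model (open_mfd (qcov (product_chart c c'))) (qgrp (product_chart c c'))"
    using complex_model_vprod[OF qchart_model[OF c] qchart_model[OF c']] by simp
  have "continuous_map (top_of_set (vprod (qcov c) (qcov c'))) T (\<lambda>z. qparam c (vleft z))"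
    using continuous_map_compose[OF continuous_map_vleft qparam_continuous[OF c], of "top_of_set (qcov c')"]
    by (simp add: vtop_top_of_set o_def)
  moreover have "continuous_map (top_of_set (vprod (qcov c) (qcov c'))) T' (\<lambda>z. qparam c' (vright z))"
    using continuous_map_compose[OF continuous_map_vright qparam_continuous[OF c'], of "top_of_set (qcov c)"]
    by (simp add: vtop_top_of_set o_def)
  ultimately have "continuous_map (top_of_set (vprod (qcov c) (qcov c'))) (prod_topology T T')
      (\<lambda>z. (qparam c (vleft z), qparam c' (vright z)))"
    by (simp add: continuous_map_pairwise o_def)
  then show "continuous_map (top_of_set (qcov (product_chart c c'))) (prod_topology T T') (qparam (product_chart c c'))"
    unfolding product_chart_simps by (rule continuous_map_eq) (simp add: qp)
  show "qparam (product_chart c c') ` qcov (product_chart c c') = qdom (product_chart c c')"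
  proof -
    have "qparam (product_chart c c') ` vprod (qcov c) (qcov c')
        = (\<lambda>z. (qparam c (vleft z), qparam c' (vright z))) ` vprod (qcov c) (qcov c')"
      by (rule image_cong) (simp_all add: qp)
    also have "\<dots> = (qparam c ` qcov c) \<times> (qparam c' ` qcov c')"
      unfolding vprod_eq_image image_image by force
    finally show ?thesis using qparam_surj[OF c] qparam_surj[OF c'] by simp
  qed
  fix z z' assume z: "z \<in> qcov (product_chart c c')" "z' \<in> qcov (product_chart c c')"
    and "qparam (product_chart c c') z = qparam (product_chart c c') z'"
  then have e: "qparam c (vleft z) = qparam c (vleft z')" "qparam c' (vright z) = qparam c' (vright z')"
    by (simp_all add: qp)
  have zz: "vleft z \<in> qcov c" "vleft z' \<in> qcov c" "vright z \<in> qcov c'" "vright z' \<in> qcov c'"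
    using z by (auto simp: vprod_def)
  have "\<exists>\<gamma>\<in>qgrp c. vleft z' = \<gamma> (vleft z)"
    using qparam_inj[OF c zz(1,2) e(1)] tg_orbit_eq_iff[OF qchart_group[OF c] zz(1,2)] by simp
  moreover have "\<exists>\<gamma>\<in>qgrp c'. vright z' = \<gamma> (vright z)"
    using qparam_inj[OF c' zz(3,4) e(2)] tg_orbit_eq_iff[OF qchart_group[OF c'] zz(3,4)] by simp
  ultimately obtain \<gamma> \<delta> where gd: "\<gamma> \<in> qgrp c" "\<delta> \<in> qgrp c'" "vleft z' = \<gamma> (vleft z)" "vright z' = \<delta> (vright z)"
    by blast
  then have "z' = restrict (vmap \<gamma> \<delta>) (vprod (qcov c) (qcov c')) z"
    using z by (intro vec_sum_eqI) simp_all
  moreover have rg: "restrict (vmap \<gamma> \<delta>) (vprod (qcov c) (qcov c')) \<in> vgroup (qcov c) (qcov c') (qgrp c) (qgrp c')"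
    using gd by (auto simp: vgroup_def)
  ultimately have ex: "\<exists>g\<in>vgroup (qcov c) (qcov c') (qgrp c) (qgrp c'). z' = g z" by (rule bexI)
  have "subgroup (vgroup (qcov c) (qcov c') (qgrp c) (qgrp c')) (BijGroup (vprod (qcov c) (qcov c')))"
    using pre_model_vprod[OF qchart_pre_model[OF c] qchart_pre_model[OF c']] by (simp add: pre_model_open_mfd_iff)
  from tg_orbit_eq_iff[OF this] show "qproj (product_chart c c') z = qproj (product_chart c c') z'"
    using z ex unfolding product_chart_simps by blast
next
  note qp = qparam_product_chart[OF qchart_group[OF c] qchart_group[OF c']]
  fix U assume U: "open U" "U \<subseteq> qcov (product_chart c c')"
  \<comment> \<open>\<open>U\<close> need not be a product, but it contains a box around each of its
    points, and boxes are mapped onto products of open sets.\<close>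
  have "openin (vtop euclidean euclidean) U"
    using U(1) by (simp add: vtop_euclidean)
  note bx = this[unfolded openin_vtop_iff]
  show "openin (prod_topology T T') (qparam (product_chart c c') ` U)"
    unfolding openin_prod_topology_alt
  proof (intro allI impI)
    fix x y assume "(x, y) \<in> qparam (product_chart c c') ` U"
    then obtain z where z: "z \<in> U" "(x, y) = qparam (product_chart c c') z" by auto
    then have xy: "x = qparam c (vleft z)" "y = qparam c' (vright z)" using U(2) qp by auto
    from bspec[OF bx z(1)] obtain V W where VW: "open V" "open W" "vleft z \<in> V" "vright z \<in> W" "vprod V W \<subseteq> U" by auto
    have sub: "vjoin a b \<in> U" if "a \<in> V" "b \<in> W" for a b using VW(5) that by (auto simp: vprod_def)
    have mem: "vjoin a b \<in> vprod (qcov c) (qcov c')" if "a \<in> V" "b \<in> W" for a b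
      using subsetD[OF U(2) sub[OF that]] by simp
    have "V \<subseteq> qcov c" using mem[OF _ VW(4)] by auto
    moreover have "W \<subseteq> qcov c'" using mem[OF VW(3)] by auto
    ultimately have "openin T (qparam c ` V)" "openin T' (qparam c' ` W)"
      using qparam_open[OF c VW(1)] qparam_open[OF c' VW(2)] by auto
    moreover have "qparam c ` V \<times> qparam c' ` W \<subseteq> qparam (product_chart c c') ` U"
    proof
      fix p assume "p \<in> qparam c ` V \<times> qparam c' ` W"
      then obtain a b where ab: "a \<in> V" "b \<in> W" "p = (qparam c a, qparam c' b)" by auto
      then have "p = qparam (product_chart c c') (vjoin a b)" using qp[OF mem[OF ab(1,2)]] by simp
      then show "p \<in> qparam (product_chart c c') ` U" using sub[OF ab(1,2)] by (rule image_eqI)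
    qed
    ultimately show "\<exists>U' V'. openin T U' \<and> openin T' V' \<and> x \<in> U' \<and> y \<in> V' \<and> U' \<times> V' \<subseteq> qparam (product_chart c c') ` U"
      using xy VW(3,4) by blast
  qed
qed

lemma overlap_model_product:
  assumes ch: "quasifold_chart T c1" "quasifold_chart T c2" "quasifold_chart T' d1" "quasifold_chart T' d2"
    and om: "overlap_model c1 c2" "overlap_model d1 d2"
  shows "qoverlap (product_chart c1 d1) (product_chart c2 d2) = vprod (qoverlap c1 c2) (qoverlap d1 d2)"
    and "overlap_model (product_chart c1 d1) (product_chart c2 d2)"
proof -
  show ov: "qoverlap (product_chart c1 d1) (product_chart c2 d2) = vprod (qoverlap c1 c2) (qoverlap d1 d2)"
    using qparam_product_chart[OF qchart_group[OF ch(1)] qchart_group[OF ch(3)]]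
    by (auto simp: qoverlap_def vprod_def)
  have sub: "vprod (qoverlap c1 c2) (qoverlap d1 d2) \<subseteq> vprod (qcov c1) (qcov d1)"
    by (auto simp: qoverlap_def vprod_def)
  let ?O = "qoverlap c1 c2" and ?O' = "qoverlap d1 d2"
  \<comment> \<open>The overlap of the products lies inside the product of the covering sets, so
    restricting to it commutes with forming products.\<close>
  have r: "restrict (restrict (vmap \<gamma> \<delta>) (vprod (qcov c1) (qcov d1))) (vprod ?O ?O')
     = restrict (vmap (restrict \<gamma> ?O) (restrict \<delta> ?O')) (vprod ?O ?O')" for \<gamma> \<delta>
    using sub by (auto simp: restrict_def fun_eq_iff vmap_def vprod_def)
  have "(\<lambda>\<gamma>. restrict \<gamma> (vprod ?O ?O')) ` vgroup (qcov c1) (qcov d1) (qgrp c1) (qgrp d1)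
      = vgroup ?O ?O' ((\<lambda>\<gamma>. restrict \<gamma> ?O) ` qgrp c1) ((\<lambda>\<gamma>. restrict \<gamma> ?O') ` qgrp d1)" (is "?L = ?R")
  proof (intro equalityI subsetI)
    fix f assume "f \<in> ?L"
    then obtain \<gamma> \<delta> where "\<gamma> \<in> qgrp c1" "\<delta> \<in> qgrp d1"
      "f = restrict (restrict (vmap \<gamma> \<delta>) (vprod (qcov c1) (qcov d1))) (vprod ?O ?O')"
      by (auto simp: vgroup_def)
    then show "f \<in> ?R" unfolding r vgroup_def by blast
  next
    fix f assume "f \<in> ?R"
    then obtain \<gamma> \<delta> where gd: "\<gamma> \<in> qgrp c1" "\<delta> \<in> qgrp d1"
      "f = restrict (vmap (restrict \<gamma> ?O) (restrict \<delta> ?O')) (vprod ?O ?O')"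
      by (auto simp: vgroup_def)
    have "restrict (vmap \<gamma> \<delta>) (vprod (qcov c1) (qcov d1)) \<in> vgroup (qcov c1) (qcov d1) (qgrp c1) (qgrp d1)"
      using gd by (auto simp: vgroup_def)
    from imageI[OF this, of "\<lambda>\<gamma>. restrict \<gamma> (vprod ?O ?O')"]
    show "f \<in> ?L" unfolding gd(3) r[symmetric] by simp
  qed
  then show "overlap_model (product_chart c1 d1) (product_chart c2 d2)"
    using pre_model_vprod om unfolding overlap_model_def ov by simp
qed

text \<open>If the domains are disjoint in one factor, there is nothing to show. Otherwise both
  factors supply covers and lifts, and their products serve for the product charts.\<close>

lemma compatible_charts_product:
  fixes c1 c2 :: "('m, 'k::finite) qchart" and d1 d2 :: "('m2, 'l::finite) qchart"
  assumes ch: "quasifold_chart T c1" "quasifold_chart T c2" "quasifold_chart T' d1" "quasifold_chart T' d2"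
    and comp: "compatible_charts c1 c2" "compatible_charts d1 d2"
  shows "compatible_charts (product_chart c1 d1) (product_chart c2 d2)"
proof (cases "qdom c1 \<inter> qdom c2 = {} \<or> qdom d1 \<inter> qdom d2 = {}")
  case True
  then have "qdom (product_chart c1 d1) \<inter> qdom (product_chart c2 d2) = {}" by auto
  then show ?thesis by (simp only: compatible_charts_def) simp
next
  case False
  then have ne: "qdom c1 \<inter> qdom c2 \<noteq> {}" "qdom d1 \<inter> qdom d2 \<noteq> {}" by auto
  obtain T1 T2 :: "(complex^'k) topology" and w1 w2 F where c: "overlap_model c1 c2" "overlap_model c2 c1"
    "simply_connected_space T1" "simply_connected_space T2"
    "covering_map T1 (top_of_set (qoverlap c1 c2)) w1" "covering_map T2 (top_of_set (qoverlap c2 c1)) w2"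
    "biholomorphic_mfd_map (cover_mfd T1 (qoverlap c1 c2) w1) (cover_mfd T2 (qoverlap c2 c1) w2) F"
    "\<forall>u\<in>topspace T1. qparam c2 (w2 (F u)) = qparam c1 (w1 u)"
    using compatible_chartsE[OF ch(1,2) comp(1) ne(1)] .
  obtain T1' T2' :: "(complex^'l) topology" and w1' w2' G where d: "overlap_model d1 d2" "overlap_model d2 d1"
    "simply_connected_space T1'" "simply_connected_space T2'"
    "covering_map T1' (top_of_set (qoverlap d1 d2)) w1'" "covering_map T2' (top_of_set (qoverlap d2 d1)) w2'"
    "biholomorphic_mfd_map (cover_mfd T1' (qoverlap d1 d2) w1') (cover_mfd T2' (qoverlap d2 d1) w2') G"
    "\<forall>u\<in>topspace T1'. qparam d2 (w2' (G u)) = qparam d1 (w1' u)"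
    using compatible_chartsE[OF ch(3,4) comp(2) ne(2)] .
  note p1 = overlap_model_product[OF ch c(1) d(1)] and p2 = overlap_model_product[OF ch(2,1,4,3) c(2) d(2)]
  have op: "open (qoverlap c1 c2)" "open (qoverlap d1 d2)" "open (qoverlap c2 c1)" "open (qoverlap d2 d1)"
    using c(1,2) d(1,2) by (auto simp: overlap_model_def pre_model_open_mfd_iff)
  have cov1: "covering_map (vtop T1 T1') (top_of_set (vprod (qoverlap c1 c2) (qoverlap d1 d2))) (vmap w1 w1')"
    using covering_map_vmap[OF c(5) d(5)] by (simp add: vtop_top_of_set)
  have cov2: "covering_map (vtop T2 T2') (top_of_set (vprod (qoverlap c2 c1) (qoverlap d2 d1))) (vmap w2 w2')"
    using covering_map_vmap[OF c(6) d(6)] by (simp add: vtop_top_of_set)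
  let ?F' = "inv_into (topspace T1) F" and ?G' = "inv_into (topspace T1') G"
  have bF: "bij_betw F (topspace T1) (topspace T2)" and bG: "bij_betw G (topspace T1') (topspace T2')"
    using c(7) d(7) by (auto simp: biholomorphic_mfd_map_def)
  have hF: "holomorphic_mfd_map (cover_mfd T1 (qoverlap c1 c2) w1) (cover_mfd T2 (qoverlap c2 c1) w2) F"
    "holomorphic_mfd_map (cover_mfd T2 (qoverlap c2 c1) w2) (cover_mfd T1 (qoverlap c1 c2) w1) ?F'"
    using c(7) by (auto simp: biholomorphic_mfd_map_def)
  have hG: "holomorphic_mfd_map (cover_mfd T1' (qoverlap d1 d2) w1') (cover_mfd T2' (qoverlap d2 d1) w2') G"
    "holomorphic_mfd_map (cover_mfd T2' (qoverlap d2 d1) w2') (cover_mfd T1' (qoverlap d1 d2) w1') ?G'"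
    using d(7) by (auto simp: biholomorphic_mfd_map_def)
  have bi: "biholomorphic_mfd_map (cover_mfd (vtop T1 T1') (vprod (qoverlap c1 c2) (qoverlap d1 d2)) (vmap w1 w1'))
     (cover_mfd (vtop T2 T2') (vprod (qoverlap c2 c1) (qoverlap d2 d1)) (vmap w2 w2')) (vmap F G)"
  proof (rule cover_biholomorphicI[OF _ _ cov1 cov2])
    show "holomorphic_mfd_map (cover_mfd (vtop T1 T1') (vprod (qoverlap c1 c2) (qoverlap d1 d2)) (vmap w1 w1'))
       (cover_mfd (vtop T2 T2') (vprod (qoverlap c2 c1) (qoverlap d2 d1)) (vmap w2 w2')) (vmap F G)"
      by (rule cover_holomorphic_vmap[OF op(1,2,3,4) c(5) d(5) c(6) d(6) hF(1) hG(1)])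
    show "holomorphic_mfd_map (cover_mfd (vtop T2 T2') (vprod (qoverlap c2 c1) (qoverlap d2 d1)) (vmap w2 w2'))
       (cover_mfd (vtop T1 T1') (vprod (qoverlap c1 c2) (qoverlap d1 d2)) (vmap w1 w1')) (vmap ?F' ?G')"
      by (rule cover_holomorphic_vmap[OF op(3,4,1,2) c(6) d(6) c(5) d(5) hF(2) hG(2)])
    show "vmap ?F' ?G' (vmap F G x) = x" if "x \<in> topspace (vtop T1 T1')" for x
      using that bij_betw_inv_into_left[OF bF] bij_betw_inv_into_left[OF bG]
      by (intro vec_sum_eqI) (auto simp: vprod_def)
    show "vmap F G (vmap ?F' ?G' y) = y" if "y \<in> topspace (vtop T2 T2')" for y
      using that bij_betw_inv_into_right[OF bF] bij_betw_inv_into_right[OF bG]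
      by (intro vec_sum_eqI) (auto simp: vprod_def)
  qed (use op open_vprod in auto)
  show ?thesis
  proof (rule compatible_chartsI[where w = "vmap w1 w1'" and w' = "vmap w2 w2'"])
    show "quasifold_chart (prod_topology T T') (product_chart c1 d1)" by (rule quasifold_chart_product[OF ch(1,3)])
    show "quasifold_chart (prod_topology T T') (product_chart c2 d2)" by (rule quasifold_chart_product[OF ch(2,4)])
    show "overlap_model (product_chart c1 d1) (product_chart c2 d2)" by (rule p1(2))
    show "overlap_model (product_chart c2 d2) (product_chart c1 d1)" by (rule p2(2))
    show "simply_connected_space (vtop T1 T1')" by (rule simply_connected_space_vtop[OF c(3) d(3)])
    show "simply_connected_space (vtop T2 T2')" by (rule simply_connected_space_vtop[OF c(4) d(4)])
    show "covering_map (vtop T1 T1') (top_of_set (qoverlap (product_chart c1 d1) (product_chart c2 d2))) (vmap w1 w1')"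
      unfolding p1(1) by (rule cov1)
    show "covering_map (vtop T2 T2') (top_of_set (qoverlap (product_chart c2 d2) (product_chart c1 d1))) (vmap w2 w2')"
      unfolding p2(1) by (rule cov2)
    show "biholomorphic_mfd_map
       (cover_mfd (vtop T1 T1') (qoverlap (product_chart c1 d1) (product_chart c2 d2)) (vmap w1 w1'))
       (cover_mfd (vtop T2 T2') (qoverlap (product_chart c2 d2) (product_chart c1 d1)) (vmap w2 w2')) (vmap F G)"
      unfolding p1(1) p2(1) by (rule bi)
    fix u assume "u \<in> topspace (vtop T1 T1')"
    then have u: "vleft u \<in> topspace T1" "vright u \<in> topspace T1'" by (auto simp: vprod_def)
    then have Fu: "F (vleft u) \<in> topspace T2" "G (vright u) \<in> topspace T2'"
      using bF bG by (auto simp: bij_betw_def)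
    have "w1 (vleft u) \<in> qoverlap c1 c2" "w1' (vright u) \<in> qoverlap d1 d2"
      "w2 (F (vleft u)) \<in> qoverlap c2 c1" "w2' (G (vright u)) \<in> qoverlap d2 d1"
      using u Fu c(5,6) d(5,6) by (auto simp: covering_map_def)
    then have "vmap w1 w1' u \<in> vprod (qcov c1) (qcov d1)" "vmap w2 w2' (vmap F G u) \<in> vprod (qcov c2) (qcov d2)"
      by (auto simp: vprod_def qoverlap_def)
    then show "qparam (product_chart c2 d2) (vmap w2 w2' (vmap F G u)) = qparam (product_chart c1 d1) (vmap w1 w1' u)"
      using bspec[OF c(8) u(1)] bspec[OF d(8) u(2)]
      by (simp add: qparam_product_chart[OF qchart_group[OF ch(1)] qchart_group[OF ch(3)]]
          qparam_product_chart[OF qchart_group[OF ch(2)] qchart_group[OF ch(4)]])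
  qed
qed

lemma complex_quasifoldD:
  assumes "complex_quasifold T A"
  shows "topspace T = (\<Union>c\<in>A. qdom c)" "\<And>c. c \<in> A \<Longrightarrow> quasifold_chart T c"
    "\<And>c c'. c \<in> A \<Longrightarrow> c' \<in> A \<Longrightarrow> compatible_charts c c'"
  using assms unfolding complex_quasifold_def by blast+

text \<open>All product charts are pairwise compatible, and they cover the product; a maximal atlas
  around them exists.\<close>

lemma product_quasifold_exists:
  assumes A: "complex_quasifold T A" and B: "complex_quasifold T' B"
  obtains P where "product_quasifold T A T' B P"
proof -
  define P\<^sub>0 where "P\<^sub>0 = {product_chart c c' |c c'. c \<in> A \<and> c' \<in> B}"
  note chA = complex_quasifoldD(2)[OF A] and chB = complex_quasifoldD(2)[OF B]
  obtain P where P: "P\<^sub>0 \<subseteq> P" "complex_quasifold (prod_topology T T') P"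
  proof (rule maximal_atlas_exists[of P\<^sub>0 "prod_topology T T'"])
    show "quasifold_chart (prod_topology T T') c" if "c \<in> P\<^sub>0" for c
      using that chA chB by (auto simp: P\<^sub>0_def intro: quasifold_chart_product)
    show "compatible_charts c c'" if "c \<in> P\<^sub>0" "c' \<in> P\<^sub>0" for c c'
    proof -
      obtain c1 d1 where 1: "c1 \<in> A" "d1 \<in> B" "c = product_chart c1 d1" using \<open>c \<in> P\<^sub>0\<close> by (auto simp: P\<^sub>0_def)
      obtain c2 d2 where 2: "c2 \<in> A" "d2 \<in> B" "c' = product_chart c2 d2" using \<open>c' \<in> P\<^sub>0\<close> by (auto simp: P\<^sub>0_def)
      show ?thesis unfolding 1(3) 2(3)
      proof (rule compatible_charts_product)
        show "quasifold_chart T c1" "quasifold_chart T c2" using chA 1 2 by blast+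
        show "quasifold_chart T' d1" "quasifold_chart T' d2" using chB 1 2 by blast+
        show "compatible_charts c1 c2" "compatible_charts d1 d2"
          using 1 2 complex_quasifoldD(3)[OF A] complex_quasifoldD(3)[OF B] by blast+
      qed
    qed
    note tops = complex_quasifoldD(1)[OF A] complex_quasifoldD(1)[OF B]
    have "\<exists>c\<in>P\<^sub>0. p \<in> qdom c" if "p \<in> topspace (prod_topology T T')" for p
    proof -
      have "fst p \<in> topspace T" "snd p \<in> topspace T'" using that by auto
      then obtain c d where "c \<in> A" "d \<in> B" "fst p \<in> qdom c" "snd p \<in> qdom d"
        unfolding tops by blast
      then show ?thesis
        by (intro bexI[of _ "product_chart c d"]) (auto simp: P\<^sub>0_def mem_Times_iff)
    qed
    then show "topspace (prod_topology T T') \<subseteq> (\<Union>c\<in>P\<^sub>0. qdom c)" by blast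
  qed
  have "product_chart c c' \<in> P" if "c \<in> A" "c' \<in> B" for c c' using P(1) that by (auto simp: P\<^sub>0_def)
  then have "product_quasifold T A T' B P" using P(2) by (simp add: product_quasifold_def)
  then show ?thesis by (rule that)
qed

section \<open>The exponential covers\<close>

text \<open>Normalized to period 1, so that its kernel is the group of integers that is divided out
  in \<open>complex_torus\<close>.\<close>

definition cexp :: "complex \<Rightarrow> complex" where
  "cexp z = exp (2 * complex_of_real pi * \<i> * z)"

text \<open>The branch of the inverse of \<open>cexp\<close> that takes the value \<open>a\<close>
  at \<open>cexp a\<close>: the principal logarithm is applied to the quotient only.\<close>

definition clog :: "complex \<Rightarrow> complex \<Rightarrow> complex" where
  "clog a y = a + Ln (y / cexp a) / (2 * complex_of_real pi * \<i>)"

definition nzset :: "'k set \<Rightarrow> (complex^'k) set" where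
  "nzset J = {z. \<forall>i\<in>J. z $ i \<noteq> 0}"

definition pexp :: "'k set \<Rightarrow> complex^'k \<Rightarrow> complex^'k" where
  "pexp J y = (\<chi> i. if i \<in> J then cexp (y $ i) else y $ i)"

definition plog :: "'k set \<Rightarrow> complex^'k \<Rightarrow> complex^'k \<Rightarrow> complex^'k" where
  "plog J x y = (\<chi> i. if i \<in> J then clog (x $ i) (y $ i) else y $ i)"

lemma cexp_0 [simp]: "cexp 0 = 1"
  by (simp add: cexp_def)

lemma cexp_nonzero [simp]: "cexp a \<noteq> 0"
  by (simp add: cexp_def)

lemma cexp_add: "cexp (a + b) = cexp a * cexp b"
  by (simp add: cexp_def exp_add distrib_left)

lemma cexp_minus_mult [simp]: "cexp (- a) * cexp a = 1" "cexp a * cexp (- a) = 1"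
  by (simp_all flip: cexp_add)

lemma cexp_diff: "cexp (a - b) = cexp a / cexp b"
  by (simp add: cexp_def exp_diff right_diff_distrib)

lemma cexp_eq_1_iff: "cexp a = 1 \<longleftrightarrow> a \<in> \<int>"
proof -
  have "cexp a = 1 \<longleftrightarrow> Im a = 0 \<and> (\<exists>n::int. 2 * pi * Re a = of_int (2 * n) * pi)"
    by (simp add: cexp_def exp_eq_1)
  also have "\<dots> \<longleftrightarrow> Im a = 0 \<and> (\<exists>n::int. Re a = of_int n)" by (auto simp: field_simps)
  also have "\<dots> \<longleftrightarrow> a \<in> \<int>" by (auto simp: complex_is_Int_iff)
  finally show ?thesis .
qed

lemma cexp_clog: "y \<noteq> 0 \<Longrightarrow> cexp (clog a y) = y"
  unfolding clog_def cexp_add by (simp add: cexp_def)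

lemma clog_cexp: "clog a (cexp a) = a"
  by (simp add: clog_def)

lemma cdiff_at1_cexp: "cdiff_at1 f z \<Longrightarrow> cdiff_at1 (\<lambda>y. cexp (f y)) z"
  unfolding cexp_def by (intro cdiff_at1_exp cdiff_at1_mult cdiff_at1_const)

text \<open>A positive real part bounds the argument of the quotient by \<open>pi / 2\<close>.
  Division by the factor \<open>2 * pi\<close> in \<open>cexp\<close> turns this into the bound
  \<open>1/4\<close>.\<close>

lemma Re_pos_iff_clog: "Re (cexp b / cexp a) > 0 \<Longrightarrow> b = clog a (cexp b) \<longleftrightarrow> \<bar>Re (b - a)\<bar> < 1/4"
proof -
  assume pos: "Re (cexp b / cexp a) > 0"
  have "b = clog a (cexp b) \<longleftrightarrow> Ln (exp (2 * complex_of_real pi * \<i> * (b - a))) = 2 * complex_of_real pi * \<i> * (b - a)"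
    by (auto simp: clog_def field_simps cexp_def exp_diff)
  also have "\<dots> \<longleftrightarrow> \<bar>Re (b - a)\<bar> < 1/4"
  proof
    assume "Ln (exp (2 * complex_of_real pi * \<i> * (b - a))) = 2 * complex_of_real pi * \<i> * (b - a)"
    then have "Im (Ln (cexp b / cexp a)) = 2 * pi * Re (b - a)"
      by (simp add: cexp_def exp_diff right_diff_distrib)
    moreover have "\<bar>Im (Ln (cexp b / cexp a))\<bar> < pi / 2"
      using pos Re_Ln_pos_lt[of "cexp b / cexp a"] by auto
    ultimately have "2 * pi * \<bar>Re (b - a)\<bar> < pi / 2" by (simp add: abs_mult)
    then show "\<bar>Re (b - a)\<bar> < 1/4" using pi_gt_zero by (simp add: field_simps)
  next
    assume "\<bar>Re (b - a)\<bar> < 1/4"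
    then have "\<bar>2 * pi * Re (b - a)\<bar> < pi"
      using pi_gt_zero by (simp add: abs_mult)
    then show "Ln (exp (2 * complex_of_real pi * \<i> * (b - a))) = 2 * complex_of_real pi * \<i> * (b - a)"
      by (intro Ln_exp) (auto simp: abs_less_iff)
  qed
  finally show ?thesis .
qed

lemma Re_cexp_quotient_pos: "\<bar>Re (b - a)\<bar> < 1/4 \<Longrightarrow> Re (cexp b / cexp a) > 0"
proof -
  assume "\<bar>Re (b - a)\<bar> < 1/4"
  then have "2 * pi * \<bar>Re (b - a)\<bar> < 2 * pi * (1/4)" using pi_gt_zero by (intro mult_strict_left_mono) auto
  then have "\<bar>2 * pi * Re (b - a)\<bar> < pi / 2" by (simp only: abs_mult) simp
  then have "2 * pi * Re (b - a) < pi / 2" "- (pi / 2) < 2 * pi * Re (b - a)"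
    unfolding abs_less_iff by linarith+
  then have "cos (2 * pi * Re (b - a)) > 0" by (intro cos_gt_zero_pi)
  moreover have "cexp b / cexp a = exp (2 * complex_of_real pi * \<i> * (b - a))"
    by (simp add: cexp_def exp_diff right_diff_distrib)
  ultimately show ?thesis by (simp add: Re_exp)
qed

section \<open>Coordinatewise exponentials and their branches\<close>

lemma open_nzset: "open (nzset J :: (complex^'k::finite) set)"
proof -
  have "nzset J = (\<Inter>i\<in>J. {z :: complex^'k. z $ i \<noteq> 0})" by (auto simp: nzset_def)
  then show ?thesis by (auto intro!: open_INT open_Collect_neq continuous_intros)
qed

lemma cdiff_at_pexp: "cdiff_at (pexp J) z"
proof -
  have "cdiff_at1 (\<lambda>y. pexp J y $ i) z" for i
    by (cases "i \<in> J") (simp_all add: pexp_def cdiff_at1_cexp)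
  then show ?thesis by (simp add: cdiff_at_iff_components)
qed

lemma continuous_on_pexp: "continuous_on S (pexp J)"
  by (rule cdiff_at_imp_continuous_on) (rule cdiff_at_pexp)

text \<open>Half-planes around the values \<open>cexp (x $ i)\<close>. They avoid 0 and the cut of
  the principal logarithm, and their branch images are strips with real part within
  \<open>1/4\<close> of that of \<open>x $ i\<close>.\<close>

definition plog_dom :: "'k set \<Rightarrow> complex^'k \<Rightarrow> (complex^'k) set" where
  "plog_dom J x = {y. \<forall>i\<in>J. Re (y $ i / cexp (x $ i)) > 0}"

lemma plog_dom_subset: "plog_dom J x \<subseteq> nzset J"
  by (auto simp: plog_dom_def nzset_def)

lemma open_plog_dom: "open (plog_dom J x)" for x :: "complex^'k::finite"
proof -
  have "plog_dom J x = (\<Inter>i\<in>J. {y. Re (y $ i / cexp (x $ i)) > 0})" by (auto simp: plog_dom_def)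
  then show ?thesis by (auto intro!: open_INT open_Collect_less continuous_intros)
qed

lemma cdiff_at_plog:
  assumes "y \<in> plog_dom J x" shows "cdiff_at (plog J x) y"
proof -
  have "cdiff_at1 (\<lambda>y. plog J x y $ i) y" for i
  proof (cases "i \<in> J")
    case True
    have "Re (y $ i / cexp (x $ i)) > 0" using assms True by (simp add: plog_dom_def)
    then have "y $ i / cexp (x $ i) \<notin> \<real>\<^sub>\<le>\<^sub>0" by (auto simp: complex_nonpos_Reals_iff)
    then have "((\<lambda>u. clog (x $ i) u) has_field_derivative
        (1 / (y $ i / cexp (x $ i)) * (1 / cexp (x $ i))) / (2 * complex_of_real pi * \<i>)) (at (y $ i))"
      unfolding clog_def by (auto intro!: derivative_eq_intros)
    then have "cdiff_at1 (\<lambda>y. clog (x $ i) (y $ i)) y"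
      by (intro cdiff_at1_compose_deriv[OF cdiff_at1_nth])
    then show ?thesis using True by (simp add: plog_def)
  qed (simp add: plog_def)
  then show ?thesis by (simp add: cdiff_at_iff_components)
qed

lemma pexp_plog: "y \<in> nzset J \<Longrightarrow> pexp J (plog J x y) = y"
  by (simp add: vec_eq_iff pexp_def plog_def nzset_def cexp_clog)

lemma plog_pexp: "plog J x (pexp J x) = x"
  by (simp add: vec_eq_iff pexp_def plog_def clog_cexp)

lemma pexp_in_plog_dom: "pexp J x \<in> plog_dom J x"
  by (simp add: plog_dom_def pexp_def)

lemma local_section_plog: "local_section euclidean (pexp J) x (plog_dom J x) (plog J x)"
proof -
  have "continuous_on (plog_dom J x) (plog J x)"
    by (rule cdiff_at_imp_continuous_on) (rule cdiff_at_plog)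
  then show ?thesis
    unfolding local_section_def using pexp_plog plog_dom_subset[of J x]
    by (auto simp: open_plog_dom pexp_in_plog_dom plog_pexp)
qed

text \<open>The continuous branches through the points of \<open>A\<close> show that
  \<open>pexp J\<close> is an open map.\<close>

lemma open_pexp_image:
  assumes "open A" shows "open (pexp J ` A)"
proof (subst open_subopen, intro ballI)
  fix y assume "y \<in> pexp J ` A"
  then obtain x where x: "x \<in> A" "y = pexp J x" by blast
  define N where "N = {u \<in> plog_dom J x. plog J x u \<in> A}"
  have "continuous_on (plog_dom J x) (plog J x)"
    by (rule cdiff_at_imp_continuous_on) (rule cdiff_at_plog)
  then have "open (plog_dom J x \<inter> plog J x -` A)"
    using open_plog_dom assms by (rule continuous_open_preimage)
  moreover have "plog_dom J x \<inter> plog J x -` A = N" by (auto simp: N_def)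
  ultimately have "open N" by simp
  moreover have "y \<in> N" using x by (simp add: N_def pexp_in_plog_dom plog_pexp)
  moreover have "u \<in> pexp J ` A" if "u \<in> N" for u
  proof -
    have "u = pexp J (plog J x u)" using that plog_dom_subset[of J x] by (auto simp: N_def pexp_plog)
    then show ?thesis using that by (auto simp: N_def)
  qed
  ultimately show "\<exists>T. open T \<and> y \<in> T \<and> T \<subseteq> pexp J ` A" by blast
qed

lemma range_pexp: "range (pexp J) = nzset J"
proof (intro equalityI subsetI)
  fix y :: "complex^'a" assume "y \<in> nzset J"
  then have "y = pexp J (plog J 0 y)" by (simp add: pexp_plog)
  then show "y \<in> range (pexp J)" by blast
qed (auto simp: nzset_def pexp_def)

text \<open>Around a centre \<open>x\<close> the product of half-planes is evenly covered, with one
  sheet for every logarithm \<open>u\<close> of \<open>x\<close>.\<close>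

lemma covering_map_pexp: "covering_map euclidean (top_of_set (nzset J)) (pexp J)"
  for J :: "'k::finite set"
  unfolding covering_map_def
proof (intro conjI ballI)
  show "continuous_map euclidean (top_of_set (nzset J)) (pexp J)"
    using range_pexp[of J] by (auto simp: continuous_map_in_subtopology continuous_on_pexp)
  show "pexp J ` topspace euclidean = topspace (top_of_set (nzset J))" by (simp add: range_pexp)
  fix x assume "x \<in> topspace (top_of_set (nzset J))"
  then obtain x0 where x0: "x = pexp J x0" using range_pexp[of J] by force
  define N where "N = plog_dom J x0"
  define \<V> where "\<V> = {plog J u ` N |u. pexp J u = x}"
  \<comment> \<open>The half-planes depend on the centre only and not on the logarithm chosen for
    it.\<close>
  have dom: "plog_dom J u = N" if "pexp J u = x" for u
  proof -
    have "cexp (u $ i) = cexp (x0 $ i)" if "i \<in> J" for i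
      using \<open>pexp J u = x\<close> that unfolding x0 vec_eq_iff pexp_def by (auto dest: spec[of _ i])
    then show ?thesis by (auto simp: N_def plog_dom_def)
  qed
  have Nsub: "N \<subseteq> nzset J" unfolding N_def by (rule plog_dom_subset)
  have "open N" unfolding N_def by (rule open_plog_dom)
  \<comment> \<open>The sheets become explicit boxes, from which their openness is read off.\<close>
  have box: "plog J u ` N = {v. \<forall>i\<in>J. \<bar>Re (v $ i - u $ i)\<bar> < 1/4}" if u: "pexp J u = x" for u
  proof (intro equalityI subsetI)
    fix v assume "v \<in> plog J u ` N"
    then obtain y where y: "y \<in> plog_dom J u" "v = plog J u y" using dom[OF u] by auto
    have "\<bar>Re (v $ i - u $ i)\<bar> < 1/4" if i: "i \<in> J" for i
    proof -
      have vi: "v $ i = clog (u $ i) (y $ i)" and pos: "Re (y $ i / cexp (u $ i)) > 0"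
        using y i by (auto simp: plog_def plog_dom_def)
      have yi: "cexp (v $ i) = y $ i" unfolding vi using pos by (intro cexp_clog) auto
      show ?thesis using Re_pos_iff_clog[of "v $ i" "u $ i"] pos vi unfolding yi by simp
    qed
    then show "v \<in> {v. \<forall>i\<in>J. \<bar>Re (v $ i - u $ i)\<bar> < 1/4}" by blast
  next
    fix v assume "v \<in> {v. \<forall>i\<in>J. \<bar>Re (v $ i - u $ i)\<bar> < 1/4}"
    then have b: "\<bar>Re (v $ i - u $ i)\<bar> < 1/4" if "i \<in> J" for i using that by blast
    have "pexp J v \<in> plog_dom J u" using Re_cexp_quotient_pos[OF b] by (simp add: plog_dom_def pexp_def)
    moreover have "v = plog J u (pexp J v)"
      using Re_pos_iff_clog[OF Re_cexp_quotient_pos[OF b]] b by (simp add: vec_eq_iff plog_def pexp_def)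
    ultimately show "v \<in> plog J u ` N" using dom[OF u] by blast
  qed
  have opV: "open (plog J u ` N)" if "pexp J u = x" for u
  proof -
    have "{v. \<forall>i\<in>J. \<bar>Re (v $ i - u $ i)\<bar> < 1/4} = (\<Inter>i\<in>J. {v. \<bar>Re (v $ i - u $ i)\<bar> < 1/4})" by auto
    then show ?thesis unfolding box[OF that]
      by (auto intro!: open_INT open_Collect_less continuous_intros)
  qed
  have hom: "homeomorphic_map (subtopology euclidean (plog J u ` N)) (subtopology (top_of_set (nzset J)) N) (pexp J)"
    if u: "pexp J u = x" for u
  proof -
    have cont: "continuous_on N (plog J u)"
      by (rule cdiff_at_imp_continuous_on) (use cdiff_at_plog dom[OF u] in blast)
    have inv: "pexp J (plog J u y) = y" if "y \<in> N" for y using that Nsub by (intro pexp_plog) blast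
    have "homeomorphic_maps (top_of_set (plog J u ` N)) (top_of_set N) (pexp J) (plog J u)"
      unfolding homeomorphic_maps_def using cont inv by (auto simp: continuous_on_pexp)
    moreover have "subtopology (top_of_set (nzset J)) N = top_of_set N"
      using Nsub by (simp add: subtopology_subtopology Int_absorb1)
    ultimately show ?thesis using homeomorphic_map_maps by metis
  qed
  have un: "\<Union>\<V> = {u \<in> topspace euclidean. pexp J u \<in> N}"
  proof (intro equalityI subsetI)
    fix v assume "v \<in> \<Union>\<V>"
    then obtain u y where "pexp J u = x" "y \<in> N" "v = plog J u y" by (auto simp: \<V>_def)
    then show "v \<in> {u \<in> topspace euclidean. pexp J u \<in> N}" using Nsub by (auto simp: pexp_plog subset_iff)
  next
    fix v assume "v \<in> {u \<in> topspace euclidean. pexp J u \<in> N}"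
    then have vN: "pexp J v \<in> N" by simp
    \<comment> \<open>The logarithm of the centre whose sheet contains \<open>v\<close>, found by
      going back from \<open>v\<close> by the principal logarithm of the quotient. Outside
      \<open>J\<close> the map \<open>pexp\<close> is the identity, so there the centre itself is
      taken.\<close>
    define u where "u = (\<chi> i. if i \<in> J then v $ i - Ln (cexp (v $ i) / x $ i) / (2 * complex_of_real pi * \<i>) else x $ i)"
    have xnz: "x $ i \<noteq> 0" if "i \<in> J" for i using that x0 by (simp add: pexp_def)
    have cu: "cexp (u $ i) = x $ i" if i: "i \<in> J" for i
    proof -
      have "cexp (Ln (cexp (v $ i) / x $ i) / (2 * complex_of_real pi * \<i>)) = cexp (v $ i) / x $ i"
        using xnz[OF i] by (simp add: cexp_def[of "Ln _ / _"])
      then show ?thesis using i xnz[OF i] by (simp add: u_def cexp_diff)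
    qed
    then have ux: "pexp J u = x" by (simp add: vec_eq_iff pexp_def u_def)
    have "plog J u (pexp J v) $ i = v $ i" for i
    proof (cases "i \<in> J")
      case True
      then have "plog J u (pexp J v) $ i = u $ i + Ln (cexp (v $ i) / x $ i) / (2 * complex_of_real pi * \<i>)"
        using cu[OF True] by (simp add: plog_def pexp_def clog_def)
      then show ?thesis using True by (simp add: u_def)
    qed (simp add: plog_def pexp_def)
    then have "v = plog J u (pexp J v)" by (simp add: vec_eq_iff)
    then show "v \<in> \<Union>\<V>" using vN ux unfolding \<V>_def by blast
  qed
  \<comment> \<open>A common point of two sheets determines its image \<open>y\<close>. The branch
    value at \<open>y\<close> differs from the logarithm of the centre by a term that depends only
    on \<open>y\<close> and the centre.\<close>
  have "u = u'" if "pexp J u = x" "pexp J u' = x" and ne: "plog J u ` N \<inter> plog J u' ` N \<noteq> {}" for u u'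
  proof -
    obtain y y' where y: "y \<in> N" "y' \<in> N" "plog J u y = plog J u' y'" using ne by blast
    have "pexp J (plog J u y) = y" using pexp_plog[OF subsetD[OF Nsub y(1)]] .
    moreover have "pexp J (plog J u' y') = y'" using pexp_plog[OF subsetD[OF Nsub y(2)]] .
    ultimately have yy: "y = y'" using y(3) by simp
    have "u $ i = u' $ i" for i
    proof (cases "i \<in> J")
      case True
      have "pexp J u $ i = x $ i" "pexp J u' $ i = x $ i" using that(1,2) by simp_all
      then have "cexp (u $ i) = x $ i" "cexp (u' $ i) = x $ i" using True by (simp_all add: pexp_def)
      moreover have "plog J u y $ i = plog J u' y $ i" using y(3) yy by simp
      ultimately show ?thesis using True by (simp add: plog_def clog_def)
    next
      case False
      have "pexp J u $ i = pexp J u' $ i" using that(1,2) by simp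
      then show ?thesis using False by (simp add: pexp_def)
    qed
    then show ?thesis by (simp add: vec_eq_iff)
  qed
  then have dis: "disjoint \<V>" unfolding disjoint_def \<V>_def by blast
  show "\<exists>U. x \<in> U \<and> openin (top_of_set (nzset J)) U \<and>
        (\<exists>\<V>. \<Union>\<V> = {u \<in> topspace euclidean. pexp J u \<in> U} \<and> (\<forall>V\<in>\<V>. openin euclidean V) \<and> disjoint \<V> \<and>
             (\<forall>V\<in>\<V>. homeomorphic_map (subtopology euclidean V) (subtopology (top_of_set (nzset J)) U) (pexp J)))"
  proof (intro exI[of _ N] exI[of _ \<V>] conjI un dis)
    show "x \<in> N" unfolding N_def x0 by (rule pexp_in_plog_dom)
    show "openin (top_of_set (nzset J)) N" using \<open>open N\<close> Nsub by (simp add: openin_open_eq[OF open_nzset])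
    show "\<forall>V\<in>\<V>. openin euclidean V" using opV by (auto simp: \<V>_def)
    show "\<forall>V\<in>\<V>. homeomorphic_map (subtopology euclidean V) (subtopology (top_of_set (nzset J)) N) (pexp J)"
      using hom by (auto simp: \<V>_def)
  qed
qed

text \<open>The straight-line homotopy between two loops runs through loops.\<close>

lemma simply_connected_space_euclidean:
  "simply_connected_space (euclidean :: 'a::real_normed_vector topology)"
  unfolding simply_connected_space_def
proof (intro allI impI)
  fix p q :: "real \<Rightarrow> 'a"
  assume pq: "pathin euclidean p \<and> p 1 = p 0 \<and> pathin euclidean q \<and> q 1 = q 0"
  then have c: "continuous_on {0..1} p" "continuous_on {0..1} q" by (auto simp: pathin_def)
  have "continuous_on ({0..1} \<times> {0..1}) (\<lambda>x :: real \<times> real. (1 - fst x) *\<^sub>R p (snd x) + fst x *\<^sub>R q (snd x))"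
    by (intro continuous_intros continuous_on_compose2[OF c(1)] continuous_on_compose2[OF c(2)]) auto
  then have "continuous_map (prod_topology (top_of_set {0..1}) (top_of_set {0..1})) euclidean
      (\<lambda>x :: real \<times> real. (1 - fst x) *\<^sub>R p (snd x) + fst x *\<^sub>R q (snd x))"
    by (simp flip: subtopology_Times)
  then show "homotopic_with (\<lambda>r. r 1 = r 0) (top_of_set {0..1}) euclidean p q"
    unfolding homotopic_with_def using pq
    by (intro exI[of _ "\<lambda>x. (1 - fst x) *\<^sub>R p (snd x) + fst x *\<^sub>R q (snd x)"]) auto
qed

text \<open>\<open>pexp\<close> is holomorphic and has holomorphic branches, so for maps between
  these covers holomorphy is ordinary holomorphy in the logarithmic coordinates.\<close>

lemma cover_holomorphic_pexp:
  fixes F :: "complex^'k::finite \<Rightarrow> complex^'l::finite"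
  assumes "\<And>z. cdiff_at F z"
  shows "holomorphic_mfd_map (cover_mfd euclidean (nzset J) (pexp J)) (cover_mfd euclidean (nzset J') (pexp J')) F"
proof (rule cover_holomorphicI[OF open_nzset open_nzset])
  show "continuous_map euclidean euclidean F"
    using cdiff_at_imp_continuous_on[of UNIV F] assms by simp
  fix x :: "complex^'k"
  have "cdiff_at (plog J x) (pexp J x)" by (rule cdiff_at_plog[OF pexp_in_plog_dom])
  then have "cdiff_at (\<lambda>y. pexp J' (F (plog J x y))) (pexp J x)"
    by (rule cdiff_at_compose[OF cdiff_at_compose[OF _ assms] cdiff_at_pexp])
  then show "\<exists>N s. local_section euclidean (pexp J) x N s \<and> cdiff_at (\<lambda>y. pexp J' (F (s y))) (pexp J x)"
    using local_section_plog[of J x] by (intro exI conjI)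
qed

section \<open>Diagonal groups\<close>

definition cmul :: "complex^'k \<Rightarrow> complex^'k \<Rightarrow> complex^'k" where
  "cmul g z = (\<chi> i. g $ i * z $ i)"

lemma closure_nzset: "closure (nzset UNIV :: (complex^'k::finite) set) = UNIV"
proof -
  have "z \<in> closure (nzset UNIV)" for z :: "complex^'k"
  proof -
    \<comment> \<open>The zero coordinates are replaced by a common value \<open>t\<close>, which is
      then sent to 0.\<close>
    define f where "f t = (\<chi> i. if z $ i = 0 then t else z $ i)" for t
    have cont: "continuous_on UNIV f"
      unfolding f_def
    proof (rule continuous_on_vec_lambda)
      show "continuous_on UNIV (\<lambda>t. if z $ i = 0 then t else z $ i)" for i
        by (cases "z $ i = 0") (simp_all add: continuous_on_id)
    qed
    have "f ` closure (- {0}) \<subseteq> closure (f ` (- {0}))"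
      by (rule continuous_image_closure_subset[OF cont]) simp
    moreover have "closure (- {0::complex}) = UNIV" by (simp add: closure_complement)
    moreover have "f 0 = z" by (simp add: f_def vec_eq_iff)
    ultimately have "z \<in> closure (f ` (- {0}))" by auto
    moreover have "f ` (- {0}) \<subseteq> nzset UNIV" by (auto simp: f_def nzset_def split: if_splits)
    ultimately show ?thesis using closure_mono by blast
  qed
  then show ?thesis by blast
qed

lemma connected_nzset: "connected (nzset J :: (complex^'k::finite) set)"
proof -
  have "connected (pexp J ` UNIV)" by (intro connected_continuous_image continuous_on_pexp connected_UNIV)
  then show ?thesis by (simp add: range_pexp)
qed

lemma cdiff_at_cmul: "cdiff_at (cmul g) z"
proof -
  have "cdiff_at1 (\<lambda>y. cmul g y $ i) z" for i by (simp add: cmul_def cdiff_at1_mult)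
  then show ?thesis by (simp add: cdiff_at_iff_components)
qed

text \<open>A diagonal map that fixes a point without zero coordinates is the identity. Such points
  are connected and dense, and they lie in every \<open>nzset J\<close>, so the whole chart and its
  overlaps are treated together.\<close>

lemma pre_model_diagonal:
  fixes G :: "(complex^'k::finite) set"
  assumes nz: "\<And>g i. g \<in> G \<Longrightarrow> g $ i \<noteq> 0" and one: "(\<chi> i. 1) \<in> G"
    and mult: "\<And>g h. g \<in> G \<Longrightarrow> h \<in> G \<Longrightarrow> cmul g h \<in> G"
    and inv: "\<And>g. g \<in> G \<Longrightarrow> \<exists>h\<in>G. cmul h g = (\<chi> i. 1)"
  shows "pre_model (open_mfd (nzset J)) ((\<lambda>g. restrict (cmul g) (nzset J)) ` G)"
  unfolding pre_model_open_mfd_iff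
proof (intro conjI ballI)
  let ?S = "nzset J" let ?\<Gamma> = "(\<lambda>g. restrict (cmul g) ?S) ` G"
  show "open ?S" "connected ?S" by (rule open_nzset connected_nzset)+
  have maps: "cmul g z \<in> ?S" if "g \<in> G" "z \<in> ?S" for g z using nz that by (auto simp: cmul_def nzset_def)
  have assoc: "cmul g (cmul h z) = cmul (cmul g h) z" for g h z :: "complex^'k" by (simp add: cmul_def vec_eq_iff)
  have comm: "cmul g h = cmul h g" for g h :: "complex^'k" by (simp add: cmul_def vec_eq_iff)
  have id1: "cmul (\<chi> i. 1) z = z" for z :: "complex^'k" by (simp add: cmul_def vec_eq_iff)
  show "subgroup ?\<Gamma> (BijGroup ?S)"
    unfolding subgroup_BijGroup_iff
  proof (intro conjI ballI subsetI)
    fix f assume "f \<in> ?\<Gamma>"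
    then obtain g where g: "g \<in> G" "f = restrict (cmul g) ?S" by blast
    obtain h where h: "h \<in> G" "cmul h g = (\<chi> i. 1)" using inv[OF g(1)] by blast
    have hg: "cmul h (cmul g z) = z" "cmul g (cmul h z) = z" for z
      using h(2) comm[of g h] by (simp_all add: assoc id1)
    have "bij_betw f ?S ?S"
      by (rule bij_betw_byWitness[where f' = "cmul h"]) (use g h hg maps in auto)
    then show "f \<in> Bij ?S" using g(2) by (simp add: Bij_def)
    have "compose ?S (restrict (cmul h) ?S) f = (\<lambda>x\<in>?S. x)"
      using g maps hg by (auto simp: compose_def)
    then show "\<exists>h\<in>?\<Gamma>. compose ?S h f = (\<lambda>x\<in>?S. x)" using h(1) by blast
  next
    have "restrict (cmul (\<chi> i. 1)) ?S = (\<lambda>x\<in>?S. x)" by (auto simp: id1)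
    then show "(\<lambda>x\<in>?S. x) \<in> ?\<Gamma>" using imageI[OF one, of "\<lambda>g. restrict (cmul g) ?S"] by simp
  next
    fix f f' assume "f \<in> ?\<Gamma>" "f' \<in> ?\<Gamma>"
    then obtain g h where gh: "g \<in> G" "h \<in> G" "f = restrict (cmul g) ?S" "f' = restrict (cmul h) ?S" by blast
    have "compose ?S f f' = restrict (cmul (cmul g h)) ?S"
      using gh maps by (auto simp: compose_def assoc)
    then show "compose ?S f f' \<in> ?\<Gamma>" using mult[OF gh(1,2)] by simp
  qed
  have free: "nzset UNIV \<subseteq> free_points ?S ?\<Gamma>"
  proof
    fix z :: "complex^'k" assume z: "z \<in> nzset UNIV"
    have zS: "z \<in> ?S" using z by (simp add: nzset_def)
    have "f = (\<lambda>y\<in>?S. y)" if f: "f \<in> ?\<Gamma>" "f z = z" for f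
    proof -
      obtain g where g: "g \<in> G" "f = restrict (cmul g) ?S" using f(1) by blast
      then have "cmul g z = z" using f(2) zS by simp
      then have "g $ i = 1" for i using z by (auto simp: cmul_def nzset_def vec_eq_iff)
      then have "g = (\<chi> i. 1)" by (simp add: vec_eq_iff)
      then show ?thesis using g(2) by (auto simp: id1)
    qed
    then show "z \<in> free_points ?S ?\<Gamma>" using zS by (simp add: free_points_def)
  qed
  show "connected (free_points ?S ?\<Gamma>)"
    by (rule connected_intermediate_closure[OF connected_nzset free]) (simp add: closure_nzset)
  show "?S \<subseteq> closure (free_points ?S ?\<Gamma>)"
    using closure_mono[OF free] closure_nzset by blast
  fix f z assume "f \<in> ?\<Gamma>" and z: "z \<in> ?S"
  then obtain g where g: "f = restrict (cmul g) ?S" by blast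
  show "cdiff_at f z" by (rule cdiff_at_transform[OF cdiff_at_cmul[of g] open_nzset z]) (simp add: g)
qed

section \<open>Coordinates at a vertex\<close>

text \<open>The complex-linear coordinates with respect to the normals at the vertex, computed by
  pairing with the dual frame \<open>D\<close>.\<close>

definition coord :: "('n \<Rightarrow> real^'n) \<Rightarrow> complex^'n \<Rightarrow> complex^'n" where
  "coord D v = (\<chi> i. \<Sum>k\<in>UNIV. complex_of_real (D i $ k) * v $ k)"

text \<open>The value \<open>b\<close> fills the coordinates away from the vertex: 1 for points of
  the slice and 0 for exponents, which then leave the slice invariant.\<close>

definition spread :: "('n \<Rightarrow> 'd) \<Rightarrow> complex \<Rightarrow> complex^'n \<Rightarrow> complex^'d" where
  "spread \<sigma> b u = (\<chi> j. if j \<in> range \<sigma> then u $ inv_into UNIV \<sigma> j else b)"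

text \<open>The torus action written with an exponent \<open>Z\<close> instead of its class modulo
  integers.\<close>

definition tact :: "complex^'d \<Rightarrow> complex^'d \<Rightarrow> complex^'d" where
  "tact Z z = (\<chi> j. cexp (Z $ j) * z $ j)"

section \<open>Linear algebra of frames and exponents\<close>

lemma complexify_add: "complexify (a + b) = complexify a + complexify b"
  and complexify_scaleR: "complexify (c *\<^sub>R a) = complex_of_real c *s complexify a"
  by (simp_all add: complexify_def vec_eq_iff)

lemma pi_C_nth: "pi_C X z $ m = (\<Sum>j\<in>UNIV. z $ j * complex_of_real (X j $ m))"
  by (simp add: pi_C_def complexify_def)

lemma pi_C_0 [simp]: "pi_C X 0 = 0"
  and pi_C_add: "pi_C X (z + z') = pi_C X z + pi_C X z'"
  and pi_C_diff: "pi_C X (z - z') = pi_C X z - pi_C X z'"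
  by (simp_all add: vec_eq_iff pi_C_nth algebra_simps sum.distrib sum_subtractf)

lemma coord_add: "coord D (a + b) = coord D a + coord D b"
  and coord_diff: "coord D (a - b) = coord D a - coord D b"
  and coord_0 [simp]: "coord D 0 = 0"
  by (simp_all add: coord_def vec_eq_iff algebra_simps sum.distrib sum_subtractf)

lemma cdiff_at_coord: "cdiff_at (coord D) v"
proof -
  have "cdiff_at1 (\<lambda>y. coord D y $ i) v" for i
    by (simp add: coord_def cdiff_at1_sum cdiff_at1_mult)
  then show ?thesis by (simp add: cdiff_at_iff_components)
qed

lemma cdiff_at1_coord: "cdiff_at f v \<Longrightarrow> cdiff_at1 (\<lambda>y. coord D (f y) $ i) v"
  using cdiff_at_iff_components[THEN iffD1, rule_format, OF cdiff_at_compose[OF _ cdiff_at_coord[of D]]] .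

lemma tact_0 [simp]: "tact 0 z = z"
  and tact_tact: "tact Z (tact Z' z) = tact (Z + Z') z"
  by (simp_all add: tact_def vec_eq_iff cexp_add)

lemma tact_nonzero_iff [simp]: "tact Z z $ j = 0 \<longleftrightarrow> z $ j = 0"
  by (simp add: tact_def)

lemma tact_in_nzset [simp]: "tact Z z \<in> nzset J \<longleftrightarrow> z \<in> nzset J"
  by (simp add: nzset_def)

lemma spread_nth [simp]: "inj \<sigma> \<Longrightarrow> spread \<sigma> b u $ \<sigma> i = u $ i"
  "j \<notin> range \<sigma> \<Longrightarrow> spread \<sigma> b u $ j = b"
  by (simp_all add: spread_def)

lemma pi_C_spread:
  assumes "inj \<sigma>"
  shows "pi_C X (spread \<sigma> 0 u) = (\<Sum>i\<in>UNIV. u $ i *s complexify (X (\<sigma> i)))"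
proof -
  have "pi_C X (spread \<sigma> 0 u) = (\<Sum>j\<in>range \<sigma>. spread \<sigma> 0 u $ j *s complexify (X j))"
    unfolding pi_C_def by (rule sum.mono_neutral_right) auto
  also have "\<dots> = (\<Sum>i\<in>UNIV. spread \<sigma> 0 u $ \<sigma> i *s complexify (X (\<sigma> i)))"
    using assms by (subst sum.reindex) simp_all
  finally show ?thesis using assms by simp
qed

lemma coord_combination:
  assumes "normal_frame X \<sigma> D"
  shows "coord D (\<Sum>i\<in>I. u $ i *s complexify (X (\<sigma> i))) $ k = (if k \<in> I then u $ k else 0)"
proof -
  have DX: "(\<Sum>m\<in>UNIV. D k $ m * X (\<sigma> i) $ m) = (if k = i then 1 else 0)" for i
    using assms unfolding normal_frame_def inner_vec_def by simp
  have "coord D (\<Sum>i\<in>I. u $ i *s complexify (X (\<sigma> i))) $ k =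
      (\<Sum>m\<in>UNIV. \<Sum>i\<in>I. u $ i * complex_of_real (D k $ m * X (\<sigma> i) $ m))"
    by (simp add: coord_def complexify_def sum_distrib_left mult_ac)
  also have "\<dots> = (\<Sum>i\<in>I. u $ i * complex_of_real (\<Sum>m\<in>UNIV. D k $ m * X (\<sigma> i) $ m))"
    by (subst sum.swap) (simp add: sum_distrib_left)
  also have "\<dots> = (\<Sum>i\<in>I. if k = i then u $ i else 0)"
    unfolding DX by (rule sum.cong) auto
  finally show ?thesis by simp
qed

lemma combination_coord:
  assumes "normal_frame X \<sigma> D"
  shows "(\<Sum>i\<in>UNIV. coord D v $ i *s complexify (X (\<sigma> i))) = v"
proof -
  \<comment> \<open>Duality in the other order, obtained by expanding the standard basis vectors in
    the frame.\<close>
  have ax: "(\<Sum>i\<in>UNIV. D i $ k * X (\<sigma> i) $ m) = (if k = m then 1 else 0)" for k m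
  proof -
    have "axis k 1 = (\<Sum>i\<in>UNIV. (D i \<bullet> axis k 1) *\<^sub>R X (\<sigma> i))"
      using assms unfolding normal_frame_def by blast
    from arg_cong[OF this, of "\<lambda>v. v $ m"]
    have "axis k (1::real) $ m = (\<Sum>i\<in>UNIV. D i $ k * X (\<sigma> i) $ m)"
      by (simp add: inner_axis)
    then show ?thesis by (auto simp: axis_def)
  qed
  have "(\<Sum>i\<in>UNIV. coord D v $ i *s complexify (X (\<sigma> i))) $ m = v $ m" for m
  proof -
    have "(\<Sum>i\<in>UNIV. coord D v $ i *s complexify (X (\<sigma> i))) $ m
        = (\<Sum>i\<in>UNIV. \<Sum>k\<in>UNIV. v $ k * complex_of_real (D i $ k * X (\<sigma> i) $ m))"
      by (simp add: coord_def complexify_def sum_distrib_left sum_distrib_right mult_ac)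
    also have "\<dots> = (\<Sum>k\<in>UNIV. v $ k * complex_of_real (\<Sum>i\<in>UNIV. D i $ k * X (\<sigma> i) $ m))"
      by (subst sum.swap) (simp add: sum_distrib_left)
    also have "\<dots> = (\<Sum>k\<in>UNIV. if k = m then v $ k else 0)"
      unfolding ax by (rule sum.cong) auto
    finally show ?thesis by simp
  qed
  then show ?thesis by (simp add: vec_eq_iff)
qed

lemma pi_C_spread_coord:
  assumes "normal_frame X \<sigma> D" shows "pi_C X (spread \<sigma> 0 (coord D v)) = v"
  using assms combination_coord[OF assms] by (simp add: pi_C_spread normal_frame_def)

lemma coord_pi_C_spread:
  assumes "normal_frame X \<sigma> D" shows "coord D (pi_C X (spread \<sigma> 0 u)) = u"
proof -
  have "inj \<sigma>" using assms by (simp add: normal_frame_def)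
  then show ?thesis using coord_combination[OF assms, where I = UNIV and u = u] by (simp add: pi_C_spread vec_eq_iff)
qed

section \<open>The complex torus and the quasitorus\<close>

definition torus_class :: "complex^'d \<Rightarrow> (complex^'d) set" where
  "torus_class Z = {a + Z |a. \<forall>j. a $ j \<in> \<int>}"

lemma carrier_complex_torus: "carrier complex_torus = range torus_class"
  by (auto simp: complex_torus_def FactGroup_def RCOSETS_def r_coset_def additive_group_def torus_class_def)

lemma torus_class_self: "Z \<in> torus_class Z"
  unfolding torus_class_def by (intro CollectI exI[of _ 0]) auto

text \<open>The representative chosen by \<open>SOME\<close> differs from \<open>Z\<close> by an
  integral vector, on which \<open>cexp\<close> is 1.\<close>

lemma torus_act_torus_class: "torus_act (torus_class Z) z = tact Z z"
proof -
  have "(SOME W. W \<in> torus_class Z) \<in> torus_class Z" using torus_class_self by (rule someI)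
  then obtain a where a: "(SOME W. W \<in> torus_class Z) = a + Z" "\<forall>j. a $ j \<in> \<int>"
    by (auto simp: torus_class_def)
  have "torus_act (torus_class Z) z = (\<chi> j. cexp (a $ j + Z $ j) * z $ j)"
    by (simp add: torus_act_def a(1) cexp_def)
  moreover have "cexp (a $ j) = 1" for j using a(2) by (simp add: cexp_eq_1_iff)
  ultimately show ?thesis by (simp add: tact_def cexp_add)
qed

lemma quasitorus_proj_eq: "quasitorus_proj Q v = (\<lambda>a. a + v) ` complexify ` Q"
  by (auto simp: quasitorus_proj_def r_coset_def additive_group_def)

lemma carrier_quasitorus: "carrier (quasitorus Q) = range (quasitorus_proj Q)"
  by (auto simp: quasitorus_def FactGroup_def RCOSETS_def quasitorus_proj_def additive_group_def)

locale toric_data =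
  fixes X :: "'d::finite \<Rightarrow> real^'n" and Q :: "(real^'n) set"
  assumes Q_add: "a \<in> Q \<Longrightarrow> b \<in> Q \<Longrightarrow> a + b \<in> Q"
    and Q_int: "a \<in> Q \<Longrightarrow> of_int m *\<^sub>R a \<in> Q"
    and X_in_Q: "X j \<in> Q"
begin

definition QC :: "(complex^'n) set" where "QC = complexify ` Q"

lemma QC_add: "a \<in> QC \<Longrightarrow> b \<in> QC \<Longrightarrow> a + b \<in> QC"
  using Q_add by (auto simp: QC_def simp flip: complexify_add)

lemma QC_int: "c \<in> \<int> \<Longrightarrow> a \<in> QC \<Longrightarrow> c *s a \<in> QC"
proof -
  assume "c \<in> \<int>" "a \<in> QC"
  then obtain m q where "c = of_int m" "a = complexify q" "q \<in> Q" by (auto simp: QC_def Ints_def)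
  then have "c *s a = complexify (of_int m *\<^sub>R q)" by (simp add: complexify_scaleR)
  then show ?thesis using Q_int[OF \<open>q \<in> Q\<close>, of m] by (simp add: QC_def)
qed

lemma QC_minus: "a \<in> QC \<Longrightarrow> - a \<in> QC"
  using QC_int[of "-1" a] by (simp add: vector_sneg_minus1[symmetric])

lemma QC_diff: "a \<in> QC \<Longrightarrow> b \<in> QC \<Longrightarrow> a - b \<in> QC"
  using QC_add[of a "- b"] QC_minus[of b] by simp

lemma X_in_QC: "complexify (X j) \<in> QC"
  using X_in_Q by (simp add: QC_def)

text \<open>Any normal witnesses that \<open>QC\<close> is nonempty, and its difference with itself
  is 0.\<close>

lemma QC_0: "0 \<in> QC"
  using QC_diff[OF X_in_QC[of undefined] X_in_QC[of undefined]] by simp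

lemma QC_sum: "(\<And>i. i \<in> I \<Longrightarrow> f i \<in> QC) \<Longrightarrow> (\<Sum>i\<in>I. f i) \<in> QC"
  by (induction I rule: infinite_finite_induct) (auto simp: QC_0 QC_add)

lemma pi_C_int_in_QC: "(\<And>j. a $ j \<in> \<int>) \<Longrightarrow> pi_C X a \<in> QC"
  unfolding pi_C_def by (intro QC_sum QC_int X_in_QC)

lemma quasitorus_proj_eq_iff: "quasitorus_proj Q v = quasitorus_proj Q v' \<longleftrightarrow> v - v' \<in> QC"
proof
  assume "quasitorus_proj Q v = quasitorus_proj Q v'"
  moreover have "v \<in> quasitorus_proj Q v" using QC_0 by (force simp: quasitorus_proj_eq QC_def)
  ultimately obtain a where "a \<in> QC" "v = a + v'" by (auto simp: quasitorus_proj_eq QC_def)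
  then show "v - v' \<in> QC" by simp
next
  have sub: "quasitorus_proj Q a \<subseteq> quasitorus_proj Q b" if "a - b \<in> QC" for a b
  proof
    fix x assume "x \<in> quasitorus_proj Q a"
    then obtain c where c: "c \<in> QC" "x = c + a" by (auto simp: quasitorus_proj_eq QC_def)
    have "x = (c + (a - b)) + b" using c(2) by simp
    moreover have "c + (a - b) \<in> complexify ` Q" using QC_add[OF c(1) that] by (simp add: QC_def)
    ultimately show "x \<in> quasitorus_proj Q b" unfolding quasitorus_proj_eq by blast
  qed
  assume "v - v' \<in> QC"
  moreover from this have "v' - v \<in> QC" using QC_minus[of "v - v'"] by simp
  ultimately show "quasitorus_proj Q v = quasitorus_proj Q v'" by (intro equalityI sub)
qed

text \<open>Representatives of a class differ by an integral vector, which \<open>pi_C\<close> sends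
  to an integral combination of normals and hence into \<open>QC\<close>.\<close>

lemma Pi_C_torus_class: "Pi_C X Q (torus_class Z) = quasitorus_proj Q (pi_C X Z)"
proof -
  have "quasitorus_proj Q (pi_C X W) = quasitorus_proj Q (pi_C X Z)" if W: "W \<in> torus_class Z" for W
  proof -
    obtain a where "W = a + Z" "\<forall>j. a $ j \<in> \<int>" using W by (auto simp: torus_class_def)
    then show ?thesis using pi_C_int_in_QC[of a] by (simp add: quasitorus_proj_eq_iff pi_C_add)
  qed
  then have "Pi_C X Q (torus_class Z) = (\<Union>W\<in>torus_class Z. quasitorus_proj Q (pi_C X Z))"
    unfolding Pi_C_def by (intro SUP_cong refl)
  moreover have "torus_class Z \<noteq> {}" using torus_class_self[of Z] by blast
  ultimately show ?thesis by simp
qed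

lemma one_quasitorus: "\<one>\<^bsub>quasitorus Q\<^esub> = quasitorus_proj Q 0"
  by (simp add: quasitorus_def FactGroup_def quasitorus_proj_eq)

lemma N_C_eq: "N_C X Q = {torus_class Z |Z. pi_C X Z \<in> QC}"
proof -
  have "N_C X Q = {t \<in> range torus_class. Pi_C X Q t = quasitorus_proj Q 0}"
    by (simp add: N_C_def kernel_def carrier_complex_torus one_quasitorus)
  also have "\<dots> = {torus_class Z |Z. Pi_C X Q (torus_class Z) = quasitorus_proj Q 0}" by blast
  finally show ?thesis by (simp add: Pi_C_torus_class quasitorus_proj_eq_iff)
qed

text \<open>From here on \<open>N\<close> is described by exponents with
  \<open>pi_C X Z \<in> QC\<close>, and cosets no longer appear.\<close>

lemma N_orbit_eq: "N_orbit X Q z = {tact Z z |Z. pi_C X Z \<in> QC}"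
proof -
  have "N_orbit X Q z = {torus_act (torus_class Z) z |Z. pi_C X Z \<in> QC}"
    unfolding N_orbit_def N_C_eq by blast
  then show ?thesis by (simp only: torus_act_torus_class)
qed

lemma N_orbit_self: "z \<in> N_orbit X Q z"
  unfolding N_orbit_eq by (intro CollectI exI[of _ 0]) (simp add: QC_0)

lemma N_orbit_eqI: "pi_C X Z \<in> QC \<Longrightarrow> N_orbit X Q (tact Z z) = N_orbit X Q z"
proof (intro equalityI subsetI)
  fix y assume Z: "pi_C X Z \<in> QC"
  { assume "y \<in> N_orbit X Q (tact Z z)"
    then obtain W where "pi_C X W \<in> QC" "y = tact (W + Z) z" by (auto simp: N_orbit_eq tact_tact)
    moreover from this have "pi_C X (W + Z) \<in> QC" using Z by (simp add: pi_C_add QC_add)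
    ultimately show "y \<in> N_orbit X Q z" unfolding N_orbit_eq by blast }
  { assume "y \<in> N_orbit X Q z"
    then obtain W where W: "pi_C X W \<in> QC" "y = tact W z" by (auto simp: N_orbit_eq)
    then have "y = tact (W - Z) (tact Z z)" by (simp add: tact_tact)
    moreover have "pi_C X (W - Z) \<in> QC" using W Z by (simp add: pi_C_diff QC_diff)
    ultimately show "y \<in> N_orbit X Q (tact Z z)" unfolding N_orbit_eq by blast }
qed

lemma N_orbit_eqD:
  assumes "N_orbit X Q z = N_orbit X Q z'" obtains Z where "pi_C X Z \<in> QC" "z' = tact Z z"
proof -
  have "z' \<in> N_orbit X Q z" using N_orbit_self[of z'] assms by simp
  then show ?thesis using that by (auto simp: N_orbit_eq)
qed

text \<open>For a frame, \<open>QC\<close> modulo the integral combinations of the normals at the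
  vertex: these are the elements with integral coordinates, and they become trivial under
  \<open>cexp\<close>.\<close>

definition vertex_group :: "('n \<Rightarrow> real^'n) \<Rightarrow> (complex^'n) set" where
  "vertex_group D = {\<chi> i. cexp (coord D a $ i) |a. a \<in> QC}"

text \<open>All points of an orbit of the vertex group spread to the same \<open>N\<close>-orbit, so
  the union in \<open>qmap\<close> is that single \<open>N\<close>-orbit.\<close>

definition vertex_chart :: "('n \<Rightarrow> 'd) \<Rightarrow> ('n \<Rightarrow> real^'n) \<Rightarrow> ((complex^'d) set, 'n) qchart" where
  "vertex_chart \<sigma> D = \<lparr>qdom = N_orbit X Q ` nzset (- range \<sigma>),
     qmap = (\<lambda>x. \<Union>z\<in>x. N_orbit X Q (spread \<sigma> 1 z)), qcov = UNIV, qgrp = cmul ` vertex_group D\<rparr>"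

section \<open>Orbits of \<open>N\<close> in slice coordinates\<close>

lemma vertex_chart_simps [simp]:
  "qdom (vertex_chart \<sigma> D) = N_orbit X Q ` nzset (- range \<sigma>)"
  "qcov (vertex_chart \<sigma> D) = UNIV" "qgrp (vertex_chart \<sigma> D) = cmul ` vertex_group D"
  by (simp_all add: vertex_chart_def)

lemma vertex_group_model:
  "pre_model (open_mfd (nzset J)) ((\<lambda>g. restrict (cmul g) (nzset J)) ` vertex_group D)"
proof (rule pre_model_diagonal)
  show "g $ i \<noteq> 0" if "g \<in> vertex_group D" for g i using that by (auto simp: vertex_group_def)
  have "(\<chi> i. cexp (coord D 0 $ i)) = (\<chi> i. 1)" by (simp add: vec_eq_iff)
  moreover have "(\<chi> i. cexp (coord D 0 $ i)) \<in> vertex_group D" using QC_0 unfolding vertex_group_def by blast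
  ultimately show "(\<chi> i. 1) \<in> vertex_group D" by simp
  show "cmul g h \<in> vertex_group D" if gh: "g \<in> vertex_group D" "h \<in> vertex_group D" for g h
  proof -
    obtain a b where ab: "a \<in> QC" "b \<in> QC" "g = (\<chi> i. cexp (coord D a $ i))" "h = (\<chi> i. cexp (coord D b $ i))"
      using gh by (auto simp: vertex_group_def)
    then have "cmul g h = (\<chi> i. cexp (coord D (a + b) $ i))" by (simp add: cmul_def coord_add cexp_add)
    then show ?thesis using QC_add[OF ab(1,2)] by (auto simp: vertex_group_def)
  qed
  show "\<exists>h\<in>vertex_group D. cmul h g = (\<chi> i. 1)" if g: "g \<in> vertex_group D" for g
  proof -
    obtain a where a: "a \<in> QC" "g = (\<chi> i. cexp (coord D a $ i))" using g by (auto simp: vertex_group_def)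
    have "coord D (- a) = - coord D a" using coord_diff[of D 0 a] by simp
    then have "cmul (\<chi> i. cexp (coord D (- a) $ i)) g = (\<chi> i. 1)" by (simp add: cmul_def a(2))
    moreover have "(\<chi> i. cexp (coord D (- a) $ i)) \<in> vertex_group D"
      using QC_minus[OF a(1)] by (auto simp: vertex_group_def)
    ultimately show ?thesis by blast
  qed
qed

lemma vertex_chart_model: "complex_model (open_mfd (qcov (vertex_chart \<sigma> D))) (qgrp (vertex_chart \<sigma> D))"
  using vertex_group_model[of "{}" D] simply_connected_space_euclidean
  by (simp add: complex_model_def nzset_def restrict_def)

lemma vertex_group_subgroup: "subgroup (cmul ` vertex_group D) (BijGroup UNIV)"
  using vertex_chart_model by (simp add: complex_model_def pre_model_open_mfd_iff)

lemma spread_cmul: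
  assumes "inj \<sigma>"
  shows "spread \<sigma> 1 (cmul (\<chi> i. cexp (u $ i)) z) = tact (spread \<sigma> 0 u) (spread \<sigma> 1 z)"
  using assms by (auto simp: vec_eq_iff spread_def tact_def cmul_def)

text \<open>The group element of \<open>a\<close> acts on the slice by the exponent that has the
  frame coordinates of \<open>a\<close> at the vertex and 0 elsewhere. Its image under
  \<open>pi_C\<close> is \<open>a\<close>, so it belongs to \<open>N\<close>.\<close>

lemma N_orbit_spread_vertex_group:
  assumes fr: "normal_frame X \<sigma> D" and g: "g \<in> vertex_group D"
  shows "N_orbit X Q (spread \<sigma> 1 (cmul g z)) = N_orbit X Q (spread \<sigma> 1 z)"
proof -
  obtain a where a: "a \<in> QC" "g = (\<chi> i. cexp (coord D a $ i))" using g by (auto simp: vertex_group_def)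
  have "inj \<sigma>" using fr by (simp add: normal_frame_def)
  then have "spread \<sigma> 1 (cmul g z) = tact (spread \<sigma> 0 (coord D a)) (spread \<sigma> 1 z)"
    unfolding a(2) by (rule spread_cmul)
  then show ?thesis using a(1) pi_C_spread_coord[OF fr] by (simp add: N_orbit_eqI)
qed

lemma qparam_vertex_chart:
  assumes fr: "normal_frame X \<sigma> D"
  shows "qparam (vertex_chart \<sigma> D) z = N_orbit X Q (spread \<sigma> 1 z)"
proof -
  have "qparam (vertex_chart \<sigma> D) z = (\<Union>g\<in>vertex_group D. N_orbit X Q (spread \<sigma> 1 (cmul g z)))"
    by (simp add: qparam_def vertex_chart_def tg_orbit_def)
  also have "\<dots> = (\<Union>g\<in>vertex_group D. N_orbit X Q (spread \<sigma> 1 z))"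
    using N_orbit_spread_vertex_group[OF fr] by simp
  moreover have "vertex_group D \<noteq> {}" using QC_0 by (auto simp: vertex_group_def)
  ultimately show ?thesis by simp
qed

text \<open>Both slice points have coordinates 1 outside \<open>range \<sigma>\<close>, so the
  exponents there are integers. Dropping them changes the value of \<open>pi_C\<close> only within
  \<open>QC\<close>, and what remains acts as an element of the vertex group.\<close>

lemma N_orbit_spread_inj:
  assumes fr: "normal_frame X \<sigma> D" and eq: "N_orbit X Q (spread \<sigma> 1 z) = N_orbit X Q (spread \<sigma> 1 z')"
  shows "\<exists>g\<in>vertex_group D. z' = cmul g z"
proof -
  obtain Z where Z: "pi_C X Z \<in> QC" "spread \<sigma> 1 z' = tact Z (spread \<sigma> 1 z)" using N_orbit_eqD[OF eq] .
  have inj: "inj \<sigma>" using fr by (simp add: normal_frame_def)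
  have nth: "spread \<sigma> 1 z' $ j = cexp (Z $ j) * spread \<sigma> 1 z $ j" for j using Z(2) by (simp add: tact_def)
  define u where "u = (\<chi> i. Z $ \<sigma> i)"
  have "(Z - spread \<sigma> 0 u) $ j \<in> \<int>" for j
  proof (cases "j \<in> range \<sigma>")
    case True
    then show ?thesis using inj by (auto simp: u_def)
  next
    case False
    then have "cexp (Z $ j) = 1" using nth[of j] by simp
    then show ?thesis using False by (simp add: cexp_eq_1_iff)
  qed
  then have "pi_C X Z - pi_C X (spread \<sigma> 0 u) \<in> QC" using pi_C_int_in_QC[of "Z - spread \<sigma> 0 u"] by (simp add: pi_C_diff)
  then have a: "pi_C X (spread \<sigma> 0 u) \<in> QC" using QC_diff[OF Z(1)] by fastforce
  have "z' $ i = cexp (u $ i) * z $ i" for i using nth[of "\<sigma> i"] inj by (simp add: u_def)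
  then have "z' = cmul (\<chi> i. cexp (coord D (pi_C X (spread \<sigma> 0 u)) $ i)) z"
    by (simp add: vec_eq_iff cmul_def coord_pi_C_spread[OF fr])
  then show ?thesis using a unfolding vertex_group_def by blast
qed

text \<open>A point of the chart domain is moved by \<open>N\<close> into the slice where the coordinates outside
  \<open>range \<sigma>\<close> are \<open>1\<close>; on logarithmic coordinates this is the following map.\<close>

definition slice :: "('n \<Rightarrow> 'd) \<Rightarrow> ('n \<Rightarrow> real^'n) \<Rightarrow> complex^'d \<Rightarrow> complex^'n" where
  "slice \<sigma> D y = (\<chi> i. y $ \<sigma> i * cexp (coord D (pi_C X (\<chi> j. if j \<in> range \<sigma> then 0 else y $ j)) $ i))"

lemma N_orbit_slice:
  assumes fr: "normal_frame X \<sigma> D"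
  shows "N_orbit X Q (spread \<sigma> 1 (slice \<sigma> D y)) = N_orbit X Q (pexp (- range \<sigma>) y)"
proof -
  have inj: "inj \<sigma>" using fr by (simp add: normal_frame_def)
  define b :: "complex^'d" where "b = (\<chi> j. if j \<in> range \<sigma> then 0 else y $ j)"
  \<comment> \<open>Subtracting \<open>b\<close> turns the coordinates outside
    \<open>range \<sigma>\<close> into 1. The first term makes up for its image under
    \<open>pi_C\<close> at the vertex, which puts \<open>Z\<close> into the kernel.\<close>
  define Z where "Z = spread \<sigma> 0 (coord D (pi_C X b)) - b"
  have "pi_C X Z = 0" by (simp add: Z_def pi_C_diff pi_C_spread_coord[OF fr])
  moreover have "spread \<sigma> 1 (slice \<sigma> D y) = tact Z (pexp (- range \<sigma>) y)"
  proof -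
    have "spread \<sigma> 1 (slice \<sigma> D y) $ j = tact Z (pexp (- range \<sigma>) y) $ j" for j
    proof (cases "j \<in> range \<sigma>")
      case True
      then obtain i where "j = \<sigma> i" by blast
      then show ?thesis using inj by (simp add: slice_def tact_def pexp_def Z_def b_def[symmetric]) (simp add: b_def)
    next
      case False
      then show ?thesis by (simp add: tact_def pexp_def Z_def b_def)
    qed
    then show ?thesis by (simp add: vec_eq_iff)
  qed
  ultimately show ?thesis using QC_0 by (simp add: N_orbit_eqI)
qed

lemma continuous_on_slice: "continuous_on S (slice \<sigma> D)"
proof (rule cdiff_at_imp_continuous_on)
  fix z
  have b: "cdiff_at (\<lambda>y. pi_C X (\<chi> j. if j \<in> range \<sigma> then 0 else y $ j)) z"
  proof -
    have "cdiff_at1 (\<lambda>y. (if j \<in> range \<sigma> then 0 else y $ j) * complex_of_real (X j $ m)) z" for j m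
      by (cases "j \<in> range \<sigma>") (simp_all add: cdiff_at1_mult)
    then show ?thesis by (simp add: cdiff_at_iff_components pi_C_nth cdiff_at1_sum)
  qed
  have "cdiff_at1 (\<lambda>y. slice \<sigma> D y $ i) z" for i
    unfolding slice_def by (simp add: cdiff_at1_mult cdiff_at1_cexp cdiff_at1_coord[OF b])
  then show "cdiff_at (slice \<sigma> D) z" by (simp add: cdiff_at_iff_components)
qed

section \<open>The transition maps\<close>

text \<open>On the overlap, the coordinates \<open>u $ i\<close> with \<open>\<sigma> i \<notin> range \<tau>\<close> are logarithmic, and the point with
  these coordinates is returned to the slice for \<open>\<tau>\<close> by the element of \<open>N\<close> with exponents \<open>- u $ i\<close> at
  these \<open>\<sigma> i\<close> and \<open>coord D x $ k\<close> at \<open>\<tau> k\<close>.\<close>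

definition transition :: "('n \<Rightarrow> 'd) \<Rightarrow> ('n \<Rightarrow> 'd) \<Rightarrow> ('n \<Rightarrow> real^'n) \<Rightarrow> complex^'n \<Rightarrow> complex^'n" where
  "transition \<sigma> \<tau> D u = (let x = \<Sum>i\<in>{i. \<sigma> i \<notin> range \<tau>}. u $ i *s complexify (X (\<sigma> i)) in
     \<chi> k. if \<tau> k \<in> range \<sigma> then u $ inv_into UNIV \<sigma> (\<tau> k) * cexp (coord D x $ k) else coord D x $ k)"

lemma cdiff_at_transition: "cdiff_at (transition \<sigma> \<tau> D) z"
proof -
  let ?x = "\<lambda>u :: complex^'n. \<Sum>i\<in>{i. \<sigma> i \<notin> range \<tau>}. u $ i *s complexify (X (\<sigma> i))"
  have "cdiff_at ?x z" by (simp add: cdiff_at_iff_components cdiff_at1_sum cdiff_at1_mult)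
  note c = cdiff_at1_coord[OF this, of D]
  have "cdiff_at1 (\<lambda>y. transition \<sigma> \<tau> D y $ k) z" for k
    using c[of k] by (cases "\<tau> k \<in> range \<sigma>") (simp_all add: transition_def Let_def cdiff_at1_mult cdiff_at1_cexp)
  then show ?thesis by (simp add: cdiff_at_iff_components)
qed

text \<open>The exponent \<open>Z\<close> removes the logarithmic coordinates, which represent the
  vector \<open>x\<close> in the frame of \<open>\<sigma>\<close>, and puts the same vector back in
  the frame of \<open>\<tau>\<close>; hence \<open>pi_C X Z = 0\<close>.\<close>

lemma N_orbit_transition:
  assumes fr: "normal_frame X \<sigma> D" and fr': "normal_frame X \<tau> D'"
  shows "N_orbit X Q (spread \<tau> 1 (pexp {k. \<tau> k \<notin> range \<sigma>} (transition \<sigma> \<tau> D' u)))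
       = N_orbit X Q (spread \<sigma> 1 (pexp {i. \<sigma> i \<notin> range \<tau>} u))"
proof -
  have inj: "inj \<sigma>" "inj \<tau>" using fr fr' by (simp_all add: normal_frame_def)
  define J where "J = {i. \<sigma> i \<notin> range \<tau>}"
  define x where "x = (\<Sum>i\<in>J. u $ i *s complexify (X (\<sigma> i)))"
  define u' :: "complex^'n" where "u' = (\<chi> i. if i \<in> J then u $ i else 0)"
  define Z where "Z = spread \<tau> 0 (coord D' x) - spread \<sigma> 0 u'"
  have "pi_C X (spread \<sigma> 0 u') = (\<Sum>i\<in>UNIV. if i \<in> J then u $ i *s complexify (X (\<sigma> i)) else 0)"
    unfolding pi_C_spread[OF inj(1)] by (rule sum.cong) (auto simp: u'_def)
  also have "\<dots> = x" by (simp add: x_def sum.If_cases)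
  finally have "pi_C X Z = 0" by (simp add: Z_def pi_C_diff pi_C_spread_coord[OF fr'])
  moreover have "spread \<tau> 1 (pexp {k. \<tau> k \<notin> range \<sigma>} (transition \<sigma> \<tau> D' u)) $ j = tact Z (spread \<sigma> 1 (pexp J u)) $ j" for j
  proof -
    have t: "transition \<sigma> \<tau> D' u $ k = (if \<tau> k \<in> range \<sigma> then u $ inv_into UNIV \<sigma> (\<tau> k) * cexp (coord D' x $ k) else coord D' x $ k)" for k
      by (simp add: transition_def Let_def x_def J_def)
    \<comment> \<open>A facet through both vertices keeps its coordinate up to the factor from
      \<open>\<tau>\<close>. A facet through only one of them exchanges a slice value 1 for an
      exponential, and a facet through neither keeps the value 1.\<close>
    consider i k where "j = \<tau> k" "j = \<sigma> i" | k where "j = \<tau> k" "j \<notin> range \<sigma>"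
      | i where "j = \<sigma> i" "j \<notin> range \<tau>" | "j \<notin> range \<sigma>" "j \<notin> range \<tau>" by blast
    then show ?thesis
    proof cases
      case 1
      have "i \<notin> J" using 1 by (auto simp: J_def)
      moreover have "\<tau> k \<in> range \<sigma>" "inv_into UNIV \<sigma> (\<tau> k) = i" using 1 inj by (auto simp flip: 1(1) simp: 1(2))
      moreover have "spread \<tau> b v $ j = v $ k" "spread \<sigma> b v $ j = v $ i" for b v
        using inj by (simp_all add: 1(1)) (simp add: 1(2) flip: 1(1))
      ultimately show ?thesis by (simp add: pexp_def t tact_def Z_def u'_def)
    next
      case 2
      then have "\<tau> k \<notin> range \<sigma>" by simp
      moreover have "spread \<tau> b v $ j = v $ k" "spread \<sigma> b v $ j = b" for b v
        using inj 2 by simp_all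
      ultimately show ?thesis by (simp add: pexp_def t tact_def Z_def)
    next
      case 3
      then have "i \<in> J" by (auto simp: J_def)
      moreover have "spread \<tau> b v $ j = b" "spread \<sigma> b v $ j = v $ i" for b v
        using inj 3 by simp_all
      ultimately show ?thesis by (simp add: pexp_def tact_def Z_def u'_def)
    next
      case 4
      then show ?thesis by (simp add: tact_def Z_def)
    qed
  qed
  then have "spread \<tau> 1 (pexp {k. \<tau> k \<notin> range \<sigma>} (transition \<sigma> \<tau> D' u)) = tact Z (spread \<sigma> 1 (pexp J u))"
    by (simp add: vec_eq_iff)
  ultimately show ?thesis using QC_0 by (simp add: N_orbit_eqI J_def)
qed

text \<open>Expand \<open>x\<close> in the frame of \<open>\<tau>\<close>. The terms whose normals
  are not in the frame of \<open>\<sigma>\<close> form the vector \<open>x'\<close> of the new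
  logarithmic coordinates; the other terms use normals common to both frames. So in the frame of
  \<open>\<sigma>\<close> the vector \<open>x'\<close> has the old logarithmic coordinates and, at
  the common normals, the negatives of the exponents used before.\<close>

lemma transition_inverse:
  assumes fr: "normal_frame X \<sigma> D" and fr': "normal_frame X \<tau> D'"
  shows "transition \<tau> \<sigma> D (transition \<sigma> \<tau> D' u) = u"
proof -
  have inj: "inj \<sigma>" "inj \<tau>" using fr fr' by (simp_all add: normal_frame_def)
  define J where "J = {i. \<sigma> i \<notin> range \<tau>}"
  define K where "K = {k. \<tau> k \<notin> range \<sigma>}"
  define x where "x = (\<Sum>i\<in>J. u $ i *s complexify (X (\<sigma> i)))"
  define v where "v = transition \<sigma> \<tau> D' u"
  have v: "v $ k = (if \<tau> k \<in> range \<sigma> then u $ inv_into UNIV \<sigma> (\<tau> k) * cexp (coord D' x $ k) else coord D' x $ k)" for k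
    by (simp add: v_def transition_def Let_def x_def J_def)
  define x' where "x' = (\<Sum>k\<in>K. v $ k *s complexify (X (\<tau> k)))"
  \<comment> \<open>The coefficients of \<open>x\<close> at the common normals, renumbered from
    \<open>\<tau>\<close> to \<open>\<sigma>\<close>.\<close>
  define r :: "complex^'n" where "r = (\<chi> i. if i \<in> J then 0 else coord D' x $ inv_into UNIV \<tau> (\<sigma> i))"
  have "x = (\<Sum>k\<in>UNIV. coord D' x $ k *s complexify (X (\<tau> k)))" using combination_coord[OF fr'] by simp
  also have "\<dots> = (\<Sum>k\<in>K. coord D' x $ k *s complexify (X (\<tau> k))) + (\<Sum>k\<in>- K. coord D' x $ k *s complexify (X (\<tau> k)))"
    by (subst sum.union_disjoint[symmetric]) auto
  also have "(\<Sum>k\<in>K. coord D' x $ k *s complexify (X (\<tau> k))) = x'"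
    unfolding x'_def by (rule sum.cong) (auto simp: v K_def)
  also have "(\<Sum>k\<in>- K. coord D' x $ k *s complexify (X (\<tau> k))) = (\<Sum>i\<in>- J. r $ i *s complexify (X (\<sigma> i)))"
  proof (rule sum.reindex_bij_witness[of _ "\<lambda>i. inv_into UNIV \<tau> (\<sigma> i)" "\<lambda>k. inv_into UNIV \<sigma> (\<tau> k)"])
    fix k assume "k \<in> - K"
    then obtain i where i: "\<tau> k = \<sigma> i" by (auto simp: K_def)
    have e: "inv_into UNIV \<sigma> (\<tau> k) = i" "inv_into UNIV \<tau> (\<sigma> i) = k"
      using inj by (simp add: i) (simp add: inj flip: i)
    have "\<sigma> i \<in> range \<tau>" using i[symmetric] by simp
    then show "inv_into UNIV \<tau> (\<sigma> (inv_into UNIV \<sigma> (\<tau> k))) = k" "inv_into UNIV \<sigma> (\<tau> k) \<in> - J"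
      "r $ inv_into UNIV \<sigma> (\<tau> k) *s complexify (X (\<sigma> (inv_into UNIV \<sigma> (\<tau> k)))) = coord D' x $ k *s complexify (X (\<tau> k))"
      by (simp_all add: e J_def r_def) (simp add: i)
  next
    fix i assume "i \<in> - J"
    then obtain k where k: "\<sigma> i = \<tau> k" by (auto simp: J_def)
    have e: "inv_into UNIV \<tau> (\<sigma> i) = k" "inv_into UNIV \<sigma> (\<tau> k) = i"
      using inj by (simp add: k) (simp add: inj flip: k)
    have "\<tau> k \<in> range \<sigma>" using k[symmetric] by simp
    then show "inv_into UNIV \<sigma> (\<tau> (inv_into UNIV \<tau> (\<sigma> i))) = i" "inv_into UNIV \<tau> (\<sigma> i) \<in> - K"
      by (simp_all add: e K_def)
  qed
  finally have "x' = x - (\<Sum>i\<in>- J. r $ i *s complexify (X (\<sigma> i)))" by simp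
  \<comment> \<open>On \<open>J\<close> this returns the original logarithms. Off \<open>J\<close>
    it is minus the exponent of the first transition, so that the two exponential factors
    cancel.\<close>
  then have cx': "coord D x' $ i = (if i \<in> J then u $ i else 0) - (if i \<in> - J then r $ i else 0)" for i
    using coord_combination[OF fr, where I = J and u = u and k = i]
      coord_combination[OF fr, where I = "- J" and u = r and k = i]
    by (simp add: coord_diff x_def)
  have "transition \<tau> \<sigma> D v $ i = u $ i" for i
  proof (cases "i \<in> J")
    case True
    then have "\<sigma> i \<notin> range \<tau>" by (simp add: J_def)
    then show ?thesis using True cx'[of i] by (simp add: transition_def Let_def x'_def K_def)
  next
    case False
    then obtain k where k: "\<sigma> i = \<tau> k" by (auto simp: J_def)
    have "\<sigma> i \<in> range \<tau>" "inv_into UNIV \<tau> (\<sigma> i) = k" using inj by (simp_all add: k)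
    moreover have "\<tau> k \<in> range \<sigma>" "inv_into UNIV \<sigma> (\<tau> k) = i" using inj by (simp_all flip: k)
    ultimately have "transition \<tau> \<sigma> D v $ i = v $ k * cexp (coord D x' $ i)" "v $ k = u $ i * cexp (coord D' x $ k)"
      "coord D x' $ i = - coord D' x $ k"
      using False cx'[of i] by (simp_all add: transition_def Let_def x'_def K_def v r_def)
    then show ?thesis by simp
  qed
  then show ?thesis by (simp add: v_def vec_eq_iff)
qed

end

section \<open>The quasitorus\<close>

context toric_data
begin

lemma mult_quasitorus:
  "quasitorus_proj Q a \<otimes>\<^bsub>quasitorus Q\<^esub> quasitorus_proj Q b = quasitorus_proj Q (a + b)"
proof -
  have "quasitorus_proj Q a \<otimes>\<^bsub>quasitorus Q\<^esub> quasitorus_proj Q b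
      = {x + y |x y. x \<in> quasitorus_proj Q a \<and> y \<in> quasitorus_proj Q b}"
    by (auto simp: quasitorus_def FactGroup_def set_mult_def additive_group_def)
  also have "\<dots> = quasitorus_proj Q (a + b)"
  proof (intro equalityI subsetI)
    fix z assume "z \<in> {x + y |x y. x \<in> quasitorus_proj Q a \<and> y \<in> quasitorus_proj Q b}"
    then obtain c d where cd: "c \<in> QC" "d \<in> QC" "z = (c + a) + (d + b)" by (auto simp: quasitorus_proj_eq QC_def)
    have "z = (c + d) + (a + b)" using cd(3) by simp
    moreover have "c + d \<in> complexify ` Q" using QC_add[OF cd(1,2)] by (simp add: QC_def)
    ultimately show "z \<in> quasitorus_proj Q (a + b)" unfolding quasitorus_proj_eq by blast
  next
    fix z assume "z \<in> quasitorus_proj Q (a + b)"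
    then obtain c where c: "c \<in> complexify ` Q" "z = c + (a + b)" by (auto simp: quasitorus_proj_eq)
    have "z = (c + a) + (0 + b)" using c(2) by simp
    moreover have "c + a \<in> quasitorus_proj Q a" "0 + b \<in> quasitorus_proj Q b"
      using c(1) QC_0 unfolding quasitorus_proj_eq QC_def by blast+
    ultimately show "z \<in> {x + y |x y. x \<in> quasitorus_proj Q a \<and> y \<in> quasitorus_proj Q b}" by blast
  qed
  finally show ?thesis .
qed

lemma group_quasitorus: "group (quasitorus Q)"
proof (rule groupI)
  fix x assume "x \<in> carrier (quasitorus Q)"
  then obtain a where x: "x = quasitorus_proj Q a" by (auto simp: carrier_quasitorus)
  show "\<one>\<^bsub>quasitorus Q\<^esub> \<otimes>\<^bsub>quasitorus Q\<^esub> x = x" by (simp add: x one_quasitorus mult_quasitorus)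
  have "quasitorus_proj Q (- a) \<otimes>\<^bsub>quasitorus Q\<^esub> x = \<one>\<^bsub>quasitorus Q\<^esub>"
    by (simp add: x one_quasitorus mult_quasitorus)
  then show "\<exists>y\<in>carrier (quasitorus Q). y \<otimes>\<^bsub>quasitorus Q\<^esub> x = \<one>\<^bsub>quasitorus Q\<^esub>"
    by (intro bexI[of _ "quasitorus_proj Q (- a)"]) (auto simp: carrier_quasitorus)
qed (auto simp: carrier_quasitorus one_quasitorus mult_quasitorus add.assoc)

lemma quasitorus_chart_simps [simp]:
  "qdom (quasitorus_chart Q) = range (quasitorus_proj Q)" "qcov (quasitorus_chart Q) = UNIV"
  "qgrp (quasitorus_chart Q) = (\<lambda>a z. z + a) ` QC" "qmap (quasitorus_chart Q) = (\<lambda>x. x)"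
  by (auto simp: quasitorus_chart_def carrier_quasitorus QC_def)

lemma qparam_quasitorus_chart: "qparam (quasitorus_chart Q) v = quasitorus_proj Q v"
  by (auto simp: qparam_def tg_orbit_def quasitorus_proj_eq QC_def add.commute)

lemma topspace_quasitorus_space: "topspace (quasitorus_space Q) = range (quasitorus_proj Q)"
  by (simp add: quasitorus_space_def)

text \<open>A translation with a fixed point is the identity, so every point is free.\<close>

lemma translation_model: "complex_model (open_mfd UNIV) ((\<lambda>a z. z + a) ` QC)"
proof -
  let ?\<Gamma> = "(\<lambda>a z. z + a) ` QC"
  have "subgroup ?\<Gamma> (BijGroup UNIV)"
    unfolding subgroup_BijGroup_iff
  proof (intro conjI ballI subsetI)
    fix f assume "f \<in> ?\<Gamma>"
    then obtain a where a: "a \<in> QC" "f = (\<lambda>z. z + a)" by blast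
    have "bij f" unfolding a(2) by (rule bij_betw_byWitness[where f' = "\<lambda>z. z - a"]) auto
    then show "f \<in> Bij UNIV" by (simp add: Bij_def)
    have "compose UNIV (\<lambda>z. z + - a) f = (\<lambda>x\<in>UNIV. x)" by (auto simp: compose_def a(2))
    moreover have "(\<lambda>z. z + - a) \<in> ?\<Gamma>" using QC_minus[OF a(1)] by blast
    ultimately show "\<exists>h\<in>?\<Gamma>. compose UNIV h f = (\<lambda>x\<in>UNIV. x)" by blast
  next
    have "(\<lambda>z. z + 0) \<in> ?\<Gamma>" using QC_0 by (rule imageI)
    then show "(\<lambda>x\<in>UNIV. x) \<in> ?\<Gamma>" by (simp add: restrict_def)
  next
    fix f g assume "f \<in> ?\<Gamma>" "g \<in> ?\<Gamma>"
    then obtain a b where ab: "a \<in> QC" "b \<in> QC" "f = (\<lambda>z. z + a)" "g = (\<lambda>z. z + b)" by blast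
    then have "compose UNIV f g = (\<lambda>z. z + (b + a))" by (auto simp: compose_def add.assoc)
    then show "compose UNIV f g \<in> ?\<Gamma>" using QC_add[OF ab(2,1)] by simp
  qed
  moreover have "free_points UNIV ?\<Gamma> = UNIV"
    by (auto simp: free_points_def restrict_def)
  moreover have "cdiff_at (\<lambda>z. z + a) z" for a z :: "complex^'n"
    by (simp add: cdiff_at_iff_components cdiff_at1_add)
  ultimately show ?thesis
    by (auto simp: complex_model_def pre_model_open_mfd_iff simply_connected_space_euclidean)
qed

lemma quasifold_chart_quasitorus: "quasifold_chart (quasitorus_space Q) (quasitorus_chart Q)"
proof (rule quasifold_chartI)
  have top: "topspace (quasitorus_space Q) = range (quasitorus_proj Q)" by (rule topspace_quasitorus_space)
  show "openin (quasitorus_space Q) (qdom (quasitorus_chart Q))"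
    using openin_topspace[of "quasitorus_space Q"] by (simp add: top)
  show "complex_model (open_mfd (qcov (quasitorus_chart Q))) (qgrp (quasitorus_chart Q))"
    using translation_model by simp
  have qp: "qparam (quasitorus_chart Q) = quasitorus_proj Q" by (rule ext) (rule qparam_quasitorus_chart)
  show "continuous_map (top_of_set (qcov (quasitorus_chart Q))) (quasitorus_space Q) (qparam (quasitorus_chart Q))"
    using quotient_imp_continuous_map[OF quotient_map_quotient_topology[of euclidean "quasitorus_proj Q"]]
    by (simp add: qp quasitorus_space_def)
  show "qparam (quasitorus_chart Q) ` qcov (quasitorus_chart Q) = qdom (quasitorus_chart Q)" by (simp add: qp)
  show "qproj (quasitorus_chart Q) z = qproj (quasitorus_chart Q) z'"
    if "qparam (quasitorus_chart Q) z = qparam (quasitorus_chart Q) z'" for z z'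
    using that by (simp add: qparam_def)
  fix U :: "(complex^'n) set" assume U: "open U"
  \<comment> \<open>The saturation of an open set is a union of its translates and hence
    open.\<close>
  have "{v. quasitorus_proj Q v \<in> quasitorus_proj Q ` U} = (\<Union>a\<in>QC. (\<lambda>v. v + a) -` U)" (is "?L = ?R")
  proof (intro equalityI subsetI)
    fix v assume "v \<in> ?L"
    then obtain u where u: "u \<in> U" "u - v \<in> QC" by (auto simp: quasitorus_proj_eq_iff) (metis QC_minus minus_diff_eq)
    then have "v + (u - v) \<in> U" by simp
    then show "v \<in> ?R" using u(2) by blast
  next
    fix v assume "v \<in> ?R"
    then obtain a where a: "a \<in> QC" "v + a \<in> U" by blast
    then have "quasitorus_proj Q v = quasitorus_proj Q (v + a)" using QC_minus by (simp add: quasitorus_proj_eq_iff)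
    then show "v \<in> ?L" using a(2) by blast
  qed
  moreover have "open ((\<lambda>v. v + a) -` U)" for a using U by (intro open_vimage continuous_intros)
  ultimately have "open {v. quasitorus_proj Q v \<in> quasitorus_proj Q ` U}" by auto
  then show "openin (quasitorus_space Q) (qparam (quasitorus_chart Q) ` U)"
    by (auto simp: qp quasitorus_space_def openin_quotient_topology)
qed

lemma quasitorus_quasifold_exists: obtains B where "quasitorus_quasifold Q B"
proof -
  obtain B where "{quasitorus_chart Q} \<subseteq> B" "complex_quasifold (quasitorus_space Q) B"
  proof (rule maximal_atlas_exists[of "{quasitorus_chart Q}" "quasitorus_space Q"])
    show "topspace (quasitorus_space Q) \<subseteq> (\<Union>c\<in>{quasitorus_chart Q}. qdom c)"
      by (simp add: topspace_quasitorus_space)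
  qed (use quasifold_chart_quasitorus compatible_charts_refl[OF quasifold_chart_quasitorus] in auto)
  then show ?thesis using that by (auto simp: quasitorus_quasifold_def)
qed

text \<open>Torus elements over the same quasitorus element differ by \<open>N\<close>, so the union
  of all translates of the orbit is a single \<open>N\<close>-orbit.\<close>

lemma induced_act_N_orbit:
  "induced_act X Q (quasitorus_proj Q (pi_C X Z)) (N_orbit X Q z) = N_orbit X Q (tact Z z)"
proof -
  have "induced_act X Q (quasitorus_proj Q (pi_C X Z)) (N_orbit X Q z)
     = {torus_act (torus_class W) y |W y. Pi_C X Q (torus_class W) = quasitorus_proj Q (pi_C X Z) \<and> y \<in> N_orbit X Q z}"
    unfolding induced_act_def carrier_complex_torus by blast
  also have "\<dots> = {tact W y |W y. pi_C X (W - Z) \<in> QC \<and> y \<in> N_orbit X Q z}"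
    by (simp only: torus_act_torus_class Pi_C_torus_class quasitorus_proj_eq_iff pi_C_diff)
  also have "\<dots> = N_orbit X Q (tact Z z)"
  proof (intro equalityI subsetI)
    fix x assume "x \<in> {tact W y |W y. pi_C X (W - Z) \<in> QC \<and> y \<in> N_orbit X Q z}"
    then obtain W V where WV: "pi_C X (W - Z) \<in> QC" "pi_C X V \<in> QC" "x = tact W (tact V z)"
      by (auto simp: N_orbit_eq)
    have "x = tact ((W - Z) + V) (tact Z z)" using WV(3) by (simp add: tact_tact)
    moreover have "pi_C X ((W - Z) + V) \<in> QC" unfolding pi_C_add[of X "W - Z"] by (rule QC_add[OF WV(1,2)])
    ultimately show "x \<in> N_orbit X Q (tact Z z)" unfolding N_orbit_eq by blast
  next
    fix x assume "x \<in> N_orbit X Q (tact Z z)"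
    then obtain V where V: "pi_C X V \<in> QC" "x = tact V (tact Z z)" by (auto simp: N_orbit_eq)
    then have "x = tact (V + Z) z" "pi_C X ((V + Z) - Z) \<in> QC" by (simp_all add: tact_tact)
    then show "x \<in> {tact W y |W y. pi_C X (W - Z) \<in> QC \<and> y \<in> N_orbit X Q z}"
      using N_orbit_self by blast
  qed
  finally show ?thesis .
qed

end

section \<open>The quasifold\<close>

text \<open>What the construction retains of the polytope: a nonempty family of frames, one or more
  for each vertex, whose chart domains cover \<open>C\<close>.\<close>

locale toric_atlas = toric_data X Q for X :: "'d::finite \<Rightarrow> real^'n" and Q +
  fixes S :: "(('n \<Rightarrow> 'd) \<times> ('n \<Rightarrow> real^'n)) set" and C :: "(complex^'d) set"
  assumes S_nonempty: "S \<noteq> {}" and frame: "(\<sigma>, D) \<in> S \<Longrightarrow> normal_frame X \<sigma> D"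
    and C_eq: "C = (\<Union>(\<sigma>, D)\<in>S. nzset (- range \<sigma>))"
begin

definition toric_space :: "(complex^'d) set topology" where
  "toric_space = quotient_topology (top_of_set C) (N_orbit X Q)"

lemma nzset_subset_C: "(\<sigma>, D) \<in> S \<Longrightarrow> nzset (- range \<sigma>) \<subseteq> C"
  unfolding C_eq by blast

lemma open_C: "open C"
  unfolding C_eq by (auto intro!: open_UN open_nzset)

lemma tact_in_C [simp]: "tact Z z \<in> C \<longleftrightarrow> z \<in> C"
  unfolding C_eq by (auto simp: case_prod_unfold)

lemma spread_in_nzset [simp]: "spread \<sigma> 1 z \<in> nzset (- range \<sigma>)"
  by (simp add: nzset_def spread_def)

lemma nzset_UNIV_subset_C: "nzset UNIV \<subseteq> C"
proof -
  obtain \<sigma> D where s: "(\<sigma>, D) \<in> S" using S_nonempty by auto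
  have "nzset UNIV \<subseteq> nzset (- range \<sigma>)" by (auto simp: nzset_def)
  then show ?thesis using nzset_subset_C[OF s] by blast
qed

lemma topspace_toric_space: "topspace toric_space = N_orbit X Q ` C"
  by (simp add: toric_space_def)

lemma continuous_map_N_orbit: "continuous_map (top_of_set C) toric_space (N_orbit X Q)"
  unfolding toric_space_def by (rule quotient_imp_continuous_map[OF quotient_map_quotient_topology])

lemma openin_toric_space_iff: "openin toric_space U \<longleftrightarrow> U \<subseteq> N_orbit X Q ` C \<and> open {z \<in> C. N_orbit X Q z \<in> U}"
  unfolding toric_space_def openin_quotient_topology by (auto simp: openin_open_eq[OF open_C])

lemma N_orbit_in_image_nzset:
  "N_orbit X Q z \<in> N_orbit X Q ` nzset J \<longleftrightarrow> z \<in> nzset J"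
proof
  assume "N_orbit X Q z \<in> N_orbit X Q ` nzset J"
  then obtain y where y: "y \<in> nzset J" "N_orbit X Q y = N_orbit X Q z" by force
  obtain Z where "z = tact Z y" using N_orbit_eqD[OF y(2)] .
  then show "z \<in> nzset J" using y(1) by simp
qed simp

text \<open>Openness in the quotient is tested on the saturation. In logarithmic coordinates it is a
  union of preimages of \<open>U\<close> under the continuous maps \<open>cmul g\<close> after
  \<open>slice\<close>, and \<open>pexp\<close> is an open map.\<close>

lemma openin_toric_space_vertex_image:
  assumes s: "(\<sigma>, D) \<in> S" and U: "open U"
  shows "openin toric_space ((\<lambda>z. N_orbit X Q (spread \<sigma> 1 z)) ` U)"
  unfolding openin_toric_space_iff
proof
  note fr = frame[OF s]
  let ?V = "(\<lambda>z. N_orbit X Q (spread \<sigma> 1 z)) ` U"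
  show "?V \<subseteq> N_orbit X Q ` C" using nzset_subset_C[OF s] spread_in_nzset by blast
  have "{z \<in> C. N_orbit X Q z \<in> ?V} = pexp (- range \<sigma>) ` (\<Union>g\<in>vertex_group D. (\<lambda>y. cmul g (slice \<sigma> D y)) -` U)" (is "?L = ?R")
  proof (intro equalityI subsetI)
    fix z assume "z \<in> ?L"
    then obtain u where u: "u \<in> U" "N_orbit X Q z = N_orbit X Q (spread \<sigma> 1 u)" by blast
    then have "N_orbit X Q z \<in> N_orbit X Q ` nzset (- range \<sigma>)" using spread_in_nzset by blast
    then have "z \<in> nzset (- range \<sigma>)" by (simp only: N_orbit_in_image_nzset)
    then obtain y where y: "z = pexp (- range \<sigma>) y" using range_pexp by blast
    then have "N_orbit X Q (spread \<sigma> 1 (slice \<sigma> D y)) = N_orbit X Q (spread \<sigma> 1 u)"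
      using u(2) N_orbit_slice[OF fr] by simp
    then obtain g where "g \<in> vertex_group D" "u = cmul g (slice \<sigma> D y)" using N_orbit_spread_inj[OF fr] by blast
    then show "z \<in> ?R" using u(1) y by blast
  next
    fix z assume "z \<in> ?R"
    then obtain g y where gy: "g \<in> vertex_group D" "cmul g (slice \<sigma> D y) \<in> U" "z = pexp (- range \<sigma>) y" by blast
    have "N_orbit X Q z = N_orbit X Q (spread \<sigma> 1 (cmul g (slice \<sigma> D y)))"
      using N_orbit_slice[OF fr] N_orbit_spread_vertex_group[OF fr gy(1)] gy(3) by simp
    moreover have "z \<in> C" using gy(3) range_pexp nzset_subset_C[OF s] by blast
    ultimately show "z \<in> ?L" using gy(2) by blast
  qed
  moreover have "open ((\<lambda>y. cmul g (slice \<sigma> D y)) -` U)" for g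
  proof (rule open_vimage[OF U])
    have c: "continuous_on UNIV (cmul g)" by (rule cdiff_at_imp_continuous_on) (rule cdiff_at_cmul)
    show "continuous_on UNIV (\<lambda>y. cmul g (slice \<sigma> D y))"
      by (rule continuous_on_compose2[OF c continuous_on_slice]) simp
  qed
  ultimately show "open {z \<in> C. N_orbit X Q z \<in> ?V}" by (auto intro!: open_pexp_image)
qed

text \<open>Every \<open>N\<close>-orbit in the chart domain meets the slice.\<close>

lemma vertex_image_UNIV:
  assumes "(\<sigma>, D) \<in> S"
  shows "(\<lambda>z. N_orbit X Q (spread \<sigma> 1 z)) ` UNIV = N_orbit X Q ` nzset (- range \<sigma>)"
proof (intro equalityI subsetI)
  fix x assume "x \<in> N_orbit X Q ` nzset (- range \<sigma>)"
  then obtain y where "x = N_orbit X Q (pexp (- range \<sigma>) y)" unfolding range_pexp[symmetric] by blast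
  then have "x = N_orbit X Q (spread \<sigma> 1 (slice \<sigma> D y))" using N_orbit_slice[OF frame[OF assms]] by simp
  then show "x \<in> (\<lambda>z. N_orbit X Q (spread \<sigma> 1 z)) ` UNIV" by blast
qed auto

lemma continuous_on_spread: "continuous_on A (spread \<sigma> b)"
proof -
  have "continuous_on A (\<lambda>u. if j \<in> range \<sigma> then u $ inv_into UNIV \<sigma> j else b)" for j
    by (cases "j \<in> range \<sigma>") (auto intro!: continuous_intros)
  then show ?thesis unfolding spread_def by (rule continuous_on_vec_lambda)
qed

lemma quasifold_chart_vertex:
  assumes s: "(\<sigma>, D) \<in> S" shows "quasifold_chart toric_space (vertex_chart \<sigma> D)"
proof (rule quasifold_chartI)
  note fr = frame[OF s]
  have qp: "qparam (vertex_chart \<sigma> D) = (\<lambda>z. N_orbit X Q (spread \<sigma> 1 z))"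
    by (rule ext) (rule qparam_vertex_chart[OF fr])
  show "openin toric_space (qdom (vertex_chart \<sigma> D))"
    using openin_toric_space_vertex_image[OF s open_UNIV] by (simp add: vertex_image_UNIV[OF s])
  show "complex_model (open_mfd (qcov (vertex_chart \<sigma> D))) (qgrp (vertex_chart \<sigma> D))" by (rule vertex_chart_model)
  have "continuous_map euclidean (top_of_set C) (spread \<sigma> 1)"
    using nzset_subset_C[OF s] spread_in_nzset by (auto simp: continuous_map_in_subtopology continuous_on_spread)
  from continuous_map_compose[OF this continuous_map_N_orbit]
  show "continuous_map (top_of_set (qcov (vertex_chart \<sigma> D))) toric_space (qparam (vertex_chart \<sigma> D))"
    by (simp add: qp o_def)
  show "openin toric_space (qparam (vertex_chart \<sigma> D) ` U)" if "open U" for U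
    unfolding qp by (rule openin_toric_space_vertex_image[OF s that])
  show "qparam (vertex_chart \<sigma> D) ` qcov (vertex_chart \<sigma> D) = qdom (vertex_chart \<sigma> D)"
    unfolding qp vertex_chart_simps by (rule vertex_image_UNIV[OF s])
  show "qproj (vertex_chart \<sigma> D) z = qproj (vertex_chart \<sigma> D) z'"
    if eq: "qparam (vertex_chart \<sigma> D) z = qparam (vertex_chart \<sigma> D) z'" for z z'
  proof -
    obtain g where "g \<in> vertex_group D" "z' = cmul g z"
      using N_orbit_spread_inj[OF fr eq[unfolded qp]] by blast
    then have "\<exists>\<gamma>\<in>cmul ` vertex_group D. z' = \<gamma> z" by blast
    then show ?thesis using tg_orbit_eq_iff[OF vertex_group_subgroup[of D], of z z'] by simp
  qed
qed

text \<open>The filled-in coordinates are 1 and never vanish, so only coordinates at facets through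
  the first vertex but not the second are constrained.\<close>

lemma qoverlap_vertex:
  assumes "(\<sigma>, D) \<in> S" and "(\<tau>, D') \<in> S"
  shows "qoverlap (vertex_chart \<sigma> D) (vertex_chart \<tau> D') = nzset {i. \<sigma> i \<notin> range \<tau>}"
proof -
  note fr = frame[OF assms(1)]
  have inj: "inj \<sigma>" using fr by (simp add: normal_frame_def)
  have "spread \<sigma> 1 z \<in> nzset (- range \<tau>) \<longleftrightarrow> z \<in> nzset {i. \<sigma> i \<notin> range \<tau>}" for z
  proof
    assume "spread \<sigma> 1 z \<in> nzset (- range \<tau>)"
    then have "spread \<sigma> 1 z $ \<sigma> i \<noteq> 0" if "\<sigma> i \<notin> range \<tau>" for i using that by (auto simp: nzset_def)
    then show "z \<in> nzset {i. \<sigma> i \<notin> range \<tau>}" using inj by (simp add: nzset_def)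
  next
    assume z: "z \<in> nzset {i. \<sigma> i \<notin> range \<tau>}"
    have "spread \<sigma> 1 z $ j \<noteq> 0" if "j \<notin> range \<tau>" for j
    proof (cases "j \<in> range \<sigma>")
      case True
      then obtain i where "j = \<sigma> i" by blast
      then show ?thesis using z that inj by (simp add: nzset_def)
    qed simp
    then show "spread \<sigma> 1 z \<in> nzset (- range \<tau>)" by (simp add: nzset_def)
  qed
  then show ?thesis
    by (simp add: qoverlap_def qparam_vertex_chart[OF fr] N_orbit_in_image_nzset)
qed

text \<open>Both overlaps are covered by the full coordinate space. There the transitions are entire
  and inverse to each other, which with \<open>N_orbit_transition\<close> is all that compatibility
  asks.\<close>

lemma compatible_vertex_charts:
  assumes s: "(\<sigma>, D) \<in> S" and t: "(\<tau>, D') \<in> S"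
  shows "compatible_charts (vertex_chart \<sigma> D) (vertex_chart \<tau> D')"
proof -
  note fr = frame[OF s] and fr' = frame[OF t]
  have om: "overlap_model (vertex_chart \<sigma> D) (vertex_chart \<tau> D')" if "(\<sigma>, D) \<in> S" "(\<tau>, D') \<in> S" for \<sigma> \<tau> D D'
  proof -
    have "(\<lambda>\<gamma>. restrict \<gamma> (nzset J)) ` qgrp (vertex_chart \<sigma> D) = (\<lambda>g. restrict (cmul g) (nzset J)) ` vertex_group D" for J
      by (simp add: image_image)
    then show ?thesis unfolding overlap_model_def qoverlap_vertex[OF that] using vertex_group_model by simp
  qed
  let ?J = "{i. \<sigma> i \<notin> range \<tau>}" and ?K = "{k. \<tau> k \<notin> range \<sigma>}"
  have bi: "biholomorphic_mfd_map (cover_mfd euclidean (nzset ?J) (pexp ?J)) (cover_mfd euclidean (nzset ?K) (pexp ?K))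
     (transition \<sigma> \<tau> D')"
    by (rule cover_biholomorphicI[OF open_nzset open_nzset covering_map_pexp covering_map_pexp
          cover_holomorphic_pexp[OF cdiff_at_transition] cover_holomorphic_pexp[OF cdiff_at_transition]
          transition_inverse[OF fr fr'] transition_inverse[OF fr' fr]])
  show ?thesis
  proof (rule compatible_chartsI[OF quasifold_chart_vertex[OF s] quasifold_chart_vertex[OF t] om[OF s t] om[OF t s]
        simply_connected_space_euclidean simply_connected_space_euclidean])
    show "covering_map euclidean (top_of_set (qoverlap (vertex_chart \<sigma> D) (vertex_chart \<tau> D'))) (pexp ?J)"
      unfolding qoverlap_vertex[OF s t] by (rule covering_map_pexp)
    show "covering_map euclidean (top_of_set (qoverlap (vertex_chart \<tau> D') (vertex_chart \<sigma> D))) (pexp ?K)"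
      unfolding qoverlap_vertex[OF t s] by (rule covering_map_pexp)
    show "biholomorphic_mfd_map (cover_mfd euclidean (qoverlap (vertex_chart \<sigma> D) (vertex_chart \<tau> D')) (pexp ?J))
       (cover_mfd euclidean (qoverlap (vertex_chart \<tau> D') (vertex_chart \<sigma> D)) (pexp ?K)) (transition \<sigma> \<tau> D')"
      unfolding qoverlap_vertex[OF t s] qoverlap_vertex[OF s t] by (rule bi)
    show "qparam (vertex_chart \<tau> D') (pexp ?K (transition \<sigma> \<tau> D' u)) = qparam (vertex_chart \<sigma> D) (pexp ?J u)" for u
      unfolding qparam_vertex_chart[OF fr] qparam_vertex_chart[OF fr'] by (rule N_orbit_transition[OF fr fr'])
  qed
qed

lemma quasifold_exists:
  obtains A :: "((complex^'d) set, 'n) qchart set"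
  where "\<forall>(\<sigma>, D)\<in>S. vertex_chart \<sigma> D \<in> A" "complex_quasifold toric_space A"
proof -
  define A\<^sub>0 where "A\<^sub>0 = (\<lambda>(\<sigma>, D). vertex_chart \<sigma> D) ` S"
  obtain A where A: "A\<^sub>0 \<subseteq> A" "complex_quasifold toric_space A"
  proof (rule maximal_atlas_exists[of A\<^sub>0 toric_space])
    show "quasifold_chart toric_space c" if "c \<in> A\<^sub>0" for c using that quasifold_chart_vertex by (auto simp: A\<^sub>0_def)
    show "compatible_charts c c'" if "c \<in> A\<^sub>0" "c' \<in> A\<^sub>0" for c c'
      using that compatible_vertex_charts by (auto simp: A\<^sub>0_def)
    show "topspace toric_space \<subseteq> (\<Union>c\<in>A\<^sub>0. qdom c)"
    proof
      fix x assume "x \<in> topspace toric_space"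
      then obtain z where z: "x = N_orbit X Q z" "z \<in> C" by (auto simp: topspace_toric_space)
      then obtain \<sigma> D where "(\<sigma>, D) \<in> S" "z \<in> nzset (- range \<sigma>)" by (auto simp: C_eq)
      moreover from this have "vertex_chart \<sigma> D \<in> A\<^sub>0" by (force simp: A\<^sub>0_def)
      ultimately show "x \<in> (\<Union>c\<in>A\<^sub>0. qdom c)" unfolding z(1) by (intro UN_I) auto
    qed
  qed
  have "\<forall>(\<sigma>, D)\<in>S. vertex_chart \<sigma> D \<in> A" using A(1) by (auto simp: A\<^sub>0_def)
  then show ?thesis using A(2) by (rule that)
qed

section \<open>The action\<close>

text \<open>Restricted to the space, since a \<open>group_action\<close> consists of elements of
  \<open>Bij\<close>, which are extensional.\<close>

definition toric_act :: "(complex^'n) set \<Rightarrow> (complex^'d) set \<Rightarrow> (complex^'d) set" where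
  "toric_act = (\<lambda>g. \<lambda>x\<in>topspace toric_space. induced_act X Q g x)"

lemma act_N_orbit: "z \<in> C \<Longrightarrow> toric_act (quasitorus_proj Q (pi_C X Z)) (N_orbit X Q z) = N_orbit X Q (tact Z z)"
  unfolding toric_act_def by (simp add: topspace_toric_space induced_act_N_orbit)

lemma pi_C_surj: obtains Z where "pi_C X Z = v"
proof -
  obtain \<sigma> D where "(\<sigma>, D) \<in> S" using S_nonempty by auto
  then show ?thesis using that pi_C_spread_coord[OF frame] by blast
qed

lemma carrier_quasitorusE:
  assumes "g \<in> carrier (quasitorus Q)" obtains Z where "g = quasitorus_proj Q (pi_C X Z)"
proof -
  obtain v where v: "g = quasitorus_proj Q v" using assms by (auto simp: carrier_quasitorus)
  obtain Z where "pi_C X Z = v" by (rule pi_C_surj)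
  then show ?thesis using that v by blast
qed

text \<open>Since \<open>pi_C\<close> is surjective, every quasitorus element has an exponent
  \<open>Z\<close>, and on exponents the action is additive; \<open>- Z\<close> supplies the
  inverse.\<close>

lemma group_action_toric_act: "group_action (quasitorus Q) (topspace toric_space) toric_act"
proof -
  have maps: "toric_act (quasitorus_proj Q (pi_C X Z)) x \<in> topspace toric_space" if "x \<in> topspace toric_space" for Z x
    using that act_N_orbit by (auto simp: topspace_toric_space)
  have inv: "toric_act (quasitorus_proj Q (pi_C X Z)) (toric_act (quasitorus_proj Q (pi_C X Z')) x)
      = toric_act (quasitorus_proj Q (pi_C X (Z + Z'))) x" if x: "x \<in> topspace toric_space" for Z Z' x
  proof -
    obtain z where "z \<in> C" "x = N_orbit X Q z" using x by (auto simp: topspace_toric_space)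
    then show ?thesis by (simp add: act_N_orbit tact_tact)
  qed
  have one: "toric_act (quasitorus_proj Q (pi_C X 0)) x = x" if x: "x \<in> topspace toric_space" for x
  proof -
    obtain z where z: "z \<in> C" "x = N_orbit X Q z" using x by (auto simp: topspace_toric_space)
    show ?thesis unfolding z(2) act_N_orbit[OF z(1)] by simp
  qed
  have bij: "toric_act g \<in> Bij (topspace toric_space)" if g: "g \<in> carrier (quasitorus Q)" for g
  proof -
    obtain Z where Z: "g = quasitorus_proj Q (pi_C X Z)" using carrier_quasitorusE[OF g] .
    have "bij_betw (toric_act g) (topspace toric_space) (topspace toric_space)"
    proof (rule bij_betw_byWitness[where f' = "toric_act (quasitorus_proj Q (pi_C X (- Z)))"])
      show "\<forall>x\<in>topspace toric_space. toric_act (quasitorus_proj Q (pi_C X (- Z))) (toric_act g x) = x"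
        unfolding Z using inv[of _ "- Z" Z] one by simp
      show "\<forall>x\<in>topspace toric_space. toric_act g (toric_act (quasitorus_proj Q (pi_C X (- Z))) x) = x"
        unfolding Z using inv[of _ Z "- Z"] one by simp
      show "toric_act g ` topspace toric_space \<subseteq> topspace toric_space" unfolding Z by (intro image_subsetI maps)
      show "toric_act (quasitorus_proj Q (pi_C X (- Z))) ` topspace toric_space \<subseteq> topspace toric_space" by (intro image_subsetI maps)
    qed
    then show ?thesis by (simp add: Bij_def toric_act_def)
  qed
  have hom: "toric_act (g \<otimes>\<^bsub>quasitorus Q\<^esub> h) = compose (topspace toric_space) (toric_act g) (toric_act h)"
    if gh: "g \<in> carrier (quasitorus Q)" "h \<in> carrier (quasitorus Q)" for g h
  proof -
    obtain Z where Z: "g = quasitorus_proj Q (pi_C X Z)" using carrier_quasitorusE[OF gh(1)] .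
    obtain Z' where Z': "h = quasitorus_proj Q (pi_C X Z')" using carrier_quasitorusE[OF gh(2)] .
    show ?thesis
    proof
      fix x show "toric_act (g \<otimes>\<^bsub>quasitorus Q\<^esub> h) x = compose (topspace toric_space) (toric_act g) (toric_act h) x"
      proof (cases "x \<in> topspace toric_space")
        case True
        then show ?thesis using inv[OF True, of Z Z'] by (simp add: Z Z' compose_eq mult_quasitorus pi_C_add)
      qed (simp add: toric_act_def compose_def)
    qed
  qed
  have "toric_act \<in> Group.hom (quasitorus Q) (BijGroup (topspace toric_space))"
  proof (rule homI)
    show "toric_act g \<in> carrier (BijGroup (topspace toric_space))" if "g \<in> carrier (quasitorus Q)" for g
      using bij[OF that] by (simp add: BijGroup_def)
    show "toric_act (g \<otimes>\<^bsub>quasitorus Q\<^esub> h) = toric_act g \<otimes>\<^bsub>BijGroup (topspace toric_space)\<^esub> toric_act h"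
      if "g \<in> carrier (quasitorus Q)" "h \<in> carrier (quasitorus Q)" for g h
      using hom[OF that] bij[OF that(1)] bij[OF that(2)] by (simp add: BijGroup_def)
  qed
  then show ?thesis
    by (intro group_action.intro group_hom.intro group_hom_axioms.intro group_quasitorus group_BijGroup)
qed

abbreviation vertex_product :: "('n \<Rightarrow> 'd) \<Rightarrow> ('n \<Rightarrow> real^'n) \<Rightarrow> ((complex^'n) set \<times> (complex^'d) set, 'n + 'n) qchart" where
  "vertex_product \<sigma> D \<equiv> product_chart (quasitorus_chart Q) (vertex_chart \<sigma> D)"

definition act_lift :: "('n \<Rightarrow> real^'n) \<Rightarrow> complex^('n + 'n) \<Rightarrow> complex^'n" where
  "act_lift D z = cmul (\<chi> i. cexp (coord D (vleft z) $ i)) (vright z)"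

lemma cdiff_at_act_lift: "cdiff_at (act_lift D) z"
proof -
  have "cdiff_at1 (\<lambda>y :: complex^('n + 'n). vright y $ i) z" for i by (simp add: vright_def)
  then have "cdiff_at1 (\<lambda>y. act_lift D y $ i) z" for i
    by (simp add: act_lift_def cmul_def cdiff_at1_mult cdiff_at1_cexp cdiff_at1_coord[OF cdiff_at_vleft])
  then show ?thesis by (simp add: cdiff_at_iff_components)
qed

lemma vprod_UNIV [simp]: "vprod UNIV UNIV = UNIV"
  by (simp add: vprod_def)

lemma qparam_vertex_product:
  assumes s: "(\<sigma>, D) \<in> S"
  shows "qparam (vertex_product \<sigma> D) z = (quasitorus_proj Q (vleft z), N_orbit X Q (spread \<sigma> 1 (vright z)))"
proof -
  have "qparam (vertex_product \<sigma> D) z = (qparam (quasitorus_chart Q) (vleft z), qparam (vertex_chart \<sigma> D) (vright z))"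
    by (rule qparam_product_chart[OF qchart_group[OF quasifold_chart_quasitorus] qchart_group[OF quasifold_chart_vertex[OF s]]]) simp
  then show ?thesis by (simp add: qparam_quasitorus_chart qparam_vertex_chart[OF frame[OF s]])
qed

text \<open>The exponent that lifts a quasitorus element is chosen supported at the vertex, so that
  it preserves the slice.\<close>

lemma act_qparam:
  assumes s: "(\<sigma>, D) \<in> S"
  shows "case_prod toric_act (qparam (vertex_product \<sigma> D) z) = qparam (vertex_chart \<sigma> D) (act_lift D z)"
proof -
  note fr = frame[OF s]
  have inj: "inj \<sigma>" using fr by (simp add: normal_frame_def)
  let ?Z = "spread \<sigma> 0 (coord D (vleft z))"
  have "spread \<sigma> 1 (vright z) \<in> C" using nzset_subset_C[OF s] spread_in_nzset by blast
  then have "toric_act (quasitorus_proj Q (pi_C X ?Z)) (N_orbit X Q (spread \<sigma> 1 (vright z))) = N_orbit X Q (tact ?Z (spread \<sigma> 1 (vright z)))"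
    by (rule act_N_orbit)
  then show ?thesis
    by (simp add: qparam_vertex_product[OF s] pi_C_spread_coord[OF fr] qparam_vertex_chart[OF fr] act_lift_def spread_cmul[OF inj])
qed

lemma quasifold_chart_vertex_product:
  "(\<sigma>, D) \<in> S \<Longrightarrow> quasifold_chart (prod_topology (quasitorus_space Q) toric_space) (vertex_product \<sigma> D)"
  by (intro quasifold_chart_product quasifold_chart_quasitorus quasifold_chart_vertex)

lemma vertex_products_cover:
  assumes "p \<in> topspace (prod_topology (quasitorus_space Q) toric_space)"
  obtains \<sigma> D where "(\<sigma>, D) \<in> S" "p \<in> qdom (vertex_product \<sigma> D)"
proof -
  have p: "fst p \<in> range (quasitorus_proj Q)" "snd p \<in> N_orbit X Q ` C"
    using assms by (auto simp: topspace_quasitorus_space topspace_toric_space)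
  then obtain \<sigma> D where "(\<sigma>, D) \<in> S" "snd p \<in> N_orbit X Q ` nzset (- range \<sigma>)" unfolding C_eq by auto
  then show ?thesis using p(1) that[of \<sigma> D] by (simp add: mem_Times_iff)
qed

text \<open>The domain is a product of quotient topologies and is not presented as a quotient of a
  product, so continuity is not simply inherited from the torus action. Instead, preimages are
  written as images of open sets under the parametrizations of product charts, which are open
  maps.\<close>

lemma continuous_map_toric_act: "continuous_map (prod_topology (quasitorus_space Q) toric_space) toric_space (case_prod toric_act)"
  unfolding continuous_map_def
proof (intro conjI allI impI funcsetI)
  let ?T = "prod_topology (quasitorus_space Q) toric_space"
  have param: "\<exists>\<sigma> D z. (\<sigma>, D) \<in> S \<and> p = qparam (vertex_product \<sigma> D) z" if p: "p \<in> topspace ?T" for p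
  proof -
    obtain \<sigma> D where s: "(\<sigma>, D) \<in> S" "p \<in> qdom (vertex_product \<sigma> D)" using vertex_products_cover[OF p] .
    then show ?thesis using qparam_surj[OF quasifold_chart_vertex_product[OF s(1)]] by blast
  qed
  show "case_prod toric_act p \<in> topspace toric_space" if p: "p \<in> topspace ?T" for p
  proof -
    obtain \<sigma> D z where s: "(\<sigma>, D) \<in> S" "p = qparam (vertex_product \<sigma> D) z" using param[OF p] by blast
    have "qparam (vertex_chart \<sigma> D) (act_lift D z) \<in> qdom (vertex_chart \<sigma> D)"
      using qparam_surj[OF quasifold_chart_vertex[OF s(1)]] by auto
    then show ?thesis
      using openin_subset[OF qchart_openin_dom[OF quasifold_chart_vertex[OF s(1)]]] act_qparam[OF s(1)] s(2) by auto
  qed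
  fix U assume U: "openin toric_space U"
  let ?V = "\<lambda>\<sigma> D. qparam (vertex_product \<sigma> D) ` {z. qparam (vertex_chart \<sigma> D) (act_lift D z) \<in> U}"
  have "{p \<in> topspace ?T. case_prod toric_act p \<in> U} = (\<Union>(\<sigma>, D)\<in>S. ?V \<sigma> D)" (is "?L = ?R")
  proof (intro equalityI subsetI)
    fix p assume "p \<in> ?L"
    then have p: "p \<in> topspace ?T" "case_prod toric_act p \<in> U" by simp_all
    obtain \<sigma> D z where s: "(\<sigma>, D) \<in> S" "p = qparam (vertex_product \<sigma> D) z" using param[OF p(1)] by blast
    then have "p \<in> ?V \<sigma> D" using p(2) act_qparam[OF s(1)] by auto
    then show "p \<in> ?R" using s(1) by blast
  next
    fix p assume "p \<in> ?R"
    then obtain \<sigma> D z where s: "(\<sigma>, D) \<in> S" "p = qparam (vertex_product \<sigma> D) z" "qparam (vertex_chart \<sigma> D) (act_lift D z) \<in> U"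
      by auto
    have "p \<in> qdom (vertex_product \<sigma> D)"
      using qparam_surj[OF quasifold_chart_vertex_product[OF s(1)]] s(2) by auto
    then have "p \<in> topspace ?T"
      using openin_subset[OF qchart_openin_dom[OF quasifold_chart_vertex_product[OF s(1)]]] by blast
    then show "p \<in> ?L" using act_qparam[OF s(1)] s(2,3) by simp
  qed
  moreover have "openin ?T (?V \<sigma> D)" if s: "(\<sigma>, D) \<in> S" for \<sigma> D
  proof (rule qparam_open[OF quasifold_chart_vertex_product[OF s]])
    have "continuous_on UNIV (act_lift D)" by (rule cdiff_at_imp_continuous_on) (rule cdiff_at_act_lift)
    then have "continuous_map euclidean euclidean (act_lift D)" by simp
    moreover have "continuous_map euclidean toric_space (qparam (vertex_chart \<sigma> D))"
      using qparam_continuous[OF quasifold_chart_vertex[OF s]] by simp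
    ultimately have "continuous_map euclidean toric_space (qparam (vertex_chart \<sigma> D) \<circ> act_lift D)"
      by (rule continuous_map_compose)
    from openin_continuous_map_preimage[OF this U]
    show "open {z. qparam (vertex_chart \<sigma> D) (act_lift D z) \<in> U}" by simp
  qed simp
  ultimately show "openin ?T {p \<in> topspace ?T. case_prod toric_act p \<in> U}" by auto
qed

text \<open>The product of the quasitorus chart with a vertex chart lies in every admissible
  \<open>P\<close>, and such products cover the space. So the same charts and the same lift serve
  for all choices of \<open>B\<close> and \<open>P\<close>.\<close>

lemma holomorphic_toric_act:
  assumes A: "\<And>\<sigma> D. (\<sigma>, D) \<in> S \<Longrightarrow> vertex_chart \<sigma> D \<in> A"
    and B: "quasitorus_quasifold Q B" and P: "product_quasifold (quasitorus_space Q) B toric_space A P"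
  shows "holomorphic_quasifold_map (prod_topology (quasitorus_space Q) toric_space) P toric_space A (\<lambda>(g, x). toric_act g x)"
  unfolding holomorphic_quasifold_map_def
proof (intro conjI ballI)
  show "continuous_map (prod_topology (quasitorus_space Q) toric_space) toric_space (\<lambda>(g, x). toric_act g x)"
    using continuous_map_toric_act by simp
  fix p assume "p \<in> topspace (prod_topology (quasitorus_space Q) toric_space)"
  then obtain \<sigma> D where s: "(\<sigma>, D) \<in> S" "p \<in> qdom (vertex_product \<sigma> D)" by (rule vertex_products_cover)
  let ?c = "vertex_product \<sigma> D" and ?c' = "vertex_chart \<sigma> D"
  note ch = quasifold_chart_vertex_product[OF s(1)] and ch' = quasifold_chart_vertex[OF s(1)]
  have "?c \<in> P" using P B A[OF s(1)] by (simp add: product_quasifold_def quasitorus_quasifold_def)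
  moreover have "?c' \<in> A" by (rule A[OF s(1)])
  moreover have "(case p of (g, x) \<Rightarrow> toric_act g x) \<in> qdom ?c'"
  proof -
    obtain z where "p = qparam ?c z" using s(2) qparam_surj[OF ch] by blast
    then have "(case p of (g, x) \<Rightarrow> toric_act g x) = qparam ?c' (act_lift D z)" using act_qparam[OF s(1), of z] by simp
    also have "\<dots> \<in> qparam ?c' ` qcov ?c'" by (rule imageI) simp
    finally show ?thesis unfolding qparam_surj[OF ch'] .
  qed
  moreover have "\<exists>f\<^sub>m. holomorphic_model_map (open_mfd (qcov ?c)) (qproj ?c) (open_mfd (qcov ?c')) (qproj ?c') f\<^sub>m \<and>
     (\<forall>x\<in>topspace (qspace ?c). qmap ?c' (f\<^sub>m x) = (case qmap ?c x of (g, x) \<Rightarrow> toric_act g x))"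
  proof (intro exI conjI ballI)
    \<comment> \<open>The action carried over to orbit spaces; injectivity of the chart map turns it
      into the map induced by \<open>act_lift\<close>.\<close>
    let ?f = "inv_into (topspace (qspace ?c')) (qmap ?c') \<circ> case_prod toric_act \<circ> qmap ?c"
    have f: "?f (qproj ?c z) = qproj ?c' (act_lift D z)" for z
    proof -
      have "?f (qproj ?c z) = inv_into (topspace (qspace ?c')) (qmap ?c') (qmap ?c' (qproj ?c' (act_lift D z)))"
        using act_qparam[OF s(1), of z] by (simp add: qparam_def)
      moreover have "qproj ?c' (act_lift D z) \<in> topspace (qspace ?c')"
        unfolding topspace_qspace by (rule imageI) simp
      ultimately show ?thesis by (simp only: inv_into_f_f[OF qmap_inj[OF ch']])
    qed
    have "holomorphic_mfd_map (open_mfd (UNIV :: (complex^('n + 'n)) set)) (open_mfd UNIV) (act_lift D)"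
      by (simp add: holomorphic_open_mfd_iff cdiff_at_act_lift)
    then show "holomorphic_model_map (open_mfd (qcov ?c)) (qproj ?c) (open_mfd (qcov ?c')) (qproj ?c') ?f"
      unfolding holomorphic_model_map_def using f by (intro exI[of _ "act_lift D"]) simp
    fix x assume "x \<in> topspace (qspace ?c)"
    then obtain z where z: "x = qproj ?c z" unfolding topspace_qspace by blast
    show "qmap ?c' (?f x) = (case qmap ?c x of (g, x) \<Rightarrow> toric_act g x)"
      unfolding z f using act_qparam[OF s(1), of z] by (simp add: qparam_def)
  qed
  ultimately show "\<exists>c\<in>P. \<exists>c'\<in>A. p \<in> qdom c \<and> (case p of (g, x) \<Rightarrow> toric_act g x) \<in> qdom c' \<and>
      (\<exists>f\<^sub>m. holomorphic_model_map (open_mfd (qcov c)) (qproj c) (open_mfd (qcov c')) (qproj c') f\<^sub>m \<and>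
        (\<forall>x\<in>topspace (qspace c). qmap c' (f\<^sub>m x) = (case qmap c x of (g, x) \<Rightarrow> toric_act g x)))"
    using s(2) by (intro bexI[of _ ?c] bexI[of _ ?c'] conjI)
qed

text \<open>The orbit of the class of the all-ones vector is the image of the points without zero
  coordinates, since \<open>pexp UNIV\<close> reaches all of these. They form a saturated open set
  that is dense in \<open>C\<close>, and density passes to the quotient by continuity.\<close>

lemma dense_open_orbit:
  "\<exists>x\<in>topspace toric_space. openin toric_space (orbit (quasitorus Q) toric_act x) \<and> toric_space closure_of orbit (quasitorus Q) toric_act x = topspace toric_space"
proof -
  define e :: "complex^'d" where "e = (\<chi> j. 1)"
  have eC: "e \<in> C" using nzset_UNIV_subset_C by (auto simp: e_def nzset_def)
  have orb: "orbit (quasitorus Q) toric_act (N_orbit X Q e) = N_orbit X Q ` nzset UNIV"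
  proof (intro equalityI subsetI)
    fix x assume "x \<in> orbit (quasitorus Q) toric_act (N_orbit X Q e)"
    then obtain g where g: "g \<in> carrier (quasitorus Q)" "x = toric_act g (N_orbit X Q e)" by (auto simp: orbit_def)
    obtain Z where Z: "g = quasitorus_proj Q (pi_C X Z)" using carrier_quasitorusE[OF g(1)] .
    have "x = N_orbit X Q (tact Z e)" unfolding g(2) Z by (rule act_N_orbit[OF eC])
    moreover have "tact Z e \<in> nzset UNIV" by (simp add: nzset_def e_def)
    ultimately show "x \<in> N_orbit X Q ` nzset UNIV" by blast
  next
    fix x assume "x \<in> N_orbit X Q ` nzset UNIV"
    then obtain y where y: "x = N_orbit X Q (pexp UNIV y)" unfolding range_pexp[symmetric] by blast
    have "pexp UNIV y = tact y e" by (simp add: pexp_def tact_def e_def)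
    then have "x = toric_act (quasitorus_proj Q (pi_C X y)) (N_orbit X Q e)" using y act_N_orbit[OF eC] by simp
    then show "x \<in> orbit (quasitorus Q) toric_act (N_orbit X Q e)" by (auto simp: orbit_def carrier_quasitorus)
  qed
  have "{z \<in> C. N_orbit X Q z \<in> N_orbit X Q ` nzset UNIV} = nzset UNIV"
    using nzset_UNIV_subset_C by (auto simp: N_orbit_in_image_nzset)
  then have "openin toric_space (N_orbit X Q ` nzset UNIV)"
    unfolding openin_toric_space_iff using nzset_UNIV_subset_C open_nzset[of UNIV] by (auto simp: image_mono)
  moreover have "toric_space closure_of (N_orbit X Q ` nzset UNIV) = topspace toric_space"
  proof
    have "top_of_set C closure_of nzset UNIV = C"
      using nzset_UNIV_subset_C by (simp add: closure_of_subtopology closure_nzset Int_absorb1)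
    then show "topspace toric_space \<subseteq> toric_space closure_of (N_orbit X Q ` nzset UNIV)"
      using continuous_map_image_closure_subset[OF continuous_map_N_orbit, of "nzset UNIV"] by (simp add: topspace_toric_space)
  qed (rule closure_of_subset_topspace)
  ultimately show ?thesis using eC by (intro bexI[of _ "N_orbit X Q e"]) (auto simp: orb topspace_toric_space)
qed

lemma toric_theorem:
  "\<exists>A :: ((complex^'d) set, 'n) qchart set. complex_quasifold toric_space A \<and> holomorphic_quasitorus_action Q toric_space A toric_act \<and>
     (\<exists>x\<in>topspace toric_space. openin toric_space (orbit (quasitorus Q) toric_act x) \<and>
        toric_space closure_of orbit (quasitorus Q) toric_act x = topspace toric_space)"
proof -
  obtain A where "\<forall>(\<sigma>, D)\<in>S. vertex_chart \<sigma> D \<in> A" and A: "complex_quasifold toric_space A"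
    by (rule quasifold_exists)
  then have vA: "vertex_chart \<sigma> D \<in> A" if "(\<sigma>, D) \<in> S" for \<sigma> D using that by blast
  obtain B where B: "quasitorus_quasifold Q B" by (rule quasitorus_quasifold_exists)
  then have "complex_quasifold (quasitorus_space Q) B" by (simp add: quasitorus_quasifold_def)
  then obtain P where P: "product_quasifold (quasitorus_space Q) B toric_space A P"
    using A by (rule product_quasifold_exists)
  have "holomorphic_quasitorus_action Q toric_space A toric_act"
    unfolding holomorphic_quasitorus_action_def
    using group_action_toric_act B P holomorphic_toric_act[OF vA] by blast
  then show ?thesis using A dense_open_orbit by blast
qed

end

section \<open>Closure properties of integer spans, and the theorem\<close>

lemma int_span_add: "a \<in> int_span S \<Longrightarrow> b \<in> int_span S \<Longrightarrow> a + b \<in> int_span S"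
proof -
  assume "a \<in> int_span S" "b \<in> int_span S"
  then obtain t k t' k' where a: "finite t" "t \<subseteq> S" "a = (\<Sum>v\<in>t. of_int (k v) *\<^sub>R v)"
    and b: "finite t'" "t' \<subseteq> S" "b = (\<Sum>v\<in>t'. of_int (k' v) *\<^sub>R v)" by (auto simp: int_span_def)
  \<comment> \<open>Each coefficient function is extended by 0 to the union of the two index sets
    before they are added.\<close>
  define m where "m v = (if v \<in> t then k v else 0) + (if v \<in> t' then k' v else 0)" for v
  have "(\<Sum>v\<in>t \<union> t'. of_int (m v) *\<^sub>R v) =
      (\<Sum>v\<in>t \<union> t'. if v \<in> t then of_int (k v) *\<^sub>R v else 0) + (\<Sum>v\<in>t \<union> t'. if v \<in> t' then of_int (k' v) *\<^sub>R v else 0)"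
    unfolding sum.distrib[symmetric] by (rule sum.cong) (auto simp: m_def scaleR_add_left)
  also have "(\<Sum>v\<in>t \<union> t'. if v \<in> t then of_int (k v) *\<^sub>R v else 0) = a"
    unfolding a(3) using a(1) b(1) by (intro sum.mono_neutral_cong_right) auto
  also have "(\<Sum>v\<in>t \<union> t'. if v \<in> t' then of_int (k' v) *\<^sub>R v else 0) = b"
    unfolding b(3) using a(1) b(1) by (intro sum.mono_neutral_cong_right) auto
  finally have "a + b = (\<Sum>v\<in>t \<union> t'. of_int (m v) *\<^sub>R v)" by simp
  moreover have "finite (t \<union> t')" "t \<union> t' \<subseteq> S" using a b by auto
  ultimately show ?thesis unfolding int_span_def by blast
qed

lemma int_span_int: "a \<in> int_span S \<Longrightarrow> of_int m *\<^sub>R a \<in> int_span S"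
proof -
  assume "a \<in> int_span S"
  then obtain t k where a: "finite t" "t \<subseteq> S" "a = (\<Sum>v\<in>t. of_int (k v) *\<^sub>R v)" by (auto simp: int_span_def)
  then have "of_int m *\<^sub>R a = (\<Sum>v\<in>t. of_int (m * k v) *\<^sub>R v)" by (simp add: scaleR_sum_right)
  then show ?thesis using a(1,2) unfolding int_span_def by (intro CollectI exI[of _ t] exI[of _ "\<lambda>v. m * k v"]) simp
qed


theorem theorem2p2:
  fixes \<Delta> Q :: "(real^'n) set"
    and X :: "'d::finite \<Rightarrow> real^'n"
    and l :: "'d \<Rightarrow> real"
  assumes "simple_polytope \<Delta>"
    and "inward_normals \<Delta> X l"
    and "quasilattice Q"
    and "range X \<subseteq> Q"
  defines "M \<equiv> toric_quotient \<Delta> X l Q"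
  defines "act \<equiv> (\<lambda>g. \<lambda>x\<in>topspace M. induced_act X Q g x)"
  shows "\<exists>A :: ((complex^'d) set, 'n) qchart set.
           complex_quasifold M A \<and>
           holomorphic_quasitorus_action Q M A act \<and>
           (\<exists>x\<in>topspace M.
              openin M (orbit (quasitorus Q) act x) \<and>
              M closure_of orbit (quasitorus Q) act x = topspace M)"
proof -
  obtain S where S: "S \<noteq> {}" "\<forall>(\<sigma>, D)\<in>S. normal_frame X \<sigma> D"
    "C_Delta \<Delta> X l = (\<Union>(\<sigma>, D)\<in>S. {z. \<forall>j. z $ j = 0 \<longrightarrow> j \<in> range \<sigma>})"
    using C_Delta_eq_vertex_charts[OF assms(1,2)] .
  obtain G where Q: "Q = int_span G" using assms(3) by (auto simp: quasilattice_def)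
  have nz: "nzset (- range \<sigma>) = {z. \<forall>j. z $ j = 0 \<longrightarrow> j \<in> range \<sigma>}" for \<sigma> :: "'n \<Rightarrow> 'd"
    by (auto simp: nzset_def)
  interpret toric_atlas X Q S "C_Delta \<Delta> X l"
  proof
    show "a + b \<in> Q" if "a \<in> Q" "b \<in> Q" for a b using that int_span_add unfolding Q by blast
    show "of_int m *\<^sub>R a \<in> Q" if "a \<in> Q" for m a using that int_span_int unfolding Q by blast
    show "X j \<in> Q" for j using assms(4) by blast
    show "C_Delta \<Delta> X l = (\<Union>(\<sigma>, D)\<in>S. nzset (- range \<sigma>))" unfolding nz by (rule S(3))
  qed (use S in auto)
  have M: "M = toric_space" by (simp add: M_def toric_quotient_def toric_space_def)
  have act: "act = toric_act" by (simp add: act_def toric_act_def M)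
  show ?thesis unfolding M act by (rule toric_theorem)
qed

end
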